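(* Let $H$ be a balanced generalized sparse random matrix (as defined in the context) with parameter $\phi>0$, let $G(z)=(H-zI)^{-1}$ and $m(z)=\frac1N\operatorname{Tr}G(z)$. For $z=E+\mathrm{i}\eta\in\mathbb{C}^+$ define $$\psi(z):=\frac1q+\frac1{\sqrt{N\eta}} .$$ Then for any sufficiently small $\ell>0$ the estimates $$\max_{i\ne j}|G_{ij}(z)|\prec\psi(z),\qquad \max_{i}|G_{ii}(z)-m(z)|\prec\psi(z),\qquad |m(z)-m_{sc}(z)|\prec\frac1{\sqrt q}+\frac1{(N\eta)^{1/3}}$$ hold uniformly on the domain $\mathcal{D}_\ell=\{z=E+\mathrm{i}\eta\in\mathbb{C}^+:|E|<3,\ N^{-1+\ell}<\eta\le3\}$.
   Context: Model. $K\ge1$ is a fixed integer and $N\to\infty$ along multiples of $K$; all objects depend on $N$. The set $\{1,\dots,N\}$ is partitioned into communities $V_1,\dots,V_K$ with $|V_\ell|=N/K$; $i\sim j$ means that $i,j$ lie in the same community. A balanced generalized sparse random matrix with parameter $\phi>0$ is a real symmetric $N\times N$ random matrix $H=(H_{ij})$ with $H_{ii}=0$ almost surely, with $(H_{ij})_{i<j}$ independent, and $$\mathbb{E}H_{ij}=0,\quad \mathbb{E}|H_{ij}|^2=\sigma_{ij}^2,\quad \mathbb{E}|H_{ij}|^k\le\frac{(Ck)^{ck}}{Nq^{k-2}}\ (k\ge2),\quad \sum_{i=1}^N\sigma_{ij}^2=1\ \text{ for each } j,$$ with constants $C,c>0$ independent of $N$ and sparsity parameter $q=q_N$ satisfying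 $N^\phi\le q\le N^{1/2}$. Moreover, for $i\ne j$ the $k$-th cumulant of $H_{ij}$ depends only on whether $i\sim j$: it equals $\kappa_s^{(k)}$ if $i\sim j$ and $\kappa_d^{(k)}$ otherwise. If $K\ge2$, the intra- and inter-community variances are of similar order: $C^{-1}\kappa_d^{(2)}\le\kappa_s^{(2)}\le C\kappa_d^{(2)}$ for a constant $C\ge 1$ independent of $N$. $m_{sc}(z)=\frac{-z+\sqrt{z^2-4}}{2}$ is the Stieltjes transform of the semicircle law $\frac1{2\pi}\sqrt{(4-x^2)_+}\,dx$ (branch with $m_{sc}(z)\in\mathbb{C}^+$ for $z\in\mathbb{C}^+$). Stochastic domination: for non-negative $N$-dependent random variables $X(u),Y(u)$, $X\prec Y$ uniformly in $u$ means that for all small $\epsilon>0$ and large $D>0$ there is $N_0(\epsilon,D)$, independent of $u$, with $\mathbb{P}(X(u)>N^\epsilon Y(u))\le N^{-D}$ for $N\ge N_0$. *)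

theory Defs
  imports
    "HOL-Probability.Probability"
    "HOL-Computational_Algebra.Formal_Power_Series"
    "Jordan_Normal_Form.Gauss_Jordan_Elimination"
begin

text \<open>
  Matrices of size \<open>N\<close> are \<open>Jordan_Normal_Form\<close> matrices, so indices range over
  \<open>{..<N}\<close> rather than \<open>{1..N}\<close>.
\<close>

subsection \<open>The random matrix model\<close>

text \<open>
  Cumulants are the coefficients of the logarithm of the exponential moment series
  \<open>\<Sum>n. E[X^n] / n! t^n\<close>.  The logarithm is taken for formal power series because the moment
  generating function of \<open>X\<close> need not converge; \<open>fps_ln 1\<close> is the series of \<open>ln (1 + t)\<close>.
\<close>

definition moment_fps :: "'w measure \<Rightarrow> ('w \<Rightarrow> real) \<Rightarrow> real fps" where
  "moment_fps M X = Abs_fps (\<lambda>n. (\<integral>\<omega>. X \<omega> ^ n \<partial>M) / fact n)"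

definition cumulant :: "'w measure \<Rightarrow> ('w \<Rightarrow> real) \<Rightarrow> nat \<Rightarrow> real" where
  "cumulant M X k = fact k * fps_nth (fps_compose (fps_ln 1) (moment_fps M X - 1)) k"

definition balanced_partition :: "nat \<Rightarrow> nat \<Rightarrow> (nat \<Rightarrow> nat set) \<Rightarrow> bool" where
  "balanced_partition N K V \<longleftrightarrow>
     disjoint_family_on V {..<K} \<and> (\<Union>l<K. V l) = {..<N} \<and> (\<forall>l<K. card (V l) = N div K)"

definition same_community :: "nat \<Rightarrow> (nat \<Rightarrow> nat set) \<Rightarrow> nat \<Rightarrow> nat \<Rightarrow> bool" where
  "same_community K V i j \<longleftrightarrow> (\<exists>l<K. i \<in> V l \<and> j \<in> V l)"

text \<open>
  The model at one fixed matrix size \<open>N\<close>.  \<open>C\<close> and \<open>c\<close> are the constants of the moment bound,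
  \<open>L\<close> is the constant comparing intra- and inter-community variances; as parameters that do not
  depend on \<open>N\<close>, they are quantified outside.
\<close>

locale balanced_sparse_matrix = prob_space M
  for M :: "'w measure" +
  fixes N K :: nat
    and V :: "nat \<Rightarrow> nat set"
    and H :: "'w \<Rightarrow> real mat"
    and \<phi> q C c L :: real
    and \<kappa>s \<kappa>d :: "nat \<Rightarrow> real"
  assumes size_dvd: "K dvd N"
    and communities: "balanced_partition N K V"
    and H_dim: "\<And>\<omega>. \<omega> \<in> space M \<Longrightarrow> H \<omega> \<in> carrier_mat N N"
    and H_measurable: "\<And>i j. i < N \<Longrightarrow> j < N \<Longrightarrow> random_variable borel (\<lambda>\<omega>. H \<omega> $$ (i, j))"
    and H_symmetric:
      "\<And>\<omega> i j. \<omega> \<in> space M \<Longrightarrow> i < N \<Longrightarrow> j < N \<Longrightarrow> H \<omega> $$ (i, j) = H \<omega> $$ (j, i)"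
    and H_diag: "\<And>i. i < N \<Longrightarrow> AE \<omega> in M. H \<omega> $$ (i, i) = 0"
    and H_indep:
      "indep_vars (\<lambda>_. borel) (\<lambda>(i, j) \<omega>. H \<omega> $$ (i, j)) {(i, j). i < j \<and> j < N}"
    and H_integrable:
      "\<And>i j k. i < N \<Longrightarrow> j < N \<Longrightarrow> integrable M (\<lambda>\<omega>. \<bar>H \<omega> $$ (i, j)\<bar> ^ k)"
    and H_mean: "\<And>i j. i < N \<Longrightarrow> j < N \<Longrightarrow> expectation (\<lambda>\<omega>. H \<omega> $$ (i, j)) = 0"
    and H_variance_sum: "\<And>j. j < N \<Longrightarrow> (\<Sum>i<N. expectation (\<lambda>\<omega>. \<bar>H \<omega> $$ (i, j)\<bar>\<^sup>2)) = 1"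
    and H_moment_bound: "\<And>i j k. i < N \<Longrightarrow> j < N \<Longrightarrow> 2 \<le> k \<Longrightarrow>
      expectation (\<lambda>\<omega>. \<bar>H \<omega> $$ (i, j)\<bar> ^ k)
        \<le> (C * real k) powr (c * real k) / (real N * q ^ (k - 2))"
    and sparsity: "real N powr \<phi> \<le> q" "q \<le> real N powr (1 / 2)"
    and H_cumulants: "\<And>i j k. i < N \<Longrightarrow> j < N \<Longrightarrow> i \<noteq> j \<Longrightarrow> 1 \<le> k \<Longrightarrow>
      cumulant M (\<lambda>\<omega>. H \<omega> $$ (i, j)) k = (if same_community K V i j then \<kappa>s k else \<kappa>d k)"
    and similar_variances: "2 \<le> K \<Longrightarrow> \<kappa>d 2 / L \<le> \<kappa>s 2 \<and> \<kappa>s 2 \<le> L * \<kappa>d 2"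


subsection \<open>Resolvent and semicircle law\<close>

text \<open>
  For symmetric \<open>A\<close> and non-real \<open>z\<close> the matrix \<open>A - z I\<close> is invertible, so that
  \<open>mat_inverse\<close> returns \<open>Some\<close> of its inverse.
\<close>

definition resolvent :: "real mat \<Rightarrow> complex \<Rightarrow> complex mat" where
  "resolvent A z = the (mat_inverse (map_mat complex_of_real A - z \<cdot>\<^sub>m 1\<^sub>m (dim_row A)))"

definition mat_trace :: "complex mat \<Rightarrow> complex" where
  "mat_trace A = (\<Sum>i<dim_row A. A $$ (i, i))"

definition m_emp :: "nat \<Rightarrow> real mat \<Rightarrow> complex \<Rightarrow> complex" where
  "m_emp N A z = mat_trace (resolvent A z) / of_nat N"

text \<open>
  The sign of the square root of \<open>z\<^sup>2 - 4\<close> is the one that puts the value into the upper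
  half-plane; for \<open>z\<close> in the upper half-plane exactly one of the two signs does.
\<close>

definition m_sc :: "complex \<Rightarrow> complex" where
  "m_sc z = (let w = csqrt (z\<^sup>2 - 4) in
     if Im ((- z + w) / 2) > 0 then (- z + w) / 2 else (- z - w) / 2)"

definition psi :: "nat \<Rightarrow> real \<Rightarrow> complex \<Rightarrow> real" where
  "psi N q z = 1 / q + 1 / sqrt (real N * Im z)"

definition spectral_domain :: "real \<Rightarrow> nat \<Rightarrow> complex set" where
  "spectral_domain l N =
     {z. Im z > 0 \<and> \<bar>Re z\<bar> < 3 \<and> real N powr (- 1 + l) < Im z \<and> Im z \<le> 3}"


subsection \<open>Stochastic domination\<close>

text \<open>
  \<open>X\<close> is stochastically dominated by \<open>Y\<close>, uniformly in \<open>u \<in> U N\<close>, as \<open>N \<rightarrow> \<infinity>\<close> along the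
  multiples of \<open>K\<close>.  The exceptional set is required to be an event because \<open>measure\<close> is \<open>0\<close> on
  non-measurable sets.
\<close>

definition stoch_dom ::
  "nat \<Rightarrow> (nat \<Rightarrow> 'w measure) \<Rightarrow> (nat \<Rightarrow> 'u set) \<Rightarrow>
   (nat \<Rightarrow> 'u \<Rightarrow> 'w \<Rightarrow> real) \<Rightarrow> (nat \<Rightarrow> 'u \<Rightarrow> 'w \<Rightarrow> real) \<Rightarrow> bool" where
  "stoch_dom K M U X Y \<longleftrightarrow>
     (\<forall>\<epsilon>>0. \<forall>D>0. \<exists>N0. \<forall>N\<ge>N0. K dvd N \<longrightarrow> (\<forall>u\<in>U N.
        {\<omega> \<in> space (M N). X N u \<omega> > real N powr \<epsilon> * Y N u \<omega>} \<in> sets (M N) \<and>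
        measure (M N) {\<omega> \<in> space (M N). X N u \<omega> > real N powr \<epsilon> * Y N u \<omega>}
          \<le> real N powr (- D)))"

end

(*
  Schur's complement formula writes 1 / G_ii as -z minus a quadratic form in the i-th row of H,
  whose coefficients come from the resolvent of the minor without row and column i and are hence
  independent of that row.  High-moment bounds for sums and quadratic forms of independent sparse
  variables, together with the Ward identity for the resolvent, replace the quadratic form by its
  mean up to an error of order 1/q + sqrt (Im m / (N eta)) + 1 / (N eta).  As all off-diagonal
  variances are comparable to 1/N, averaging with respect to the variances contracts oscillations,
  so all G_ii are close to m, and m nearly solves m^2 + z m + 1 = 0.  The a priori bounds needed
  for this, and the choice of the root m_sc, are propagated from Im z >= 3 down a fine vertical
  grid of spectral parameters by the Lipschitz continuity of the resolvent.
*)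

theory Submission
  imports Defs "Jordan_Normal_Form.Determinant" "HOL-Real_Asymp.Real_Asymp"
begin

hide_const (open) Determinants.det Finite_Cartesian_Product.vec

section \<open>Resolvents of real symmetric matrices\<close>

text \<open>Probability and analysis are kept apart. Each row estimate bounds a form by the actual
  size of its own random coefficients (\<open>minor_max\<close> and a sum of squares), not by an
  assumed smallness of the resolvent. It can therefore be proved for frozen coefficients, and the
  events of all grid points can be intersected before any induction starts. Moments of every order
  are available, so at the price of a factor \<open>R\<close>, a small power of \<open>N\<close>,
  each event fails with probability below any fixed power of \<open>N\<close>, and a union bound
  over polynomially many events is harmless. The rest concerns one fixed matrix
  (\<open>sparse_instance\<close>). Two obstacles shape that part. With several communities the rows
  obey different averaged equations; the contraction factor depends on \<open>L\<close> only, and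
  since \<open>m_sc\<close> lies in the unit disc the product \<open>G i i * G j j\<close> cannot
  destroy it. And the two roots of the limiting equation, \<open>m_sc\<close> and its reciprocal,
  approach each other near the spectral edges, where the size of \<open>m\<close> does not tell them
  apart; only continuity along the path does.\<close>

lemma sum_delta_mult:
  fixes f :: "nat \<Rightarrow> complex"
  assumes "i < N"
  shows "(\<Sum>k<N. (if k = i then a else 0) * f k) = a * f i"
    and "(\<Sum>k<N. (if i = k then a else 0) * f k) = a * f i"
    and "(\<Sum>k<N. f k * (if k = i then a else 0)) = a * f i"
    and "(\<Sum>k<N. f k * (if i = k then a else 0)) = a * f i"
  using assms by (simp_all add: if_distrib[of "\<lambda>x. x * _"] if_distrib[of "\<lambda>x. _ * x"] cong: if_cong)

locale sym_resolvent =
  fixes N :: nat and A :: "real mat" and z :: complex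
  assumes carrier: "A \<in> carrier_mat N N"
    and sym: "\<And>i j. i < N \<Longrightarrow> j < N \<Longrightarrow> A $$ (i, j) = A $$ (j, i)"
    and Im_nz: "Im z \<noteq> 0"
begin

abbreviation G :: "nat \<Rightarrow> nat \<Rightarrow> complex" where
  "G i j \<equiv> resolvent A z $$ (i, j)"

abbreviation B :: "complex mat" where
  "B \<equiv> map_mat complex_of_real A - z \<cdot>\<^sub>m 1\<^sub>m (dim_row A)"

lemma B_carrier: "B \<in> carrier_mat N N"
  using carrier by auto

lemma B_index: "i < N \<Longrightarrow> j < N \<Longrightarrow> B $$ (i, j) = of_real (A $$ (i, j)) - (if i = j then z else 0)"
  using carrier by auto

text \<open>A kernel vector \<open>f\<close> would make the quadratic form of \<open>A\<close> at
  \<open>f\<close> equal to \<open>z\<close> times the squared norm of \<open>f\<close>. Symmetry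
  makes that form real, while \<open>Im z\<close> is nonzero.\<close>

lemma det_B: "det B \<noteq> 0"
proof
  assume "det B = 0"
  then obtain v where v: "v \<in> carrier_vec N" "v \<noteq> 0\<^sub>v N" "B *\<^sub>v v = 0\<^sub>v N"
    using det_0_iff_vec_prod_zero[OF B_carrier] by auto
  define f where "f i = v $ i" for i
  have eq: "(\<Sum>k<N. of_real (A $$ (i, k)) * f k) = z * f i" if "i < N" for i
  proof -
    have "(B *\<^sub>v v) $ i = (\<Sum>k<N. B $$ (i, k) * f k)"
      using that v(1) B_carrier unfolding f_def
      by (simp add: scalar_prod_def atLeast0LessThan del: index_minus_mat)
    also have "\<dots> = (\<Sum>k<N. of_real (A $$ (i, k)) * f k - (if i = k then z else 0) * f k)"
      by (intro sum.cong refl) (use that in \<open>simp add: B_index left_diff_distrib del: index_minus_mat\<close>)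
    also have "\<dots> = (\<Sum>k<N. of_real (A $$ (i, k)) * f k) - z * f i"
      using that by (simp only: sum_subtractf sum_delta_mult)
    finally show ?thesis using v(3) that by simp
  qed
  define S where "S = (\<Sum>i<N. \<Sum>k<N. cnj (f i) * of_real (A $$ (i, k)) * f k)"
  have "cnj S = (\<Sum>i<N. \<Sum>k<N. f i * of_real (A $$ (i, k)) * cnj (f k))"
    unfolding S_def by (simp add: cnj_sum)
  also have "\<dots> = (\<Sum>k<N. \<Sum>i<N. f i * of_real (A $$ (i, k)) * cnj (f k))"
    by (rule sum.swap)
  also have "\<dots> = S" unfolding S_def
    by (intro sum.cong refl) (simp add: sym mult_ac)
  finally have "Im S = 0" by (metis Reals_cnj_iff complex_is_Real_iff)
  moreover have "S = (\<Sum>i<N. cnj (f i) * (z * f i))"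
    unfolding S_def by (intro sum.cong refl) (simp add: eq[symmetric] sum_distrib_left mult_ac)
  then have "S = z * of_real (\<Sum>i<N. (cmod (f i))\<^sup>2)"
    by (simp add: sum_distrib_left complex_norm_square mult_ac del: of_real_power)
  ultimately have "(\<Sum>i<N. (cmod (f i))\<^sup>2) = 0" using Im_nz by auto
  then have "\<forall>i<N. f i = 0" by (subst (asm) sum_nonneg_eq_0_iff) auto
  then have "v = 0\<^sub>v N" using v(1) unfolding f_def by auto
  then show False using v(2) by simp
qed

lemma resolvent_inverse:
  "B * resolvent A z = 1\<^sub>m N" "resolvent A z * B = 1\<^sub>m N"
  and resolvent_carrier: "resolvent A z \<in> carrier_mat N N"
proof -
  have "B \<in> Units (ring_mat TYPE(complex) N ())"
    using det_non_zero_imp_unit[OF B_carrier det_B] .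
  then obtain R where R: "mat_inverse B = Some R"
    using mat_inverse(1)[OF B_carrier, where b = "()"] by (cases "mat_inverse B") auto
  then have "resolvent A z = R" unfolding resolvent_def by simp
  with mat_inverse(2)[OF B_carrier R]
  show "B * resolvent A z = 1\<^sub>m N" "resolvent A z * B = 1\<^sub>m N" "resolvent A z \<in> carrier_mat N N"
    by auto
qed

lemma resolvent_right:
  assumes "i < N" "j < N"
  shows "(\<Sum>k<N. of_real (A $$ (i, k)) * G k j) = (if i = j then 1 else 0) + z * G i j"
proof -
  have "(B * resolvent A z) $$ (i, j) = (\<Sum>k<N. B $$ (i, k) * G k j)"
    using assms B_carrier resolvent_carrier
    by (simp add: scalar_prod_def atLeast0LessThan del: index_minus_mat)
  also have "\<dots> = (\<Sum>k<N. of_real (A $$ (i, k)) * G k j - (if i = k then z else 0) * G k j)"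
    by (intro sum.cong refl) (use assms in \<open>simp add: B_index left_diff_distrib del: index_minus_mat\<close>)
  also have "\<dots> = (\<Sum>k<N. of_real (A $$ (i, k)) * G k j) - z * G i j"
    using assms by (simp only: sum_subtractf sum_delta_mult)
  finally show ?thesis using assms resolvent_inverse(1) by simp
qed

lemma resolvent_left:
  assumes "i < N" "j < N"
  shows "(\<Sum>k<N. G i k * of_real (A $$ (k, j))) = (if i = j then 1 else 0) + z * G i j"
proof -
  have "(resolvent A z * B) $$ (i, j) = (\<Sum>k<N. G i k * B $$ (k, j))"
    using assms B_carrier resolvent_carrier
    by (simp add: scalar_prod_def atLeast0LessThan del: index_minus_mat)
  also have "\<dots> = (\<Sum>k<N. G i k * of_real (A $$ (k, j)) - G i k * (if k = j then z else 0))"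
    by (intro sum.cong refl) (use assms in \<open>simp add: B_index right_diff_distrib del: index_minus_mat\<close>)
  also have "\<dots> = (\<Sum>k<N. G i k * of_real (A $$ (k, j))) - z * G i j"
    using assms by (simp only: sum_subtractf sum_delta_mult)
  finally show ?thesis using assms resolvent_inverse(2) by simp
qed

text \<open>Sandwich \<open>A\<close> between the resolvent and the candidate \<open>F\<close> and
  evaluate the double sum from either side. Symmetry and conjugation of the resolvent follow by
  inserting transposed or conjugated entries for \<open>F\<close>.\<close>

lemma resolvent_unique:
  assumes F: "\<And>i j. i < N \<Longrightarrow> j < N \<Longrightarrow>
      (\<Sum>k<N. of_real (A $$ (i, k)) * F k j) = (if i = j then 1 else 0) + z * F i j"
    and ij: "i < N" "j < N"
  shows "F i j = G i j"
proof -
  have "(\<Sum>k<N. \<Sum>l<N. G i k * of_real (A $$ (k, l)) * F l j)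
      = (\<Sum>k<N. G i k * ((if k = j then 1 else 0) + z * F k j))"
    by (intro sum.cong refl) (simp add: F ij sum_distrib_left[symmetric] mult.assoc)
  also have "\<dots> = G i j + z * (\<Sum>k<N. G i k * F k j)"
    using ij by (simp only: distrib_left sum.distrib sum_delta_mult) (simp add: sum_distrib_left mult_ac)
  finally have 1: "(\<Sum>k<N. \<Sum>l<N. G i k * of_real (A $$ (k, l)) * F l j) = \<dots>" .
  have "(\<Sum>k<N. \<Sum>l<N. G i k * of_real (A $$ (k, l)) * F l j)
      = (\<Sum>l<N. \<Sum>k<N. G i k * of_real (A $$ (k, l)) * F l j)" by (rule sum.swap)
  also have "\<dots> = (\<Sum>l<N. ((if i = l then 1 else 0) + z * G i l) * F l j)"
    by (intro sum.cong refl) (simp add: resolvent_left ij sum_distrib_right[symmetric])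
  also have "\<dots> = F i j + z * (\<Sum>k<N. G i k * F k j)"
    using ij by (simp only: distrib_right sum.distrib sum_delta_mult) (simp add: sum_distrib_left mult_ac)
  finally show ?thesis using 1 by simp
qed

lemma resolvent_sym: "i < N \<Longrightarrow> j < N \<Longrightarrow> G i j = G j i"
proof -
  assume ij: "i < N" "j < N"
  have "(\<lambda>i j. G j i) i j = G i j"
  proof (rule resolvent_unique[OF _ ij])
    fix i j assume *: "i < N" "j < N"
    have "(\<Sum>k<N. of_real (A $$ (i, k)) * G j k) = (\<Sum>k<N. G j k * of_real (A $$ (k, i)))"
      by (intro sum.cong refl) (simp add: * sym mult_ac)
    then show "(\<Sum>k<N. of_real (A $$ (i, k)) * G j k) = (if i = j then 1 else 0) + z * G j i"
      using resolvent_left[of j i] * by auto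
  qed
  then show ?thesis by simp
qed

lemma resolvent_cnj: "i < N \<Longrightarrow> j < N \<Longrightarrow> resolvent A (cnj z) $$ (i, j) = cnj (G i j)"
proof -
  assume ij: "i < N" "j < N"
  interpret c: sym_resolvent N A "cnj z" by unfold_locales (use carrier sym Im_nz in auto)
  have "(\<lambda>i j. cnj (G i j)) i j = resolvent A (cnj z) $$ (i, j)"
  proof (rule c.resolvent_unique[OF _ ij])
    fix i j assume *: "i < N" "j < N"
    have "cnj (\<Sum>k<N. of_real (A $$ (i, k)) * G k j) = cnj ((if i = j then 1 else 0) + z * G i j)"
      using resolvent_right * by simp
    then show "(\<Sum>k<N. of_real (A $$ (i, k)) * cnj (G k j)) = (if i = j then 1 else 0) + cnj z * cnj (G i j)"
      by (simp add: cnj_sum)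
  qed
  then show ?thesis by simp
qed

end

text \<open>Evaluate the product of the two resolvents around \<open>A\<close> and around
  \<open>A'\<close> by the outer equations and subtract. Since both matrix and spectral parameter
  may change, one formula yields the Ward identity (parameter \<open>cnj z\<close>), Lipschitz
  continuity in \<open>z\<close>, and Schur's formula (row \<open>i\<close> zeroed).\<close>

lemma resolvent_identity:
  assumes "sym_resolvent N A z" "sym_resolvent N A' z'" and ij: "i < N" "j < N"
  shows "resolvent A z $$ (i, j) - resolvent A' z' $$ (i, j) =
     (z - z') * (\<Sum>k<N. resolvent A z $$ (i, k) * resolvent A' z' $$ (k, j)) +
     (\<Sum>k<N. \<Sum>l<N. resolvent A z $$ (i, k) * of_real (A' $$ (k, l) - A $$ (k, l)) * resolvent A' z' $$ (l, j))"
proof -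
  interpret a: sym_resolvent N A z by fact
  interpret b: sym_resolvent N A' z' by fact
  let ?F = a.G and ?G = b.G
  have "(\<Sum>k<N. \<Sum>l<N. ?F i k * of_real (A' $$ (k, l)) * ?G l j)
      = (\<Sum>k<N. ?F i k * ((if k = j then 1 else 0) + z' * ?G k j))"
    by (intro sum.cong refl) (simp add: b.resolvent_right ij sum_distrib_left[symmetric] mult.assoc)
  also have "\<dots> = ?F i j + z' * (\<Sum>k<N. ?F i k * ?G k j)"
    using ij by (simp only: distrib_left sum.distrib sum_delta_mult) (simp add: sum_distrib_left mult_ac)
  finally have 1: "(\<Sum>k<N. \<Sum>l<N. ?F i k * of_real (A' $$ (k, l)) * ?G l j) = \<dots>" .
  have "(\<Sum>k<N. \<Sum>l<N. ?F i k * of_real (A $$ (k, l)) * ?G l j)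
      = (\<Sum>l<N. \<Sum>k<N. ?F i k * of_real (A $$ (k, l)) * ?G l j)" by (rule sum.swap)
  also have "\<dots> = (\<Sum>l<N. ((if i = l then 1 else 0) + z * ?F i l) * ?G l j)"
    by (intro sum.cong refl) (simp add: a.resolvent_left ij sum_distrib_right[symmetric])
  also have "\<dots> = ?G i j + z * (\<Sum>k<N. ?F i k * ?G k j)"
    using ij by (simp only: distrib_right sum.distrib sum_delta_mult) (simp add: sum_distrib_left mult_ac)
  finally have 2: "(\<Sum>k<N. \<Sum>l<N. ?F i k * of_real (A $$ (k, l)) * ?G l j) = \<dots>" .
  have "(\<Sum>k<N. \<Sum>l<N. ?F i k * of_real (A' $$ (k, l) - A $$ (k, l)) * ?G l j) =
     (\<Sum>k<N. \<Sum>l<N. ?F i k * of_real (A' $$ (k, l)) * ?G l j)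
     - (\<Sum>k<N. \<Sum>l<N. ?F i k * of_real (A $$ (k, l)) * ?G l j)"
    by (simp add: algebra_simps sum_subtractf)
  with 1 2 show ?thesis by (simp add: algebra_simps)
qed

section \<open>Ward identity and the bounds that follow from it\<close>

context sym_resolvent begin

text \<open>Take \<open>cnj z\<close> as second parameter in the resolvent identity; by symmetry the
  product sum becomes a sum of squared moduli.\<close>

lemma ward:
  assumes i: "i < N"
  shows "Im z * (\<Sum>k<N. (cmod (G i k))\<^sup>2) = Im (G i i)"
proof -
  have c: "sym_resolvent N A (cnj z)" by unfold_locales (use carrier sym Im_nz in auto)
  have "G i i - cnj (G i i) = (z - cnj z) * (\<Sum>k<N. G i k * cnj (G k i))"
    using resolvent_identity[OF sym_resolvent_axioms c i i] i by (simp add: resolvent_cnj)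
  also have "(\<Sum>k<N. G i k * cnj (G k i)) = of_real (\<Sum>k<N. (cmod (G i k))\<^sup>2)"
    unfolding of_real_sum by (intro sum.cong refl) (simp add: complex_norm_square[symmetric] resolvent_sym[of _ i] i)
  finally show ?thesis by (simp add: complex_eq_iff)
qed

lemma ward_div: "i < N \<Longrightarrow> (\<Sum>k<N. (cmod (G i k))\<^sup>2) = Im (G i i) / Im z"
  using ward[of i] Im_nz by (simp add: field_simps)

text \<open>The squared modulus of \<open>G i i\<close> is itself a term of the Ward sum, and
  \<open>Im (G i i)\<close> is at most the modulus. Dividing out one modulus gives the usual norm
  bound without spectral decomposition.\<close>

lemma norm_diag_le:
  assumes "Im z > 0" "i < N"
  shows "cmod (G i i) \<le> 1 / Im z"
proof -
  have "(cmod (G i i))\<^sup>2 \<le> (\<Sum>k<N. (cmod (G i k))\<^sup>2)"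
    by (rule member_le_sum) (use assms in auto)
  also have "\<dots> \<le> cmod (G i i) / Im z"
    using assms by (simp add: ward_div divide_right_mono abs_Im_le_cmod[THEN order_trans[OF abs_ge_self]])
  finally have "cmod (G i i) * cmod (G i i) \<le> cmod (G i i) * (1 / Im z)"
    by (simp add: power2_eq_square)
  then show ?thesis
    using assms mult_left_le_imp_le[of "cmod (G i i)" "cmod (G i i)" "1 / Im z"] by (cases "G i i = 0") simp_all
qed

lemma sum_sq_le:
  assumes "Im z > 0" "i < N"
  shows "(\<Sum>k<N. (cmod (G i k))\<^sup>2) \<le> (1 / Im z)\<^sup>2"
proof -
  have "(\<Sum>k<N. (cmod (G i k))\<^sup>2) \<le> cmod (G i i) / Im z"
    using assms by (simp add: ward_div divide_right_mono abs_Im_le_cmod[THEN order_trans[OF abs_ge_self]])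
  also have "\<dots> \<le> (1 / Im z) / Im z"
    using norm_diag_le[OF assms] assms by (intro divide_right_mono) auto
  finally show ?thesis by (simp add: power2_eq_square)
qed

lemma norm_entry_le:
  assumes "Im z > 0" "i < N" "j < N"
  shows "cmod (G i j) \<le> 1 / Im z"
proof -
  have "(cmod (G i j))\<^sup>2 \<le> (\<Sum>k<N. (cmod (G i k))\<^sup>2)"
    by (rule member_le_sum) (use assms in auto)
  also have "\<dots> \<le> (1 / Im z)\<^sup>2" by (rule sum_sq_le) fact+
  finally show ?thesis by (rule power2_le_imp_le) (use assms in auto)
qed

lemma Im_diag_nonneg: "Im z > 0 \<Longrightarrow> i < N \<Longrightarrow> 0 \<le> Im (G i i)"
  unfolding ward[symmetric] by (intro mult_nonneg_nonneg sum_nonneg) auto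

end

text \<open>Cauchy-Schwarz in the resolvent identity, each row being bounded in the euclidean norm
  by the reciprocal of the imaginary part.\<close>

lemma resolvent_lipschitz:
  assumes "sym_resolvent N A z" "sym_resolvent N A w" "Im z > 0" "Im w > 0" "i < N" "j < N"
  shows "cmod (resolvent A z $$ (i, j) - resolvent A w $$ (i, j)) \<le> cmod (z - w) / (Im z * Im w)"
proof -
  interpret a: sym_resolvent N A z by fact
  interpret b: sym_resolvent N A w by fact
  have "cmod (\<Sum>k<N. a.G i k * b.G k j) \<le> (\<Sum>k<N. \<bar>cmod (a.G i k)\<bar> * \<bar>cmod (b.G k j)\<bar>)"
    by (rule order_trans[OF norm_sum]) (simp add: norm_mult)
  also have "\<dots> \<le> L2_set (\<lambda>k. cmod (a.G i k)) {..<N} * L2_set (\<lambda>k. cmod (b.G k j)) {..<N}"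
    by (rule L2_set_mult_ineq)
  also have "L2_set (\<lambda>k. cmod (b.G k j)) {..<N} = L2_set (\<lambda>k. cmod (b.G j k)) {..<N}"
    by (rule L2_set_cong) (use assms in \<open>auto simp: b.resolvent_sym\<close>)
  also have "L2_set (\<lambda>k. cmod (a.G i k)) {..<N} * L2_set (\<lambda>k. cmod (b.G j k)) {..<N}
      \<le> (1 / Im z) * (1 / Im w)"
    unfolding L2_set_def
    by (intro mult_mono real_le_lsqrt a.sum_sq_le b.sum_sq_le) (use assms in \<open>auto intro: sum_nonneg\<close>)
  finally have "cmod (\<Sum>k<N. a.G i k * b.G k j) \<le> 1 / (Im z * Im w)" by simp
  then have "cmod (z - w) * cmod (\<Sum>k<N. a.G i k * b.G k j) \<le> cmod (z - w) * (1 / (Im z * Im w))"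
    by (rule mult_left_mono) simp
  then show ?thesis
    using resolvent_identity[OF assms(1,2,5,6)] by (simp add: norm_mult)
qed

text \<open>Row and column \<open>i\<close> are zeroed rather than removed, so that all matrices have size \<open>N\<close>.  Away from
  index \<open>i\<close> the resolvent is that of the minor; its entry at \<open>(i, i)\<close> is \<open>- 1 / z\<close>.\<close>

definition del_index :: "nat \<Rightarrow> real mat \<Rightarrow> real mat" where
  "del_index i A = mat (dim_row A) (dim_col A) (\<lambda>(a, b). if a = i \<or> b = i then 0 else A $$ (a, b))"

lemma sym_resolvent_del_index: "sym_resolvent N A z \<Longrightarrow> sym_resolvent N (del_index i A) z"
  unfolding sym_resolvent_def del_index_def by auto

section \<open>Schur complement formulas\<close>

context sym_resolvent begin

lemma del_index_entry:
  "a < N \<Longrightarrow> b < N \<Longrightarrow> del_index i A $$ (a, b) = (if a = i \<or> b = i then 0 else A $$ (a, b))"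
  using carrier unfolding del_index_def by auto

abbreviation Gd :: "nat \<Rightarrow> nat \<Rightarrow> nat \<Rightarrow> complex" where
  "Gd i k l \<equiv> resolvent (del_index i A) z $$ (k, l)"

text \<open>Row \<open>i\<close> of the zeroed matrix vanishes, so its resolvent equation reduces to
  \<open>z\<close> times the entry being 0.\<close>

lemma Gd_zero:
  assumes "i < N" "k < N" "k \<noteq> i"
  shows "Gd i k i = 0"
proof -
  interpret d: sym_resolvent N "del_index i A" z
    by (rule sym_resolvent_del_index) (rule sym_resolvent_axioms)
  have "(\<Sum>l<N. of_real (del_index i A $$ (i, l)) * Gd i l k) = 0"
    using assms by (intro sum.neutral) (auto simp: del_index_entry)
  with d.resolvent_right[of i k] assms Im_nz have "Gd i i k = 0" by auto
  then show ?thesis using d.resolvent_sym[of i k] assms by simp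
qed

text \<open>The two matrices differ only in row and column \<open>i\<close>. In the resolvent
  identity the row contribution is killed by \<open>Gd_zero\<close>; what survives is a linear form
  in the \<open>i\<close>-th column of \<open>A\<close>.\<close>

lemma schur_row:
  assumes "i < N" "k < N" "j < N" "k \<noteq> i"
  shows "G k j = Gd i k j - (\<Sum>a\<in>{..<N}-{i}. Gd i k a * of_real (A $$ (a, i))) * G i j"
proof -
  have d: "sym_resolvent N (del_index i A) z"
    by (rule sym_resolvent_del_index) (rule sym_resolvent_axioms)
  have "Gd i k j - G k j =
     (\<Sum>a<N. \<Sum>b<N. Gd i k a * of_real (A $$ (a, b) - del_index i A $$ (a, b)) * G b j)"
    using resolvent_identity[OF d sym_resolvent_axioms, of k j] assms by simp
  also have "\<dots> = (\<Sum>a\<in>{..<N}-{i}. \<Sum>b<N. Gd i k a * of_real (A $$ (a, b) - del_index i A $$ (a, b)) * G b j)"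
    using assms by (intro sum.mono_neutral_right) (auto simp: Gd_zero)
  also have "\<dots> = (\<Sum>a\<in>{..<N}-{i}. \<Sum>b<N. (if b = i then Gd i k a * of_real (A $$ (a, i)) else 0) * G b j)"
    by (intro sum.cong refl) (use assms in \<open>auto simp: del_index_entry\<close>)
  also have "\<dots> = (\<Sum>a\<in>{..<N}-{i}. Gd i k a * of_real (A $$ (a, i)) * G i j)"
    using assms by (simp only: sum_delta_mult)
  also have "\<dots> = (\<Sum>a\<in>{..<N}-{i}. Gd i k a * of_real (A $$ (a, i))) * G i j"
    by (simp only: sum_distrib_right)
  finally show ?thesis by (simp add: algebra_simps)
qed

lemma G_offdiag:
  assumes "i < N" "k < N" "k \<noteq> i"
  shows "G k i = - (\<Sum>a\<in>{..<N}-{i}. Gd i k a * of_real (A $$ (a, i))) * G i i"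
  using schur_row[of i k i] assms by (simp add: Gd_zero)

text \<open>Insert \<open>G_offdiag\<close> into row \<open>i\<close> of the resolvent equation.
  Stated as a product rather than as a reciprocal, it also shows that \<open>G i i\<close> is
  nonzero.\<close>

lemma G_diag:
  assumes "i < N" "A $$ (i, i) = 0"
  shows "G i i * (- z - (\<Sum>k\<in>{..<N}-{i}. \<Sum>a\<in>{..<N}-{i}.
     of_real (A $$ (k, i)) * Gd i k a * of_real (A $$ (a, i)))) = 1"
proof -
  have "1 + z * G i i = (\<Sum>k<N. of_real (A $$ (i, k)) * G k i)"
    using resolvent_right[of i i] assms by simp
  also have "\<dots> = (\<Sum>k\<in>{..<N}-{i}. of_real (A $$ (i, k)) * G k i)"
    using assms by (intro sum.mono_neutral_right) auto
  also have "\<dots> = (\<Sum>k\<in>{..<N}-{i}. of_real (A $$ (k, i)) *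
      (- (\<Sum>a\<in>{..<N}-{i}. Gd i k a * of_real (A $$ (a, i))) * G i i))"
  proof (intro sum.cong refl)
    fix k assume k: "k \<in> {..<N} - {i}"
    then have "A $$ (i, k) = A $$ (k, i)" using sym[of i k] assms by simp
    with k show "of_real (A $$ (i, k)) * G k i = of_real (A $$ (k, i)) *
      (- (\<Sum>a\<in>{..<N}-{i}. Gd i k a * of_real (A $$ (a, i))) * G i i)"
      using G_offdiag[of i k] assms by simp
  qed
  also have "\<dots> = - G i i * (\<Sum>k\<in>{..<N}-{i}. \<Sum>a\<in>{..<N}-{i}.
     of_real (A $$ (k, i)) * Gd i k a * of_real (A $$ (a, i)))"
    by (simp add: sum_distrib_left sum_negf mult_ac)
  finally have e: "1 + z * G i i = - G i i * (\<Sum>k\<in>{..<N}-{i}. \<Sum>a\<in>{..<N}-{i}.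
     of_real (A $$ (k, i)) * Gd i k a * of_real (A $$ (a, i)))" (is "_ = - _ * ?S") .
  have "G i i * (- z - ?S) = - (z * G i i) + (- G i i * ?S)" by (simp add: algebra_simps)
  also have "\<dots> = 1" by (simp only: e[symmetric]) simp
  finally show ?thesis .
qed

lemma G_diag_nz: "i < N \<Longrightarrow> A $$ (i, i) = 0 \<Longrightarrow> G i i \<noteq> 0"
  using G_diag[of i] by auto

text \<open>\<open>G_offdiag\<close> expresses the linear form in \<open>schur_row\<close> by
  \<open>G k i\<close> and \<open>G i i\<close>. This eliminates the entries of \<open>A\<close>, so
  that minor and full resolvent can be compared directly.\<close>

lemma Gd_eq:
  assumes "i < N" "A $$ (i, i) = 0" "k < N" "l < N" "k \<noteq> i"
  shows "Gd i k l = G k l - G k i * G i l / G i i"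
proof -
  have "(\<Sum>a\<in>{..<N}-{i}. Gd i k a * of_real (A $$ (a, i))) = - G k i / G i i"
    using G_offdiag[of i k] G_diag_nz[of i] assms by (simp add: field_simps)
  then show ?thesis using schur_row[of i k l] assms by simp
qed

end

section \<open>Measurability of resolvent entries\<close>

lemma measurable_det:
  fixes F :: "'a \<Rightarrow> complex mat"
  assumes c: "\<And>x. x \<in> space M \<Longrightarrow> F x \<in> carrier_mat n n"
    and m: "\<And>i j. i < n \<Longrightarrow> j < n \<Longrightarrow> (\<lambda>x. F x $$ (i, j)) \<in> borel_measurable M"
  shows "(\<lambda>x. det (F x)) \<in> borel_measurable M"
proof (subst measurable_cong)
  show "det (F x) = (\<Sum>p\<in>{p. p permutes {0..<n}}. signof p * (\<Prod>i=0..<n. F x $$ (i, p i)))"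
    if "x \<in> space M" for x using c[OF that] by (rule det_def')
  show "(\<lambda>x. \<Sum>p\<in>{p. p permutes {0..<n}}. signof p * (\<Prod>i=0..<n. F x $$ (i, p i))) \<in> borel_measurable M"
    by (intro borel_measurable_sum borel_measurable_times borel_measurable_const borel_measurable_prod m)
      (auto simp: permutes_in_image)
qed

text \<open>Cramer's rule. It turns the output of \<open>mat_inverse\<close>, an elimination
  procedure, into a rational function of the entries, whose measurability is evident.\<close>

lemma (in sym_resolvent) resolvent_cofactor:
  assumes "i < N" "j < N"
  shows "G i j = cofactor B j i / det B"
proof -
  have "resolvent A z * (B * adj_mat B) = adj_mat B"
    using assoc_mult_mat[OF resolvent_carrier B_carrier adj_mat(1)[OF B_carrier]] resolvent_inverse(2)
      left_mult_one_mat[OF adj_mat(1)[OF B_carrier]] by simp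
  then have "det B \<cdot>\<^sub>m resolvent A z = adj_mat B"
    using adj_mat(2)[OF B_carrier] resolvent_carrier by (simp add: mult_smult_distrib[of _ N N _ N])
  then have "(det B \<cdot>\<^sub>m resolvent A z) $$ (i, j) = adj_mat B $$ (i, j)" by simp
  then have "det B * G i j = cofactor B j i"
    using assms resolvent_carrier B_carrier carrier unfolding adj_mat_def by auto
  then show ?thesis using det_B by (simp add: field_simps)
qed

lemma measurable_resolvent:
  assumes r: "\<And>x. x \<in> space M \<Longrightarrow> sym_resolvent N (F x) z"
    and m: "\<And>i j. i < N \<Longrightarrow> j < N \<Longrightarrow> (\<lambda>x. F x $$ (i, j)) \<in> borel_measurable M"
    and ij: "i < N" "j < N"
  shows "(\<lambda>x. resolvent (F x) z $$ (i, j)) \<in> borel_measurable M"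
proof (subst measurable_cong)
  let ?B = "\<lambda>x. map_mat complex_of_real (F x) - z \<cdot>\<^sub>m 1\<^sub>m (dim_row (F x))"
  have Bm: "(\<lambda>x. ?B x $$ (a, b)) \<in> borel_measurable M" if "a < N" "b < N" for a b
  proof (subst measurable_cong)
    show "?B x $$ (a, b) = of_real (F x $$ (a, b)) - (if a = b then z else 0)" if "x \<in> space M" for x
      using sym_resolvent.B_index[OF r[OF that]] \<open>a < N\<close> \<open>b < N\<close> by auto
    have [measurable]: "(\<lambda>x. F x $$ (a, b)) \<in> borel_measurable M" using m that by auto
    show "(\<lambda>x. of_real (F x $$ (a, b)) - (if a = b then z else 0)) \<in> borel_measurable M" by measurable
  qed
  have Bc: "?B x \<in> carrier_mat N N" if "x \<in> space M" for x
    using sym_resolvent.B_carrier[OF r[OF that]] .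
  show "resolvent (F x) z $$ (i, j) = cofactor (?B x) j i / det (?B x)" if "x \<in> space M" for x
    by (rule sym_resolvent.resolvent_cofactor[OF r[OF that] ij])
  have "(\<lambda>x. det (mat_delete (?B x) j i)) \<in> borel_measurable M"
  proof (rule measurable_det[where n = "N - 1"])
    show "mat_delete (?B x) j i \<in> carrier_mat (N - 1) (N - 1)" if "x \<in> space M" for x
      using Bc[OF that] unfolding mat_delete_def carrier_mat_def by auto
    fix a b assume ab: "a < N - 1" "b < N - 1"
    show "(\<lambda>x. mat_delete (?B x) j i $$ (a, b)) \<in> borel_measurable M"
    proof (subst measurable_cong)
      show "mat_delete (?B x) j i $$ (a, b) = ?B x $$ (if a < j then a else Suc a, if b < i then b else Suc b)"
        if "x \<in> space M" for x
        using Bc[OF that] ab unfolding mat_delete_def by (auto simp del: index_minus_mat)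
      show "(\<lambda>x. ?B x $$ (if a < j then a else Suc a, if b < i then b else Suc b)) \<in> borel_measurable M"
        by (rule Bm) (use ab in auto)
    qed
  qed
  moreover have "(\<lambda>x. det (?B x)) \<in> borel_measurable M"
    by (rule measurable_det[where n = N]) (use Bc Bm in auto)
  ultimately show "(\<lambda>x. cofactor (?B x) j i / det (?B x)) \<in> borel_measurable M"
    unfolding cofactor_def by (intro borel_measurable_divide borel_measurable_times borel_measurable_const)
qed

section \<open>The semicircle law\<close>

lemma m_sc_quadratic: "(m_sc z)\<^sup>2 + z * m_sc z + 1 = 0"
proof -
  define w where "w = csqrt (z\<^sup>2 - 4)"
  have w: "w\<^sup>2 = z\<^sup>2 - 4" unfolding w_def by simp
  have "((- z + w) / 2)\<^sup>2 + z * ((- z + w) / 2) + 1 = (w\<^sup>2 - z\<^sup>2 + 4) / 4"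
    by (simp add: power2_eq_square field_simps)
  moreover have "((- z - w) / 2)\<^sup>2 + z * ((- z - w) / 2) + 1 = (w\<^sup>2 - z\<^sup>2 + 4) / 4"
    by (simp add: power2_eq_square field_simps)
  ultimately show ?thesis unfolding m_sc_def Let_def w_def[symmetric] using w by auto
qed

lemma quadratic_root_facts:
  fixes m z :: complex
  assumes "m\<^sup>2 + z * m + 1 = 0"
  shows "m \<noteq> 0" "m + 1 / m = - z"
proof -
  show "m \<noteq> 0" using assms by auto
  then show "m + 1 / m = - z"
    using assms by (simp add: field_simps power2_eq_square) (metis add.commute add.left_commute eq_neg_iff_add_eq_0)
qed

text \<open>The two candidate values have product 1 and sum \<open>- z\<close>. If neither had
  positive imaginary part, product 1 would give imaginary parts of opposite sign, so both would be
  real, against \<open>Im z > 0\<close>.\<close>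

lemma Im_m_sc_pos:
  assumes "Im z > 0"
  shows "Im (m_sc z) > 0"
proof (rule ccontr)
  define w where "w = csqrt (z\<^sup>2 - 4)"
  define p where "p = (- z + w) / 2"
  define r where "r = (- z - w) / 2"
  have w: "w * w = z * z - 4" unfolding w_def by (simp flip: power2_eq_square)
  have pr: "p * r = 1"
    unfolding p_def r_def using w by (simp add: field_simps)
  then have nz: "p \<noteq> 0" "r \<noteq> 0" by auto
  have sum: "p + r = - z" unfolding p_def r_def by (simp add: field_simps)
  assume "\<not> Im (m_sc z) > 0"
  then have p: "Im p \<le> 0" and r: "Im r \<le> 0"
    unfolding m_sc_def Let_def w_def[symmetric] p_def[symmetric] r_def[symmetric] by (auto split: if_splits)
  have "p = cnj r / (of_real ((cmod r)\<^sup>2))"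
    using pr nz by (simp add: complex_norm_square field_simps del: of_real_power)
  then have "Im p = - Im r / (cmod r)\<^sup>2" by (metis Im_divide_of_real cnj.simps(2))
  then have "Im p \<ge> 0" using r by (simp add: divide_nonpos_nonneg)
  then have "Im p = 0" "Im r = 0" using p \<open>Im p = - Im r / (cmod r)\<^sup>2\<close> nz by auto
  then have "Im z = 0" using arg_cong[OF sum, of Im] by simp
  then show False using assms by simp
qed

text \<open>The imaginary part of \<open>m + 1/m = - z\<close>.\<close>

lemma m_sc_Im_identity:
  assumes "Im z > 0"
  shows "Im (m_sc z) * (1 - (cmod (m_sc z))\<^sup>2) = Im z * (cmod (m_sc z))\<^sup>2"
proof -
  let ?m = "m_sc z"
  note q = quadratic_root_facts[OF m_sc_quadratic[of z]]
  have "1 / ?m = cnj ?m / of_real ((cmod ?m)\<^sup>2)"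
    using q(1) by (simp add: complex_norm_square field_simps del: of_real_power)
  then have "Im (1 / ?m) = - Im ?m / (cmod ?m)\<^sup>2" by (metis Im_divide_of_real cnj.simps(2))
  then have "Im ?m - Im ?m / (cmod ?m)\<^sup>2 = - Im z"
    using arg_cong[OF q(2), of Im] by simp
  then show ?thesis using q(1) by (simp add: field_simps)
qed

lemma m_sc_norm_lt_1:
  assumes "Im z > 0"
  shows "cmod (m_sc z) < 1"
proof -
  have "0 < Im z * (cmod (m_sc z))\<^sup>2"
    using assms quadratic_root_facts(1)[OF m_sc_quadratic[of z]] by simp
  then have "0 < 1 - (cmod (m_sc z))\<^sup>2"
    using m_sc_Im_identity[OF assms] Im_m_sc_pos[OF assms] by (metis zero_less_mult_pos)
  then show ?thesis by (simp add: abs_square_less_1)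
qed

text \<open>A quantitative form of \<open>cmod (m_sc z) < 1\<close>, from the imaginary part
  identity and \<open>Im (m_sc z)\<close> being at most the modulus. It keeps
  \<open>1 - m_sc z * m_sc w\<close> away from zero in the Lipschitz estimate.\<close>

lemma m_sc_gap:
  assumes "Im z > 0"
  shows "Im z * cmod (m_sc z) \<le> 1 - (cmod (m_sc z))\<^sup>2"
proof -
  let ?m = "m_sc z"
  have nz: "?m \<noteq> 0" using quadratic_root_facts(1)[OF m_sc_quadratic[of z]] .
  have p: "1 - (cmod ?m)\<^sup>2 \<ge> 0" using m_sc_norm_lt_1[OF assms] by (simp add: abs_square_le_1)
  have "Im z * (cmod ?m)\<^sup>2 \<le> cmod ?m * (1 - (cmod ?m)\<^sup>2)"
    using m_sc_Im_identity[OF assms] p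
    by (metis abs_Im_le_cmod abs_ge_self mult_right_mono order_trans)
  then have "cmod ?m * (Im z * cmod ?m) \<le> cmod ?m * (1 - (cmod ?m)\<^sup>2)"
    by (simp add: power2_eq_square mult_ac)
  then show ?thesis using nz by (meson mult_left_le_imp_le zero_less_norm_iff)
qed

text \<open>From \<open>m * (z + m) = - 1\<close>. It keeps diagonal resolvent entries near
  \<open>m_sc z\<close> away from zero, by which \<open>Gd_eq\<close> divides.\<close>

lemma m_sc_lower:
  assumes "Im z > 0"
  shows "1 \<le> cmod (m_sc z) * (cmod z + 1)"
proof -
  have "(m_sc z) * (z + m_sc z) = - 1"
    using m_sc_quadratic[of z] by (simp add: algebra_simps power2_eq_square eq_neg_iff_add_eq_0)
  then have "1 = cmod (m_sc z) * cmod (z + m_sc z)" by (metis norm_minus_cancel norm_mult norm_one)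
  also have "\<dots> \<le> cmod (m_sc z) * (cmod z + 1)"
    by (intro mult_left_mono order_trans[OF norm_triangle_ineq]) (use m_sc_norm_lt_1[OF assms] in auto)
  finally show ?thesis .
qed

lemma m_sc_upper: 
  assumes "Im z > 0"
  shows "cmod (m_sc z) \<le> 1 / Im z"
proof -
  have "Im z * cmod (m_sc z) \<le> 1" using m_sc_gap[OF assms] by (simp add: order_trans)
  then show ?thesis using assms by (simp add: field_simps)
qed

text \<open>With \<open>a\<close> and \<open>b\<close> the two values, subtracting the equations
  gives \<open>(a - b) * (1 - a * b) = a * b * (z - w)\<close>. By \<open>m_sc_gap\<close> at the
  value of larger modulus, \<open>1 - cmod a * cmod b\<close> is at least
  \<open>\<eta> * (cmod a * cmod b)\<close>, so the product of the moduli cancels.\<close>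

lemma m_sc_lipschitz:
  assumes z: "Im z > 0" and w: "Im w > 0" and e: "\<eta> \<le> Im z" "\<eta> \<le> Im w" "\<eta> > 0"
  shows "cmod (m_sc z - m_sc w) \<le> cmod (z - w) / \<eta>"
proof -
  let ?a = "m_sc z" and ?b = "m_sc w"
  note a = quadratic_root_facts[OF m_sc_quadratic[of z]] and b = quadratic_root_facts[OF m_sc_quadratic[of w]]
  have na: "0 < cmod ?a" "cmod ?a < 1" and nb: "0 < cmod ?b" "cmod ?b < 1"
    using a(1) b(1) m_sc_norm_lt_1 z w by auto
  have "(?a - ?b) * (1 - ?a * ?b) = ?a * ?b * (z - w)"
  proof -
    have "z - w = ?b + 1 / ?b - ?a - 1 / ?a" using a(2) b(2) by (simp add: algebra_simps)
    also have "?a * ?b * \<dots> = ?a * ?b * (?b - ?a) + (?a - ?b)"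
      using a(1) b(1) by (simp add: field_simps)
    finally show ?thesis by (simp add: algebra_simps)
  qed
  then have eq: "cmod (?a - ?b) * cmod (1 - ?a * ?b) = cmod ?a * cmod ?b * cmod (z - w)"
    by (metis norm_mult)
  have lb: "1 - cmod ?a * cmod ?b \<le> cmod (1 - ?a * ?b)"
    using norm_triangle_ineq2[of 1 "?a * ?b"] by (simp add: norm_mult)
  have g: "\<eta> * (cmod ?a * cmod ?b) \<le> 1 - cmod ?a * cmod ?b"
  proof (cases "cmod ?b \<le> cmod ?a")
    case True
    have "cmod ?a * cmod ?b \<le> (cmod ?a)\<^sup>2" using True by (simp add: power2_eq_square mult_left_mono)
    moreover have "\<eta> * (cmod ?a * cmod ?b) \<le> Im z * cmod ?a"
      using e z na nb by (intro mult_mono) (auto simp: mult_left_le)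
    ultimately show ?thesis using m_sc_gap[OF z] by linarith
  next
    case False
    have "cmod ?a * cmod ?b \<le> (cmod ?b)\<^sup>2" using False by (simp add: power2_eq_square mult_right_mono)
    moreover have "\<eta> * (cmod ?a * cmod ?b) \<le> Im w * cmod ?b"
      using e w na nb by (intro mult_mono) (auto simp: mult_le_cancel_right1)
    ultimately show ?thesis using m_sc_gap[OF w] by linarith
  qed
  have "cmod (?a - ?b) * (\<eta> * (cmod ?a * cmod ?b)) \<le> cmod (?a - ?b) * cmod (1 - ?a * ?b)"
    using g lb by (intro mult_left_mono) auto
  also have "\<dots> = cmod ?a * cmod ?b * cmod (z - w)" by (rule eq)
  finally have "(cmod ?a * cmod ?b) * (cmod (?a - ?b) * \<eta>) \<le> (cmod ?a * cmod ?b) * cmod (z - w)"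
    by (simp add: mult_ac)
  then have "cmod (?a - ?b) * \<eta> \<le> cmod (z - w)"
    using na nb by (meson mult_left_le_imp_le mult_pos_pos)
  then show ?thesis using e by (simp add: field_simps)
qed

section \<open>Distance between the two roots of the quadratic equation\<close>

definition root_gap :: "complex \<Rightarrow> real" where
  "root_gap z = cmod (m_sc z - 1 / m_sc z)"

lemma root_gap_sq: "(root_gap z)\<^sup>2 = cmod (z\<^sup>2 - 4)"
proof -
  note q = quadratic_root_facts[OF m_sc_quadratic[of z]]
  have "(m_sc z - 1 / m_sc z)\<^sup>2 = (m_sc z + 1 / m_sc z)\<^sup>2 - 4"
    using q(1) by (simp add: power2_eq_square field_simps)
  then show ?thesis unfolding root_gap_def by (simp add: q(2) flip: norm_power)
qed

text \<open>The squared distance is \<open>cmod (z - 2) * cmod (z + 2)\<close>, and both factors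
  grow with the imaginary part. Hence the roots can only approach each other along a path
  downwards.\<close>

lemma root_gap_mono:
  assumes "Re z = Re w" "0 \<le> Im z" "Im z \<le> Im w"
  shows "root_gap z \<le> root_gap w"
proof -
  have m: "cmod (z - of_real a) \<le> cmod (w - of_real a)" for a :: real
    unfolding cmod_def using assms by (simp add: power_mono)
  have f: "cmod (u\<^sup>2 - 4) = cmod (u - of_real 2) * cmod (u - of_real (-2))" for u :: complex
    by (subst norm_mult[symmetric], rule arg_cong[of _ _ cmod]) (simp add: power2_eq_square algebra_simps)
  have "(root_gap z)\<^sup>2 \<le> (root_gap w)\<^sup>2"
    unfolding root_gap_sq f by (intro mult_mono m) auto
  then show ?thesis by (rule power2_le_imp_le) (simp add: root_gap_def)
qed

text \<open>The distance is the modulus of \<open>2 * m_sc z + z\<close>, whose imaginary part is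
  already larger than \<open>Im (m_sc z)\<close>. It lets \<open>Im m\<close> be bounded by the
  distances of \<open>m\<close> to the two roots.\<close>

lemma Im_m_sc_le_root_gap:
  assumes "Im z > 0"
  shows "Im (m_sc z) \<le> root_gap z"
proof -
  have "m_sc z - 1 / m_sc z = 2 * m_sc z + z"
    using quadratic_root_facts(2)[OF m_sc_quadratic[of z]] by (simp add: algebra_simps eq_neg_iff_add_eq_0)
  then have "Im (m_sc z - 1 / m_sc z) = 2 * Im (m_sc z) + Im z" by (simp only: plus_complex.sel) simp
  also have "\<dots> \<ge> Im (m_sc z)" using assms Im_m_sc_pos[OF assms] by simp
  finally show ?thesis
    unfolding root_gap_def using abs_Im_le_cmod[of "m_sc z - 1 / m_sc z"] by linarith
qed

lemma quadratic_factor: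
  "m\<^sup>2 + z * m + 1 = (m - m_sc z) * (m - 1 / m_sc z)"
proof -
  note q = quadratic_root_facts[OF m_sc_quadratic[of z]]
  have "z = - (m_sc z + 1 / m_sc z)" using q(2) by simp
  then have "m\<^sup>2 + z * m + 1 = m\<^sup>2 - (m_sc z + 1 / m_sc z) * m + 1" by (metis minus_mult_left diff_conv_add_uminus)
  then show ?thesis using q(1) by (simp add: power2_eq_square field_simps)
qed

section \<open>Deterministic stability at one spectral parameter\<close>

text \<open>Doeblin's argument: a common lower bound on two probability vectors makes averaging a
  contraction for the oscillation.\<close>

lemma averaging_contraction:
  fixes s t :: "nat \<Rightarrow> real" and g :: "nat \<Rightarrow> complex"
  assumes ij: "i < N" "j < N"
    and s: "(\<Sum>k<N. s k) = 1" "s i = 0" "\<And>k. k < N \<Longrightarrow> k \<noteq> i \<Longrightarrow> a \<le> s k"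
    and t: "(\<Sum>k<N. t k) = 1" "t j = 0" "\<And>k. k < N \<Longrightarrow> k \<noteq> j \<Longrightarrow> a \<le> t k"
    and a: "0 \<le> a" and D: "\<And>k l. k < N \<Longrightarrow> l < N \<Longrightarrow> cmod (g k - g l) \<le> D"
  shows "cmod ((\<Sum>k<N. of_real (s k) * g k) - (\<Sum>k<N. of_real (t k) * g k)) \<le> (1 - a * (real N - 2)) * D"
proof -
  \<comment> \<open>The common lower bound is split off; the remainders are nonnegative and have the
    same mass \<open>T\<close>.\<close>
  define s' where "s' k = s k - a * (if k = i then 0 else 1)" for k
  define t' where "t' k = t k - a * (if k = j then 0 else 1)" for k
  define T where "T = 1 - a * (real N - 1)"
  have card: "(\<Sum>k<N. if k = i then 0 else 1) = real N - 1" if "i < N" for i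
  proof -
    have "(\<Sum>k<N. if k = i then 0 else 1) = (\<Sum>k\<in>{..<N}-{i}. 1::real)"
      by (intro sum.mono_neutral_cong_right) auto
    also have "\<dots> = real N - 1" using that by (simp add: of_nat_diff)
    finally show ?thesis .
  qed
  have s': "(\<Sum>k<N. s' k) = T" "\<And>k. k < N \<Longrightarrow> 0 \<le> s' k"
    unfolding s'_def T_def using s ij by (auto simp: sum_subtractf sum_distrib_left[symmetric] card)
  have t': "(\<Sum>k<N. t' k) = T" "\<And>k. k < N \<Longrightarrow> 0 \<le> t' k"
    unfolding t'_def T_def using t ij by (auto simp: sum_subtractf sum_distrib_left[symmetric] card)
  have T0: "0 \<le> T" using s' by (metis lessThan_iff sum_nonneg)
  have D0: "0 \<le> D" using D[OF ij(1) ij(1)] by simp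
  let ?X = "\<Sum>k<N. of_real (s' k) * g k" and ?Y = "\<Sum>k<N. of_real (t' k) * g k"
  have XY: "cmod (?X - ?Y) \<le> T * D"
  proof (cases "T = 0")
    case True
    then have "s' k = 0" "t' k = 0" if "k < N" for k
      using sum_nonneg_0[of "{..<N}" s' k] sum_nonneg_0[of "{..<N}" t' k] s' t' that by auto
    then show ?thesis using True by simp
  next
    case False
    \<comment> \<open>Product coupling of the two remainders: the difference becomes a weighted sum
      of terms \<open>g k - g l\<close>, each of modulus at most \<open>D\<close>.\<close>
    have "of_real T * (?X - ?Y) = (\<Sum>l<N. of_real (t' l)) * ?X - (\<Sum>k<N. of_real (s' k)) * ?Y"
      unfolding of_real_sum[symmetric] s' t' by (simp add: algebra_simps)
    also have "\<dots> = (\<Sum>l<N. \<Sum>k<N. of_real (t' l) * (of_real (s' k) * g k))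
        - (\<Sum>l<N. \<Sum>k<N. of_real (t' l) * (of_real (s' k) * g l))"
      unfolding sum_product by (subst (2) sum.swap) (simp add: mult_ac)
    also have "\<dots> = (\<Sum>l<N. \<Sum>k<N. of_real (t' l * s' k) * (g k - g l))"
      by (simp only: sum_subtractf[symmetric] of_real_mult right_diff_distrib mult.assoc)
    finally have e: "of_real T * (?X - ?Y) = (\<Sum>l<N. \<Sum>k<N. of_real (t' l * s' k) * (g k - g l))" .
    have "T * cmod (?X - ?Y) = cmod (of_real T * (?X - ?Y))" using T0 by (simp only: norm_mult norm_of_real abs_of_nonneg)
    also have "\<dots> = cmod (\<Sum>l<N. \<Sum>k<N. of_real (t' l * s' k) * (g k - g l))" unfolding e ..
    also have "\<dots> \<le> (\<Sum>l<N. \<Sum>k<N. t' l * s' k * D)"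
      by (intro sum_norm_le) (use s' t' D in \<open>auto simp: norm_mult intro!: mult_left_mono\<close>)
    also have "\<dots> = T * (T * D)"
      by (simp add: sum_distrib_left[symmetric] sum_distrib_right[symmetric] s' t' mult.assoc)
    finally show ?thesis using False T0 by simp
  qed
  have split: "(\<Sum>k<N. of_real (r k) * g k) = (\<Sum>k<N. of_real (r k - a * (if k = i then 0 else 1)) * g k)
      + of_real a * (\<Sum>k<N. g k) - of_real a * g i" if "i < N" for r :: "nat \<Rightarrow> real" and i
  proof -
    have "(\<Sum>k<N. of_real (r k) * g k) = (\<Sum>k<N. of_real (r k - a * (if k = i then 0 else 1)) * g k
        + of_real a * g k - (if k = i then of_real a else 0) * g k)"
      by (intro sum.cong refl) (simp add: algebra_simps)
    then show ?thesis using that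
      by (simp only: sum.distrib sum_subtractf sum_delta_mult sum_distrib_left)
  qed
  \<comment> \<open>The split-off parts are uniform except for one missing index each. This leaves
    \<open>a * (g j - g i)\<close> and explains \<open>N - 2\<close> in place of
    \<open>N - 1\<close>.\<close>
  have "(\<Sum>k<N. of_real (s k) * g k) - (\<Sum>k<N. of_real (t k) * g k) = (?X - ?Y) + of_real a * (g j - g i)"
    unfolding split[OF ij(1), of s] split[OF ij(2), of t] s'_def t'_def by (simp add: algebra_simps)
  also have "cmod \<dots> \<le> T * D + a * D"
    by (rule order_trans[OF norm_triangle_ineq])
      (use XY D[OF ij(2,1)] a in \<open>auto simp: norm_mult intro!: add_mono mult_left_mono\<close>)
  also have "\<dots> = (1 - a * (real N - 2)) * D" unfolding T_def by (simp add: algebra_simps)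
  finally show ?thesis .
qed

section \<open>From an approximate quadratic equation to closeness to a root\<close>

definition conv_rate :: "nat \<Rightarrow> real \<Rightarrow> complex \<Rightarrow> real" where
  "conv_rate N q z = 1 / sqrt q + 1 / (real N * Im z) powr (1 / 3)"

text \<open>Either \<open>m\<close> is close to \<open>m_sc\<close> or to the other root of the quadratic equation.  The exponent
  \<open>1/3\<close> arises because \<open>Im m\<close>, which enters the error term, is at most three times the larger of
  the two distances.\<close>

lemma root_dichotomy:
  assumes z: "Im z > 0" and Nz: "1 \<le> real N * Im z" and q: "1 \<le> q" and B: "1 \<le> B"
    and m0: "0 \<le> Im m"
    and quad: "cmod (m\<^sup>2 + z * m + 1) \<le> B * (1 / q + sqrt (Im m / (real N * Im z)) + 1 / (real N * Im z))"
  shows "cmod (m - m_sc z) \<le> 5 * B * conv_rate N q z \<or> cmod (m - 1 / m_sc z) \<le> 5 * B * conv_rate N q z"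
proof (rule ccontr)
  let ?T = "5 * B"
  define r where "r = 1 / sqrt q"
  define y where "y = 1 / (real N * Im z) powr (1 / 3)"
  have r: "0 < r" "r\<^sup>2 = 1 / q" unfolding r_def using q by (auto simp: power_divide)
  have y3: "y ^ 3 = 1 / (real N * Im z)"
  proof -
    have "((real N * Im z) powr (1 / 3)) ^ 3 = (real N * Im z) powr (1 / 3 * 3)"
      using Nz by (subst powr_powr[symmetric]) (simp add: powr_numeral)
    then show ?thesis unfolding y_def using Nz by (simp add: power_divide)
  qed
  have "1 \<le> (real N * Im z) powr (1 / 3)" using Nz by (rule ge_one_powr_ge_zero) simp
  then have y: "0 < y" "y \<le> 1" unfolding y_def by (auto simp: divide_le_eq_1 simp del: powr_gt_zero)
  define a where "a = cmod (m - m_sc z)"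
  define b where "b = cmod (m - 1 / m_sc z)"
  define \<mu> where "\<mu> = min a b"
  define X where "X = max a b"
  define t where "t = ?T * (r + y)"
  \<comment> \<open>If both distances exceed \<open>t\<close>, every error term can be compared with
    \<open>\<mu> * X\<close>, which is the modulus of the quadratic polynomial.\<close>
  assume "\<not> ?thesis"
  then have \<mu>: "t < \<mu>" unfolding \<mu>_def a_def b_def t_def conv_rate_def r_def y_def by auto
  have tpos: "0 < t" unfolding t_def using r y B by simp
  have \<mu>X: "0 < \<mu>" "\<mu> \<le> X" "a * b = \<mu> * X"
    using \<mu> tpos unfolding \<mu>_def X_def by (auto simp: min_def max_def)
  have T1: "1 \<le> ?T" using B by simp
  have Im: "Im m \<le> 3 * X"
  proof -
    have "Im m = Im (m_sc z) + Im (m - m_sc z)" by simp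
    also have "\<dots> \<le> root_gap z + a"
      unfolding a_def using abs_Im_le_cmod[of "m - m_sc z"] Im_m_sc_le_root_gap[OF z] by linarith
    also have "root_gap z \<le> a + b"
      unfolding root_gap_def a_def b_def using norm_triangle_ineq4[of "m - 1 / m_sc z" "m - m_sc z"] by simp
    finally show ?thesis unfolding X_def by linarith
  qed
  have ry: "?T * r \<le> \<mu>" "?T * y \<le> \<mu>"
    using \<mu> T1 r y unfolding t_def by (simp_all add: distrib_left) (smt (verit, best) B mult_pos_pos)+
  have e1: "1 / q \<le> \<mu> * X / ?T"
  proof -
    have "?T * (1 / q) = (?T * r) * r" unfolding r(2)[symmetric] by (simp add: power2_eq_square)
    also have "\<dots> \<le> \<mu> * (?T * r)" using r T1 ry \<mu>X B by (intro mult_mono) auto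
    also have "\<dots> \<le> \<mu> * X" using ry \<mu>X by (intro mult_left_mono) auto
    finally show ?thesis using T1 by (simp add: field_simps)
  qed
  have e3: "1 / (real N * Im z) \<le> \<mu> * X / ?T"
  proof -
    have "?T * y ^ 3 = (?T * y) * (y * y)" by (simp add: power3_eq_cube)
    also have "\<dots> \<le> (?T * y) * (?T * y)" using y B by (intro mult_left_mono mult_mono) auto
    also have "\<dots> \<le> \<mu> * X" using ry \<mu>X y B by (intro mult_mono) auto
    finally show ?thesis using T1 y3 by (simp add: field_simps)
  qed
  have e2: "sqrt (Im m / (real N * Im z)) \<le> 2 * (\<mu> * X / ?T)"
  proof (rule real_le_lsqrt)
    have "Im m / (real N * Im z) = Im m * y ^ 3" using y3 by simp
    also have "\<dots> \<le> 3 * X * y ^ 3" using Im y by (intro mult_right_mono) auto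
    also have "\<dots> \<le> 4 * (X * y ^ 3)" using \<mu>X y by simp
    also have "X * y ^ 3 \<le> X * (\<mu>\<^sup>2 * X / ?T\<^sup>2)"
    proof (rule mult_left_mono)
      \<comment> \<open>Two factors \<open>?T * y\<close> are bounded by \<open>\<mu>\<close> and
        the third by \<open>X\<close>. With the factor \<open>X\<close> from \<open>Im m\<close>,
        the square root becomes proportional to \<open>\<mu> * X\<close>; this is where the cube
        root in \<open>y\<close> is used.\<close>
      have "?T\<^sup>2 * y ^ 3 = (?T * y)\<^sup>2 * y" by (simp add: power2_eq_square power3_eq_cube)
      also have "\<dots> \<le> \<mu>\<^sup>2 * (?T * y)" using ry y B by (intro mult_mono power_mono) auto
      also have "\<dots> \<le> \<mu>\<^sup>2 * X" using ry \<mu>X by (intro mult_left_mono) auto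
      finally show "y ^ 3 \<le> \<mu>\<^sup>2 * X / ?T\<^sup>2" using T1 by (simp add: field_simps)
    qed (use \<mu>X in auto)
    finally show "Im m / (real N * Im z) \<le> (2 * (\<mu> * X / ?T))\<^sup>2"
      by (simp add: power_mult_distrib power_divide power2_eq_square mult_ac)
  qed (use \<mu>X T1 in auto)
  \<comment> \<open>The three error terms contribute 1, 2 and 1 units of
    \<open>\<mu> * X / ?T\<close>; the factor 5 in \<open>?T\<close> leaves 4/5 of
    \<open>\<mu> * X\<close>, a contradiction.\<close>
  have "\<mu> * X \<le> B * (1 / q + sqrt (Im m / (real N * Im z)) + 1 / (real N * Im z))"
    using quad \<mu>X(3) unfolding quadratic_factor norm_mult a_def b_def by simp
  also have "\<dots> \<le> B * (4 * (\<mu> * X / ?T))" using e1 e2 e3 B by (intro mult_left_mono) auto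
  also have "\<dots> = 4 / 5 * (\<mu> * X)" using B by (simp add: field_simps)
  finally show False using \<mu>X by (simp add: mult_le_cancel_right)
qed

lemma sym_resolvent_Im_trace_nonneg:
  assumes "sym_resolvent N A z" "Im z > 0"
  shows "0 \<le> Im (\<Sum>i<N. resolvent A z $$ (i, i))"
  using sym_resolvent.Im_diag_nonneg[OF assms] by (auto intro!: sum_nonneg)

lemma m_emp_eq: "sym_resolvent N A z \<Longrightarrow> m_emp N A z = (\<Sum>i<N. resolvent A z $$ (i, i)) / of_nat N"
  using sym_resolvent.resolvent_carrier[of N A z] unfolding m_emp_def mat_trace_def by auto

section \<open>Good rows and the deterministic setting\<close>

definition minor_max :: "nat \<Rightarrow> real mat \<Rightarrow> complex \<Rightarrow> nat \<Rightarrow> real" where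
  "minor_max N A z i = Max ((\<lambda>(k, l). cmod (resolvent (del_index i A) z $$ (k, l))) `
     (({..<N} - {i}) \<times> ({..<N} - {i})))"

text \<open>The right-hand side involves only the minor, which in the model is independent of row
  \<open>i\<close>. The factor 2 pays for real and imaginary parts, \<open>R\<close> for a small
  exceptional probability.\<close>

definition row_linear_good :: "nat \<Rightarrow> real \<Rightarrow> real \<Rightarrow> real mat \<Rightarrow> complex \<Rightarrow> nat \<Rightarrow> nat \<Rightarrow> bool" where
  "row_linear_good N q R A z i j \<longleftrightarrow>
     cmod (\<Sum>k\<in>{..<N}-{i}. resolvent (del_index i A) z $$ (j, k) * of_real (A $$ (k, i)))
     \<le> 2 * (R * (minor_max N A z i / q +
          sqrt ((\<Sum>k\<in>{..<N}-{i}. (cmod (resolvent (del_index i A) z $$ (j, k)))\<^sup>2) / real N)))"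

text \<open>With \<open>s\<close> the variances, the subtracted sum is the conditional mean of the
  quadratic form given the minor. The factor 4 counts diagonal and off-diagonal parts, each with
  real and imaginary part.\<close>

definition row_quad_good ::
    "nat \<Rightarrow> real \<Rightarrow> real \<Rightarrow> (nat \<Rightarrow> nat \<Rightarrow> real) \<Rightarrow> real mat \<Rightarrow> complex \<Rightarrow> nat \<Rightarrow> bool" where
  "row_quad_good N q R s A z i \<longleftrightarrow>
     cmod ((\<Sum>k\<in>{..<N}-{i}. \<Sum>l\<in>{..<N}-{i}.
          of_real (A $$ (k, i)) * resolvent (del_index i A) z $$ (k, l) * of_real (A $$ (l, i)))
        - (\<Sum>k\<in>{..<N}-{i}. of_real (s k i) * resolvent (del_index i A) z $$ (k, k)))
     \<le> 4 * (R * (minor_max N A z i / q +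
          sqrt ((\<Sum>k\<in>{..<N}-{i}. \<Sum>l\<in>{..<N}-{i}. (cmod (resolvent (del_index i A) z $$ (k, l)))\<^sup>2) / (real N)\<^sup>2)))"

definition rows_good ::
    "nat \<Rightarrow> real \<Rightarrow> real \<Rightarrow> (nat \<Rightarrow> nat \<Rightarrow> real) \<Rightarrow> real mat \<Rightarrow> complex \<Rightarrow> bool" where
  "rows_good N q R s A z \<longleftrightarrow> (\<forall>i<N. row_quad_good N q R s A z i \<and>
     (\<forall>j<N. j \<noteq> i \<longrightarrow> row_linear_good N q R A z i j))"

text \<open>Constants dictated by the estimates below. The tolerance keeps
  \<open>(1 + tol)\<^sup>2\<close> from spoiling the contraction; 8 is the 4 of
  \<open>row_quad_good\<close> times the bound 2 on minor entries, and \<open>C0\<close> comes from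
  the variances; 48 is 16 * 3 from \<open>osc_bound\<close> and \<open>err_le_psi\<close>; 1050 is 5
  * 210 from \<open>root_dichotomy\<close> and \<open>m_quadratic\<close>.\<close>

definition apriori_tol :: "real \<Rightarrow> real" where "apriori_tol L = 1 / (20 * L)"
definition err_coeff :: "real \<Rightarrow> real" where "err_coeff C0 = 8 + C0"
definition offset_coeff :: "real \<Rightarrow> real \<Rightarrow> real" where "offset_coeff C0 L = 48 * L * err_coeff C0"
definition root_coeff :: "real \<Rightarrow> real \<Rightarrow> real" where "root_coeff C0 L = 1050 * L * err_coeff C0"

text \<open>At height at least \<open>1 / N\<close> resolvent entries have Lipschitz constant at
  most \<open>N\<^sup>2\<close>, so a step of length \<open>1 / N ^ 4\<close> moves them by at most
  \<open>1 / N\<^sup>2\<close>.\<close>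

definition path :: "nat \<Rightarrow> complex \<Rightarrow> nat \<Rightarrow> complex" where
  "path N z k = z + \<i> * of_real (real k / real N ^ 4)"

lemma path_simps [simp]: "Re (path N z k) = Re z" "Im (path N z k) = Im z + real k / real N ^ 4"
  unfolding path_def by auto

text \<open>One realisation of the matrix, with zero diagonal, and its variance profile
  \<open>s\<close>, which \<open>L\<close> and \<open>C0\<close> bound from below and above on the
  scale \<open>1 / N\<close>.\<close>

locale sparse_instance =
  fixes N :: nat and A :: "real mat" and s :: "nat \<Rightarrow> nat \<Rightarrow> real" and q R C0 L :: real
  assumes A_carrier: "A \<in> carrier_mat N N"
    and A_sym: "\<And>i j. i < N \<Longrightarrow> j < N \<Longrightarrow> A $$ (i, j) = A $$ (j, i)"
    and A_diag: "\<And>i. i < N \<Longrightarrow> A $$ (i, i) = 0"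
    and s_sum: "\<And>i. i < N \<Longrightarrow> (\<Sum>k<N. s k i) = 1"
    and s_diag: "\<And>i. i < N \<Longrightarrow> s i i = 0"
    and s_lower: "\<And>i k. i < N \<Longrightarrow> k < N \<Longrightarrow> k \<noteq> i \<Longrightarrow> 1 / (L * real N) \<le> s k i"
    and s_upper: "\<And>i k. i < N \<Longrightarrow> k < N \<Longrightarrow> s k i \<le> C0 / real N"
    and N: "4 \<le> N" and q: "1 \<le> q" and R: "1 \<le> R" and C0: "0 \<le> C0" and L: "1 \<le> L"
begin

abbreviation tol :: real where "tol \<equiv> apriori_tol L"

lemma tol: "0 < tol" "tol \<le> 1 / 20" "(1 + tol)\<^sup>2 * (1 - 1 / (2 * L)) \<le> 1 - 1 / (4 * L)"
proof -
  show "0 < tol" and t: "tol \<le> 1 / 20" unfolding apriori_tol_def using L by (auto simp: field_simps)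
  define x where "x = 1 / L"
  have x: "0 < x" "x \<le> 1" unfolding x_def using L by auto
  have tx: "tol = x / 20" "1 / (2 * L) = x / 2" "1 / (4 * L) = x / 4" unfolding apriori_tol_def x_def by auto
  have "(1 + tol)\<^sup>2 = 1 + 2 * tol + tol * tol" by (simp add: power2_eq_square algebra_simps)
  also have "tol * tol \<le> tol" using t \<open>0 < tol\<close> by (intro mult_left_le) auto
  finally have "(1 + tol)\<^sup>2 \<le> 1 + 3 * tol" by simp
  then have "(1 + tol)\<^sup>2 * (1 - x / 2) \<le> (1 + x / 4) * (1 - x / 2)"
    using x tx by (intro mult_right_mono) auto
  also have "\<dots> = 1 - x / 4 - x * x / 8" by (simp add: algebra_simps)
  also have "\<dots> \<le> 1 - x / 4" by simp
  finally show "(1 + tol)\<^sup>2 * (1 - 1 / (2 * L)) \<le> 1 - 1 / (4 * L)" unfolding tx .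
qed

lemma resolvent_model: "Im z \<noteq> 0 \<Longrightarrow> sym_resolvent N A z"
  by unfold_locales (use A_carrier A_sym in auto)

abbreviation C1 :: real where "C1 \<equiv> err_coeff C0"

text \<open>The first bound keeps the factor \<open>G i i * G j j\<close> harmless for the
  contraction; the second bounds \<open>minor_max\<close> in the row estimates.\<close>

definition a_priori :: "complex \<Rightarrow> bool" where
  "a_priori z \<longleftrightarrow> (\<forall>i<N. cmod (resolvent A z $$ (i, i)) \<le> 1 + tol) \<and>
     (\<forall>i<N. \<forall>k<N. \<forall>l<N. k \<noteq> i \<longrightarrow> l \<noteq> i \<longrightarrow> cmod (resolvent (del_index i A) z $$ (k, l)) \<le> 2)"

text \<open>\<open>Im m\<close> is retained instead of a constant bound: with a constant, the square
  root of the error at merging roots would have \<open>N * Im z\<close> to the power 1/4 in place of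
  1/3.\<close>

definition err :: "complex \<Rightarrow> real" where
  "err z = R * (1 / q + sqrt (Im (m_emp N A z) / (real N * Im z)) + 1 / (real N * Im z))"

context
  fixes z :: complex
  assumes z: "Im z > 0" and ap: "a_priori z" and good: "rows_good N q R s A z"
begin

interpretation sym_resolvent N A z by (rule resolvent_model) (use z in auto)

abbreviation (input) m where "m \<equiv> m_emp N A z"

lemma m_eq: "m = (\<Sum>i<N. G i i) / of_nat N"
  by (rule m_emp_eq) (rule sym_resolvent_axioms)

lemma Im_m_nonneg: "0 \<le> Im m"
  using sym_resolvent_Im_trace_nonneg[OF sym_resolvent_axioms z] unfolding m_eq by (simp add: Im_divide_of_nat)

lemma diag_le: "i < N \<Longrightarrow> cmod (G i i) \<le> 1 + tol"
  using ap unfolding a_priori_def by auto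

lemma Gd_le: "i < N \<Longrightarrow> k < N \<Longrightarrow> l < N \<Longrightarrow> k \<noteq> i \<Longrightarrow> l \<noteq> i \<Longrightarrow> cmod (Gd i k l) \<le> 2"
  using ap unfolding a_priori_def by auto

lemma minor_max_le: "i < N \<Longrightarrow> minor_max N A z i \<le> 2"
proof -
  assume i: "i < N"
  have "\<exists>k<N. k \<noteq> i" using N i by (intro exI[of _ "if i = 0 then 1 else 0"]) auto
  then show ?thesis unfolding minor_max_def using i by (subst Max_le_iff) (auto intro: Gd_le)
qed

lemma diag_row_ratio: "i < N \<Longrightarrow> (\<Sum>k<N. (cmod (G i k))\<^sup>2) / cmod (G i i) \<le> 1 / Im z"
proof -
  assume i: "i < N"
  have "(\<Sum>k<N. (cmod (G i k))\<^sup>2) \<le> cmod (G i i) * (1 / Im z)"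
    using ward_div[OF i] abs_Im_le_cmod[of "G i i"] z by (simp add: divide_right_mono)
  then show ?thesis using G_diag_nz[OF i A_diag[OF i]] by (simp add: field_simps)
qed

lemma Gd_ward: 
  assumes "i < N" "k < N"
  shows "(\<Sum>l\<in>{..<N}-{i}. (cmod (Gd i k l))\<^sup>2) \<le> Im (Gd i k k) / Im z"
proof -
  interpret d: sym_resolvent N "del_index i A" z
    by (rule sym_resolvent_del_index) (rule sym_resolvent_axioms)
  have "(\<Sum>l\<in>{..<N}-{i}. (cmod (Gd i k l))\<^sup>2) \<le> (\<Sum>l<N. (cmod (Gd i k l))\<^sup>2)"
    by (rule sum_mono2) auto
  then show ?thesis using d.ward_div[OF assms(2)] by simp
qed

lemma Gd_diff:
  assumes "i < N" "k < N" "k \<noteq> i"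
  shows "cmod (Gd i k k - G k k) = (cmod (G i k))\<^sup>2 / cmod (G i i)"
  using Gd_eq[of i k k] resolvent_sym[of k i] A_diag assms
  by (simp add: norm_mult norm_divide power2_eq_square)

text \<open>Plays the role of eigenvalue interlacing: by \<open>Gd_eq\<close> each difference is
  \<open>(cmod (G i k))\<^sup>2 / cmod (G i i)\<close>, and the Ward identity sums these with a
  bound free of \<open>N\<close>.\<close>

lemma sum_Gd_diff:
  assumes i: "i < N"
  shows "(\<Sum>k\<in>{..<N}-{i}. cmod (Gd i k k - G k k)) \<le> 1 / Im z"
proof -
  have "(\<Sum>k\<in>{..<N}-{i}. cmod (Gd i k k - G k k)) = (\<Sum>k\<in>{..<N}-{i}. (cmod (G i k))\<^sup>2 / cmod (G i i))"
    by (intro sum.cong refl) (use i Gd_diff in auto)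
  also have "\<dots> \<le> (\<Sum>k<N. (cmod (G i k))\<^sup>2 / cmod (G i i))" by (rule sum_mono2) auto
  also have "\<dots> \<le> 1 / Im z" using diag_row_ratio[OF i] by (simp add: sum_divide_distrib)
  finally show ?thesis .
qed

text \<open>The Ward identity in the minor reduces the double sum to a trace of imaginary parts.
  Passing to the full trace costs \<open>1 / Im z\<close> by \<open>sum_Gd_diff\<close>, which after
  division and square root is the extra \<open>1 / (N * Im z)\<close>.\<close>

lemma double_sum_Gd:
  assumes i: "i < N"
  shows "sqrt ((\<Sum>k\<in>{..<N}-{i}. \<Sum>l\<in>{..<N}-{i}. (cmod (Gd i k l))\<^sup>2) / (real N)\<^sup>2)
    \<le> sqrt (Im m / (real N * Im z)) + 1 / (real N * Im z)"
proof -
  have Npos: "0 < real N" using N by simp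
  have "(\<Sum>k\<in>{..<N}-{i}. \<Sum>l\<in>{..<N}-{i}. (cmod (Gd i k l))\<^sup>2) \<le> (\<Sum>k\<in>{..<N}-{i}. Im (Gd i k k) / Im z)"
    by (intro sum_mono Gd_ward) (use i in auto)
  also have "\<dots> \<le> (\<Sum>k\<in>{..<N}-{i}. (Im (G k k) + cmod (Gd i k k - G k k)) / Im z)"
  proof (intro sum_mono divide_right_mono)
    fix k show "Im (Gd i k k) \<le> Im (G k k) + cmod (Gd i k k - G k k)"
      using abs_Im_le_cmod[of "Gd i k k - G k k"] by simp
  qed (use z in auto)
  also have "\<dots> = ((\<Sum>k\<in>{..<N}-{i}. Im (G k k)) + (\<Sum>k\<in>{..<N}-{i}. cmod (Gd i k k - G k k))) / Im z"
    by (simp add: sum_divide_distrib[symmetric] sum.distrib)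
  also have "\<dots> \<le> ((\<Sum>k<N. Im (G k k)) + 1 / Im z) / Im z"
    using z by (intro divide_right_mono add_mono sum_Gd_diff i sum_mono2) (auto intro: Im_diag_nonneg)
  also have "(\<Sum>k<N. Im (G k k)) = real N * Im m"
    unfolding m_eq using Npos by (simp add: Im_divide_of_nat)
  finally have "(\<Sum>k\<in>{..<N}-{i}. \<Sum>l\<in>{..<N}-{i}. (cmod (Gd i k l))\<^sup>2) / (real N)\<^sup>2
      \<le> (real N * Im m + 1 / Im z) / Im z / (real N)\<^sup>2" by (rule divide_right_mono) simp
  also have "\<dots> = Im m / (real N * Im z) + (1 / (real N * Im z))\<^sup>2"
    using Npos z by (simp add: power2_eq_square field_simps)
  finally have "sqrt ((\<Sum>k\<in>{..<N}-{i}. \<Sum>l\<in>{..<N}-{i}. (cmod (Gd i k l))\<^sup>2) / (real N)\<^sup>2)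
      \<le> sqrt (Im m / (real N * Im z) + (1 / (real N * Im z))\<^sup>2)" by simp
  also have "\<dots> \<le> sqrt (Im m / (real N * Im z)) + sqrt ((1 / (real N * Im z))\<^sup>2)"
    using z Npos Im_m_nonneg by (intro sqrt_add_le_add_sqrt) auto
  also have "sqrt ((1 / (real N * Im z))\<^sup>2) = 1 / (real N * Im z)" using z Npos by simp
  finally show ?thesis .
qed

definition row_avg :: "nat \<Rightarrow> complex" where
  "row_avg i = (\<Sum>k<N. of_real (s k i) * G k k)"

lemma err_ge: "1 / (real N * Im z) \<le> err z" "0 \<le> err z"
proof -
  have nn: "0 \<le> 1 / q" "0 \<le> sqrt (Im m / (real N * Im z))" "0 \<le> 1 / (real N * Im z)"
    using q z Im_m_nonneg by auto
  have "1 / (real N * Im z) \<le> R * (1 / (real N * Im z))" using R nn(3) by (simp add: mult_le_cancel_right1 del: times_divide_eq_right)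
  also have "\<dots> \<le> err z" unfolding err_def using R nn by (intro mult_left_mono) auto
  finally show "1 / (real N * Im z) \<le> err z" .
  then show "0 \<le> err z" using nn(3) by linarith
qed

text \<open>Schur's formula after two replacements: the quadratic form by its conditional mean (row
  estimate), then in that mean the minor entries by full ones (\<open>sum_Gd_diff\<close> and the
  upper bound on the variances).\<close>

lemma self_consistent:
  assumes i: "i < N"
  obtains \<epsilon> where "cmod \<epsilon> \<le> C1 * err z" "G i i * (- z - row_avg i + \<epsilon>) = 1"
proof
  let ?Q = "\<Sum>k\<in>{..<N}-{i}. \<Sum>l\<in>{..<N}-{i}. of_real (A $$ (k, i)) * Gd i k l * of_real (A $$ (l, i))"
  let ?S = "\<Sum>k\<in>{..<N}-{i}. of_real (s k i) * Gd i k k"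
  have Npos: "0 < real N" using N by simp
  show "G i i * (- z - row_avg i + (row_avg i - ?Q)) = 1"
    using G_diag[OF i A_diag[OF i]] by simp
  have "row_avg i = (\<Sum>k\<in>{..<N}-{i}. of_real (s k i) * G k k)"
    unfolding row_avg_def using i by (intro sum.mono_neutral_right) (auto simp: s_diag)
  then have "?S - row_avg i = (\<Sum>k\<in>{..<N}-{i}. of_real (s k i) * (Gd i k k - G k k))"
    by (simp add: sum_subtractf[symmetric] algebra_simps)
  also have "cmod \<dots> \<le> (\<Sum>k\<in>{..<N}-{i}. C0 / real N * cmod (Gd i k k - G k k))"
  proof (intro sum_norm_le)
    fix k assume k: "k \<in> {..<N}-{i}"
    have "0 \<le> 1 / (L * real N)" using L by simp
    also have "\<dots> \<le> s k i" using s_lower[OF i] k by auto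
    finally have "0 \<le> s k i" .
    then show "cmod (of_real (s k i) * (Gd i k k - G k k)) \<le> C0 / real N * cmod (Gd i k k - G k k)"
      using mult_right_mono[OF s_upper[OF i, of k] norm_ge_zero[of "Gd i k k - G k k"]] k by (simp add: norm_mult)
  qed
  also have "\<dots> \<le> C0 / real N * (1 / Im z)"
    unfolding sum_distrib_left[symmetric] using C0 by (intro mult_left_mono sum_Gd_diff i) auto
  also have "\<dots> = C0 * (1 / (real N * Im z))" by simp
  also have "\<dots> \<le> C0 * err z" using C0 err_ge by (intro mult_left_mono) auto
  finally have 1: "cmod (?S - row_avg i) \<le> C0 * err z" .
  have "cmod (?Q - ?S) \<le> 4 * (R * (minor_max N A z i / q +
          sqrt ((\<Sum>k\<in>{..<N}-{i}. \<Sum>l\<in>{..<N}-{i}. (cmod (Gd i k l))\<^sup>2) / (real N)\<^sup>2)))"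
    using good i unfolding rows_good_def row_quad_good_def by auto
  also have "\<dots> \<le> 4 * (R * (2 / q + (sqrt (Im m / (real N * Im z)) + 1 / (real N * Im z))))"
    using R q by (intro mult_left_mono add_mono double_sum_Gd i divide_right_mono minor_max_le) auto
  also have "\<dots> \<le> 4 * (R * (2 * (1 / q + sqrt (Im m / (real N * Im z)) + 1 / (real N * Im z))))"
  proof (intro mult_left_mono)
    have "2 * a + (b + c) \<le> 2 * (a + b + c)" if "0 \<le> b" "0 \<le> c" for a b c :: real
      using that by simp
    from this[of "sqrt (Im m / (real N * Im z))" "1 / (real N * Im z)" "1 / q"]
    show "2 / q + (sqrt (Im m / (real N * Im z)) + 1 / (real N * Im z))
        \<le> 2 * (1 / q + sqrt (Im m / (real N * Im z)) + 1 / (real N * Im z))"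
      using z Im_m_nonneg by simp
  qed (use R in auto)
  also have "\<dots> = 8 * err z" unfolding err_def by simp
  finally have 2: "cmod (?Q - ?S) \<le> 8 * err z" .
  have "cmod (row_avg i - ?Q) \<le> cmod (?S - row_avg i) + cmod (?Q - ?S)"
    using norm_triangle_ineq[of "?S - row_avg i" "?Q - ?S"] by (simp add: norm_minus_commute)
  then show "cmod (row_avg i - ?Q) \<le> C1 * err z" using 1 2 unfolding err_coeff_def by (simp add: algebra_simps)
qed

text \<open>Up to the factor \<open>G i i\<close> the entry is a linear form in column
  \<open>i\<close>. The Ward identity in the minor bounds the sum of its squared coefficients by a
  multiple of \<open>1 / Im z\<close>.\<close>

lemma offdiag_bound:
  assumes i: "i < N" "k < N" "k \<noteq> i"
  shows "cmod (G k i) \<le> 16 * (R * psi N q z)"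
proof -
  have Npos: "0 < real N" using N by simp
  have "cmod (G k i) = cmod (\<Sum>a\<in>{..<N}-{i}. Gd i k a * of_real (A $$ (a, i))) * cmod (G i i)"
    using G_offdiag[OF i] by (simp add: norm_mult)
  also have "\<dots> \<le> (2 * (R * (minor_max N A z i / q + sqrt ((\<Sum>a\<in>{..<N}-{i}. (cmod (Gd i k a))\<^sup>2) / real N)))) * 2"
  proof -
    have lin: "cmod (\<Sum>a\<in>{..<N}-{i}. Gd i k a * of_real (A $$ (a, i)))
        \<le> 2 * (R * (minor_max N A z i / q + sqrt ((\<Sum>a\<in>{..<N}-{i}. (cmod (Gd i k a))\<^sup>2) / real N)))"
      using good i unfolding rows_good_def row_linear_good_def by auto
    show ?thesis
      by (rule mult_mono[OF lin _ order_trans[OF norm_ge_zero lin]]) (use diag_le[OF i(1)] tol in auto)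
  qed
  also have "\<dots> \<le> (2 * (R * (2 / q + 2 / sqrt (real N * Im z)))) * 2"
  proof -
    have "(\<Sum>a\<in>{..<N}-{i}. (cmod (Gd i k a))\<^sup>2) \<le> Im (Gd i k k) / Im z" by (rule Gd_ward) fact+
    also have "\<dots> \<le> 4 / Im z"
      using Gd_le[OF i(1,2,2,3,3)] abs_Im_le_cmod[of "Gd i k k"] z by (intro divide_right_mono) auto
    finally have "(\<Sum>a\<in>{..<N}-{i}. (cmod (Gd i k a))\<^sup>2) / real N \<le> 4 / Im z / real N"
      by (rule divide_right_mono) simp
    then have "sqrt ((\<Sum>a\<in>{..<N}-{i}. (cmod (Gd i k a))\<^sup>2) / real N) \<le> sqrt (4 / (real N * Im z))"
      by (simp add: field_simps)
    also have "\<dots> = 2 / sqrt (real N * Im z)" by (simp add: real_sqrt_divide)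
    finally show ?thesis using R q minor_max_le[OF i(1)]
      by (intro mult_right_mono mult_left_mono add_mono divide_right_mono) auto
  qed
  also have "\<dots> = 8 * (R * psi N q z)" unfolding psi_def by (simp add: algebra_simps)
  also have "\<dots> \<le> 16 * (R * psi N q z)"
    using R q z by (intro mult_right_mono) (auto simp: psi_def)
  finally show ?thesis .
qed

section \<open>Oscillation of the diagonal and the equation for m\<close>

definition osc :: real where
  "osc = Max ((\<lambda>(i, j). cmod (G i i - G j j)) ` ({..<N} \<times> {..<N}))"

lemma osc_ge: "i < N \<Longrightarrow> j < N \<Longrightarrow> cmod (G i i - G j j) \<le> osc"
  unfolding osc_def by (rule Max_ge) auto

text \<open>Subtract the self-consistent equations at a pair attaining the maximum.
  \<open>averaging_contraction\<close> returns a fraction of \<open>osc\<close> itself, which is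
  absorbed on the left.\<close>

lemma osc_bound: "osc \<le> 16 * L * (C1 * err z)"
proof -
  have "osc \<in> (\<lambda>(i, j). cmod (G i i - G j j)) ` ({..<N} \<times> {..<N})"
    unfolding osc_def using N by (intro Max_in) (auto simp: lessThan_empty_iff bot_nat_def)
  then obtain i j where ij: "i < N" "j < N" and osc: "osc = cmod (G i i - G j j)" by auto
  have osc0: "0 \<le> osc" using osc by simp
  obtain \<epsilon> where e: "cmod \<epsilon> \<le> C1 * err z" "G i i * (- z - row_avg i + \<epsilon>) = 1" using self_consistent[OF ij(1)] .
  obtain \<delta> where d: "cmod \<delta> \<le> C1 * err z" "G j j * (- z - row_avg j + \<delta>) = 1" using self_consistent[OF ij(2)] .
  have "G i i - G j j = G i i * (G j j * (- z - row_avg j + \<delta>)) - G j j * (G i i * (- z - row_avg i + \<epsilon>))"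
    using d e by simp
  also have "\<dots> = G i i * G j j * ((row_avg i - row_avg j) + (\<delta> - \<epsilon>))" by (simp add: algebra_simps)
  finally have "osc = cmod (G i i) * cmod (G j j) * cmod ((row_avg i - row_avg j) + (\<delta> - \<epsilon>))"
    using osc by (simp add: norm_mult)
  also have "\<dots> \<le> (1 + tol) * (1 + tol) * ((1 - 1 / (2 * L)) * osc + 2 * (C1 * err z))"
  proof (intro mult_mono diag_le ij)
    have "cmod (row_avg i - row_avg j) \<le> (1 - 1 / (L * real N) * (real N - 2)) * osc"
      unfolding row_avg_def
      by (rule averaging_contraction[OF ij]) (use s_sum s_diag s_lower ij L osc_ge in auto)
    \<comment> \<open>Here \<open>4 \<le> N\<close> gives
      \<open>(N - 2) / N \<ge> 1 / 2\<close>.\<close>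
    also have "\<dots> \<le> (1 - 1 / (2 * L)) * osc"
      using N L osc0 by (intro mult_right_mono) (auto simp: field_simps)
    finally have "cmod (row_avg i - row_avg j) \<le> (1 - 1 / (2 * L)) * osc" .
    moreover have "cmod (\<delta> - \<epsilon>) \<le> 2 * (C1 * err z)"
      using norm_triangle_ineq4[of \<delta> \<epsilon>] d e by simp
    ultimately show "cmod ((row_avg i - row_avg j) + (\<delta> - \<epsilon>)) \<le> (1 - 1 / (2 * L)) * osc + 2 * (C1 * err z)"
      using norm_triangle_ineq[of "row_avg i - row_avg j" "\<delta> - \<epsilon>"] by linarith
  qed (use tol in auto)
  also have "\<dots> = ((1 + tol)\<^sup>2 * (1 - 1 / (2 * L))) * osc + (1 + tol)\<^sup>2 * (2 * (C1 * err z))"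
    by (simp add: power2_eq_square algebra_simps)
  also have "\<dots> \<le> (1 - 1 / (4 * L)) * osc + 2 * (2 * (C1 * err z))"
  proof (intro add_mono mult_right_mono tol osc0)
    have "(1 + tol)\<^sup>2 \<le> (1 + 1 / 20)\<^sup>2" using tol by (intro power_mono) auto
    then show "(1 + tol)\<^sup>2 \<le> 2" by (simp add: power2_eq_square)
    show "0 \<le> 2 * (C1 * err z)" using err_ge C0 by (simp add: err_coeff_def)
  qed
  finally have "1 / (4 * L) * osc \<le> 4 * (C1 * err z)" by (simp add: algebra_simps)
  then have "(4 * L) * (1 / (4 * L) * osc) \<le> (4 * L) * (4 * (C1 * err z))"
    using L by (intro mult_left_mono) auto
  then show ?thesis using L by simp
qed

lemma diag_diff_m:
  assumes "i < N"
  shows "cmod (G i i - m) \<le> osc"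
proof -
  have Npos: "0 < real N" using N by simp
  have "of_nat N * (G i i - m) = (\<Sum>k<N. G i i - G k k)"
    unfolding m_eq using Npos by (simp add: sum_subtractf algebra_simps)
  then have "real N * cmod (G i i - m) = cmod (\<Sum>k<N. G i i - G k k)"
    by (metis norm_mult norm_of_nat)
  also have "\<dots> \<le> (\<Sum>k<N. osc)" by (intro sum_norm_le osc_ge) (use assms in auto)
  finally show ?thesis using Npos by simp
qed

lemma row_avg_diff_m:
  assumes i: "i < N"
  shows "cmod (row_avg i - m) \<le> osc"
proof -
  have s0: "0 \<le> s k i" if "k < N" for k
    using s_lower[OF i that] s_diag[OF i] L by (cases "k = i") (auto intro: order_trans[rotated])
  have "(\<Sum>k<N. of_real (s k i)) = (1::complex)" unfolding of_real_sum[symmetric] s_sum[OF i] by simp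
  then have "row_avg i - m = (\<Sum>k<N. of_real (s k i) * (G k k - m))"
    unfolding row_avg_def right_diff_distrib sum_subtractf sum_distrib_right[symmetric] by simp
  also have "cmod \<dots> \<le> (\<Sum>k<N. s k i * osc)"
    by (intro sum_norm_le) (auto simp: norm_mult s0 intro!: mult_left_mono diag_diff_m)
  also have "\<dots> = osc" unfolding sum_distrib_right[symmetric] s_sum[OF i] by simp
  finally show ?thesis .
qed

lemma m_norm_le: "cmod m \<le> 2"
proof -
  have Npos: "0 < real N" using N by simp
  have "cmod (\<Sum>i<N. G i i) \<le> (\<Sum>i<N. 2)"
    by (intro sum_norm_le) (use diag_le tol in force)
  then show ?thesis unfolding m_eq using Npos by (simp add: norm_divide field_simps)
qed

text \<open>The equation of row 0, standing for any row, replaces the constant 1; the distances of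
  \<open>G 0 0\<close> and \<open>row_avg 0\<close> from \<open>m\<close> are at most
  \<open>osc\<close>. The numbers are 11 = 9 + 2 and 210 = 16 * 13 + 2.\<close>

lemma m_quadratic:
  assumes z9: "cmod z \<le> 9"
  shows "cmod (m\<^sup>2 + z * m + 1) \<le> 210 * L * C1 * err z"
proof -
  have i: "0 < N" using N by simp
  obtain \<epsilon> where e: "cmod \<epsilon> \<le> C1 * err z" "G 0 0 * (- z - row_avg 0 + \<epsilon>) = 1" using self_consistent[OF i] .
  have CE: "0 \<le> C1 * err z" using e(1) norm_ge_zero order_trans by blast
  have osc0: "0 \<le> osc" using osc_ge[OF i i] by simp
  have "m\<^sup>2 + z * m + 1 = m\<^sup>2 + z * m + G 0 0 * (- z - row_avg 0 + \<epsilon>)" using e by simp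
  also have "\<dots> = (G 0 0 - m) * (- z - m) + G 0 0 * ((m - row_avg 0) + \<epsilon>)"
    by (simp add: algebra_simps power2_eq_square)
  also have "cmod \<dots> \<le> cmod (G 0 0 - m) * cmod (- z - m) + cmod (G 0 0) * cmod ((m - row_avg 0) + \<epsilon>)"
    by (rule order_trans[OF norm_triangle_ineq]) (simp add: norm_mult)
  also have "\<dots> \<le> osc * 11 + 2 * (osc + C1 * err z)"
  proof (intro add_mono mult_mono diag_diff_m i)
    show "cmod (- z - m) \<le> 11" using norm_triangle_ineq4[of "- z" m] m_norm_le z9 by simp
    show "cmod (G 0 0) \<le> 2" using diag_le[OF i] tol by simp
    show "cmod ((m - row_avg 0) + \<epsilon>) \<le> osc + C1 * err z"
      using norm_triangle_ineq[of "m - row_avg 0" \<epsilon>] row_avg_diff_m[OF i] e by (simp add: norm_minus_commute)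
  qed (use osc0 in auto)
  also have "\<dots> \<le> (16 * L * (C1 * err z)) * 13 + 2 * (L * (C1 * err z))"
    using osc_bound CE L mult_right_mono[of 1 L "C1 * err z"] by simp
  finally show ?thesis by (simp add: algebra_simps)
qed

lemma err_le_psi:
  assumes "1 \<le> real N * Im z"
  shows "err z \<le> 3 * (R * psi N q z)"
proof -
  let ?x = "real N * Im z"
  have "sqrt (Im m / ?x) \<le> sqrt (4 / ?x)"
    using m_norm_le abs_Im_le_cmod[of m] assms by (intro real_sqrt_le_mono divide_right_mono) auto
  also have "\<dots> = 2 / sqrt ?x" by (simp add: real_sqrt_divide)
  finally have 1: "sqrt (Im m / ?x) \<le> 2 / sqrt ?x" .
  have "sqrt ?x \<le> ?x" using assms by (simp add: real_le_lsqrt self_le_power sqrt_le_D)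
  then have 2: "1 / ?x \<le> 1 / sqrt ?x" using assms by (intro divide_left_mono) auto
  have "1 / q + sqrt (Im m / ?x) + 1 / ?x \<le> 3 * psi N q z"
  proof -
    have "a + b + c \<le> 3 * (a + t)" if "b \<le> 2 * t" "c \<le> t" "0 \<le> a" for a b c t :: real
      using that by simp
    from this[of "sqrt (Im m / ?x)" "1 / sqrt ?x" "1 / ?x" "1 / q"]
    show ?thesis unfolding psi_def using 1 2 q by simp
  qed
  then have "R * (1 / q + sqrt (Im m / ?x) + 1 / ?x) \<le> R * (3 * psi N q z)" using R by (intro mult_left_mono) auto
  then show ?thesis unfolding err_def by simp
qed

end

end

section \<open>Bootstrap along a vertical path\<close>

context sparse_instance begin

abbreviation offset_const :: real where "offset_const \<equiv> offset_coeff C0 L"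
abbreviation root_const :: real where "root_const \<equiv> root_coeff C0 L"

lemma C1_ge: "8 \<le> C1" using C0 unfolding err_coeff_def by simp

lemma const_pos: "1 \<le> offset_const" "1 \<le> root_const"
proof -
  have "1 * 8 \<le> L * C1" using L C1_ge by (intro mult_mono) auto
  then show "1 \<le> offset_const" "1 \<le> root_const" unfolding offset_coeff_def root_coeff_def by auto
qed

text \<open>What can be concluded at a single spectral parameter: the root is not yet determined,
  hence the disjunction.\<close>

definition near_sc :: "complex \<Rightarrow> bool" where
  "near_sc z \<longleftrightarrow>
     (\<forall>i<N. \<forall>k<N. k \<noteq> i \<longrightarrow> cmod (resolvent A z $$ (k, i)) \<le> 16 * (R * psi N q z)) \<and>
     (\<forall>i<N. cmod (resolvent A z $$ (i, i) - m_emp N A z) \<le> offset_const * (R * psi N q z)) \<and>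
     (cmod (m_emp N A z - m_sc z) \<le> root_const * R * conv_rate N q z \<or>
      cmod (m_emp N A z - 1 / m_sc z) \<le> root_const * R * conv_rate N q z)"

lemma near_scI:
  assumes z: "Im z > 0" "cmod z \<le> 9" "1 \<le> real N * Im z" and ap: "a_priori z"
    and good: "rows_good N q R s A z"
  shows "near_sc z"
  unfolding near_sc_def
proof (intro conjI allI impI)
  note h = z(1) ap good
  show "cmod (resolvent A z $$ (k, i)) \<le> 16 * (R * psi N q z)" if "i < N" "k < N" "k \<noteq> i" for i k
    by (rule offdiag_bound[OF h that])
  show "cmod (resolvent A z $$ (i, i) - m_emp N A z) \<le> offset_const * (R * psi N q z)" if i: "i < N" for i
  proof -
    have "cmod (resolvent A z $$ (i, i) - m_emp N A z) \<le> 16 * L * (C1 * err z)"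
      using diag_diff_m[OF h i] osc_bound[OF h] by linarith
    also have "\<dots> \<le> 16 * L * (C1 * (3 * (R * psi N q z)))"
      using L C1_ge by (intro mult_left_mono err_le_psi h z) auto
    finally show ?thesis unfolding offset_coeff_def by (simp add: mult_ac)
  qed
  have LC: "0 \<le> 210 * L * C1" using L C1_ge by simp
  have B: "1 \<le> 210 * L * C1 * R"
  proof -
    have "1 * 1 \<le> (210 * L * C1) * R"
      using const_pos R by (intro mult_mono) (auto simp: root_coeff_def offset_coeff_def)
    then show ?thesis by simp
  qed
  show "cmod (m_emp N A z - m_sc z) \<le> root_const * R * conv_rate N q z \<or>
      cmod (m_emp N A z - 1 / m_sc z) \<le> root_const * R * conv_rate N q z"
    using root_dichotomy[OF z(1) z(3) q B Im_m_nonneg[OF h]] m_quadratic[OF h z(2)]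
    unfolding root_coeff_def err_def by (simp add: mult_ac)
qed

lemma conv_rate_pos: "0 < real N * Im z \<Longrightarrow> 0 < conv_rate N q z"
  unfolding conv_rate_def using q by (intro add_pos_nonneg) auto

lemma conv_rate_antimono: "0 < Im z \<Longrightarrow> Im z \<le> Im w \<Longrightarrow> conv_rate N q w \<le> conv_rate N q z"
  unfolding conv_rate_def using N
  by (intro add_left_mono divide_left_mono powr_mono2 mult_left_mono mult_pos_pos) auto

lemma psi_antimono: "0 < Im z \<Longrightarrow> Im z \<le> Im w \<Longrightarrow> psi N q w \<le> psi N q z"
  unfolding psi_def using N
  by (intro add_left_mono divide_left_mono real_sqrt_le_mono mult_left_mono mult_pos_pos) auto

text \<open>Closes the loop of the bootstrap. For \<open>cmod z \<le> 9\<close>,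
  \<open>m_sc_lower\<close> gives \<open>m_sc z\<close> modulus at least 1/10, so diagonal entries
  have modulus at least 1/20, and \<open>Gd_eq\<close> bounds minor entries by
  \<open>1 + tol + 20 * tol\<^sup>2\<close>.\<close>

lemma a_priori_near:
  assumes z: "Im z > 0" "cmod z \<le> 9"
    and d: "\<And>i. i < N \<Longrightarrow> cmod (resolvent A z $$ (i, i) - m_sc z) \<le> tol"
    and o: "\<And>i k. i < N \<Longrightarrow> k < N \<Longrightarrow> k \<noteq> i \<Longrightarrow> cmod (resolvent A z $$ (k, i)) \<le> tol"
  shows "a_priori z"
  unfolding a_priori_def
proof (intro conjI allI impI)
  interpret sym_resolvent N A z by (rule resolvent_model) (use z in auto)
  show le: "cmod (G i i) \<le> 1 + tol" if "i < N" for i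
    using norm_triangle_sub[of "G i i" "m_sc z"] d[OF that] m_sc_norm_lt_1[OF z(1)] by simp
  fix i k l assume ikl: "i < N" "k < N" "l < N" "k \<noteq> i" "l \<noteq> i"
  have "1 \<le> cmod (m_sc z) * (cmod z + 1)" by (rule m_sc_lower[OF z(1)])
  also have "\<dots> \<le> cmod (m_sc z) * 10" using z by (intro mult_left_mono) auto
  finally have "1 / 10 \<le> cmod (m_sc z)" by simp
  then have low: "1 / 20 \<le> cmod (G i i)"
    using norm_triangle_sub[of "m_sc z" "G i i"] d[OF ikl(1)] tol by (simp add: norm_minus_commute)
  have "cmod (Gd i k l) \<le> cmod (G k l) + cmod (G k i) * cmod (G i l) / cmod (G i i)"
    using Gd_eq[OF ikl(1) A_diag[OF ikl(1)] ikl(2,3,4)] norm_triangle_ineq4[of "G k l" "G k i * G i l / G i i"]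
    by (simp add: norm_mult norm_divide)
  also have "\<dots> \<le> (1 + tol) + tol * tol / (1 / 20)"
  proof (intro add_mono frac_le mult_mono o ikl low)
    show "cmod (G k l) \<le> 1 + tol" using le[of k] o[of l k] ikl by (cases "k = l") auto
  qed (use tol ikl in auto)
  also have "tol * tol \<le> 1 / 20 * (1 / 20)" using tol by (intro mult_mono) auto
  finally show "cmod (Gd i k l) \<le> 2" using tol by simp
qed

text \<open>The induction runs down the vertical path towards \<open>z\<close>.  The last conjunct of the induction
  hypothesis excludes the wrong root as long as the two roots are separated; once their distance
  falls below the error it stays there.\<close>

lemma bootstrap:
  assumes z: "1 / real N \<le> Im z" "\<bar>Re z\<bar> \<le> 3" "Im z \<le> 3"
    and good: "\<And>k. k \<le> 3 * N ^ 4 \<Longrightarrow> rows_good N q R s A (path N z k)"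
    and small: "2 / (real N)\<^sup>2 + offset_const * (R * psi N q z) + 5 * (root_const * R * conv_rate N q z) \<le> tol"
      "16 * (R * psi N q z) + 1 / (real N)\<^sup>2 \<le> tol"
    and qN: "q \<le> (real N)\<^sup>2"
  shows "near_sc z" "cmod (m_emp N A z - m_sc z) \<le> 5 * (root_const * R * conv_rate N q z)"
proof -
  have Npos: "0 < real N" using N by simp
  have "0 < 1 / real N" using Npos by simp
  then have z0: "0 < Im z" using z(1) by linarith
  \<comment> \<open>With \<open>3 * N ^ 4\<close> steps of length \<open>1 / N ^ 4\<close>, the
    start \<open>v 0\<close> lies at height \<open>Im z + 3\<close> and the end \<open>v n\<close>
    is \<open>z\<close>.\<close>
  define n where "n = 3 * N ^ 4"
  define v where "v j = path N z (n - j)" for j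
  let ?\<theta> = "\<lambda>w. root_const * R * conv_rate N q w"
  let ?\<Lambda> = "\<lambda>w. cmod (m_emp N A w - m_sc w)"
  have Im_v: "Im z \<le> Im (v j)" "0 < Im (v j)" "1 / real N \<le> Im (v j)" for j
  proof -
    show 1: "Im z \<le> Im (v j)" unfolding v_def by simp
    show "0 < Im (v j)" "1 / real N \<le> Im (v j)"
      using z 1 Npos order_less_le_trans[of 0 "1 / real N" "Im (v j)"] by auto
  qed
  have NIm: "1 \<le> real N * Im (v j)" for j using Im_v(3)[of j] Npos by (simp add: field_simps)
  have v9: "cmod (v j) \<le> 9" for j
  proof -
    have "real (n - j) \<le> 3 * real N ^ 4" unfolding n_def by (metis diff_le_self of_nat_le_iff of_nat_mult of_nat_numeral of_nat_power)
    then have "real (n - j) / real N ^ 4 \<le> 3" using Npos by (simp add: field_simps)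
    then have "Im (v j) \<le> 6" unfolding v_def using z by simp
    then show ?thesis
      using cmod_le[of "v j"] z Im_v(2)[of j] unfolding v_def by simp
  qed
  have good_v: "rows_good N q R s A (v j)" for j unfolding v_def n_def by (rule good) simp
  have \<theta>_v: "?\<theta> (v j) \<le> ?\<theta> z" for j
    using conv_rate_antimono[OF z0 Im_v(1)] const_pos R by (intro mult_left_mono) auto
  have psi_v: "R * psi N q (v j) \<le> R * psi N q z" for j
    using psi_antimono[OF z0 Im_v(1)] R by (intro mult_left_mono) auto
  \<comment> \<open>The change over one grid step must be smaller than the error itself;
    \<open>q \<le> N\<^sup>2\<close> bounds the error below by \<open>1 / N\<close>.\<close>
  have \<theta>_small: "1 / (real N)\<^sup>2 < ?\<theta> (v j)" for j
  proof -
    have "sqrt q \<le> real N" using qN Npos by (simp add: real_le_lsqrt)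
    then have "1 / real N \<le> 1 / sqrt q" using q Npos by (intro divide_left_mono mult_pos_pos) auto
    also have "\<dots> \<le> conv_rate N q (v j)" unfolding conv_rate_def by simp
    also have "\<dots> \<le> (root_const * R) * conv_rate N q (v j)"
    proof -
      have "1 * 1 \<le> root_const * R" using const_pos R by (intro mult_mono) auto
      then show ?thesis
        using conv_rate_pos[of "v j"] NIm[of j] by (simp add: mult_le_cancel_right1)
    qed
    finally have "1 / real N \<le> ?\<theta> (v j)" .
    moreover have "1 / (real N)\<^sup>2 < 1 / real N" using N by (simp add: power2_eq_square field_simps)
    ultimately show ?thesis by linarith
  qed
  have claim: "a_priori (v j) \<and> (4 * ?\<theta> (v j) \<le> root_gap (v j) \<longrightarrow> ?\<Lambda> (v j) \<le> ?\<theta> (v j))"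
    if "j \<le> n" for j
    using that
  proof (induction j)
    case 0
    have Im3: "3 \<le> Im (v 0)"
    proof -
      have "real n / real N ^ 4 = 3" unfolding n_def using Npos by simp
      then show ?thesis unfolding v_def using z Npos by (simp add: order_trans[OF _ z(1)])
    qed
    interpret sym_resolvent N A "v 0" by (rule resolvent_model) (use Im_v(2)[of 0] in simp)
    have inv: "1 / Im (v 0) \<le> 1 / 3" using Im3 by (intro divide_left_mono) auto
    have Gle: "cmod (G i i) \<le> 1 / 3" if "i < N" for i
      using norm_diag_le[OF Im_v(2) that] inv by linarith
    have ap: "a_priori (v 0)"
      unfolding a_priori_def
    proof (intro conjI allI impI)
      show "cmod (G i i) \<le> 1 + tol" if "i < N" for i using Gle[OF that] tol by simp
      fix i k l assume "i < N" "k < N" "l < N"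
      interpret d: sym_resolvent N "del_index i A" "v 0"
        by (rule sym_resolvent_del_index) (rule sym_resolvent_axioms)
      show "cmod (Gd i k l) \<le> 2"
        using d.norm_entry_le[OF Im_v(2) \<open>k < N\<close> \<open>l < N\<close>] inv by linarith
    qed
    have ns: "near_sc (v 0)" by (rule near_scI[OF Im_v(2) v9 NIm ap good_v])
    have "?\<theta> (v 0) \<le> 1 / 20"
    proof -
      have "0 \<le> 2 / (real N)\<^sup>2" "0 \<le> offset_const * (R * psi N q z)"
        using const_pos R q z Npos unfolding psi_def by (auto intro!: mult_nonneg_nonneg add_nonneg_nonneg order_trans[OF _ z(1)])
      then show ?thesis using small(1) tol(2) \<theta>_v[of 0] by linarith
    qed
    moreover have "cmod (m_emp N A (v 0)) \<le> 1 / 3"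
    proof -
      have "cmod (\<Sum>i<N. G i i) \<le> (\<Sum>i<N. 1 / 3)" by (intro sum_norm_le) (use Gle in auto)
      then show ?thesis unfolding m_emp_eq[OF sym_resolvent_axioms] using Npos by (simp add: norm_divide field_simps)
    qed
    moreover have "3 \<le> cmod (1 / m_sc (v 0))"
    proof -
      have "cmod (m_sc (v 0)) \<le> 1 / 3" using m_sc_upper[OF Im_v(2)[of 0]] inv by linarith
      then show ?thesis
        using quadratic_root_facts(1)[OF m_sc_quadratic[of "v 0"]] by (simp add: norm_divide field_simps)
    qed
    \<comment> \<open>At height at least 3 the roots are told apart by size: \<open>m\<close> has
      modulus at most 1/3, the wrong root at least 3.\<close>
    ultimately have "\<not> cmod (m_emp N A (v 0) - 1 / m_sc (v 0)) \<le> ?\<theta> (v 0)"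
      using norm_triangle_ineq2[of "1 / m_sc (v 0)" "m_emp N A (v 0)"] by (simp add: norm_minus_commute)
    then show ?case using ap ns unfolding near_sc_def by blast
  next
    case (Suc j)
    let ?w = "v j" and ?u = "v (Suc j)"
    have IH: "a_priori ?w" "4 * ?\<theta> ?w \<le> root_gap ?w \<Longrightarrow> ?\<Lambda> ?w \<le> ?\<theta> ?w"
      using Suc by auto
    have ns: "near_sc ?w" by (rule near_scI[OF Im_v(2) v9 NIm IH(1) good_v])
    \<comment> \<open>Either the induction hypothesis selects the root, or the roots are within
      \<open>4 * ?\<theta> ?w\<close> of each other and closeness to either one suffices.\<close>
    have L5: "?\<Lambda> ?w \<le> 5 * ?\<theta> ?w"
    proof (cases "4 * ?\<theta> ?w \<le> root_gap ?w")
      case True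
      then show ?thesis using IH(2) \<theta>_small[of j] order_trans[of 0 "1 / (real N)\<^sup>2" "?\<theta> ?w"] by force
    next
      case False
      have "?\<Lambda> ?w \<le> cmod (m_emp N A ?w - 1 / m_sc ?w) + root_gap ?w"
        unfolding root_gap_def
        using norm_triangle_ineq4[of "m_emp N A ?w - 1 / m_sc ?w" "m_sc ?w - 1 / m_sc ?w"] by simp
      moreover have "0 < ?\<theta> ?w" using \<theta>_small[of j] by (rule order_le_less_trans[rotated]) simp
      ultimately show ?thesis using False ns unfolding near_sc_def by linarith
    qed
    have step: "cmod (?u - ?w) = 1 / real N ^ 4"
    proof -
      have "real (n - j) = real (n - Suc j) + 1" using Suc.prems by simp
      then have "real (n - j) / real N ^ 4 - real (n - Suc j) / real N ^ 4 = 1 / real N ^ 4"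
        by (simp add: diff_divide_distrib[symmetric])
      moreover have "?w - ?u = \<i> * of_real (real (n - j) / real N ^ 4 - real (n - Suc j) / real N ^ 4)"
        unfolding v_def path_def of_real_diff right_diff_distrib by (rule add_diff_cancel_left)
      ultimately have "?w - ?u = \<i> * of_real (1 / real N ^ 4)" by (simp only:)
      then have "cmod (?w - ?u) = 1 / real N ^ 4" by (simp add: norm_mult norm_divide norm_power)
      then show ?thesis by (simp add: norm_minus_commute)
    qed
    have lipG: "cmod (resolvent A ?u $$ (i, k) - resolvent A ?w $$ (i, k)) \<le> 1 / (real N)\<^sup>2"
      if "i < N" "k < N" for i k
    proof -
      have "cmod (resolvent A ?u $$ (i, k) - resolvent A ?w $$ (i, k)) \<le> cmod (?u - ?w) / (Im ?u * Im ?w)"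
        by (rule resolvent_lipschitz[OF resolvent_model resolvent_model])
          (use Im_v(2)[of j] Im_v(2)[of "Suc j"] that in auto)
      also have "\<dots> \<le> (1 / real N ^ 4) / (1 / real N * (1 / real N))"
        unfolding step using Im_v(2,3)[of j] Im_v(2,3)[of "Suc j"] Npos
        by (intro divide_left_mono mult_mono mult_pos_pos) auto
      also have "\<dots> = 1 / (real N)\<^sup>2" using Npos by (simp add: field_simps power2_eq_square power4_eq_xxxx)
      finally show ?thesis .
    qed
    have lipsc: "cmod (m_sc ?u - m_sc ?w) \<le> 1 / (real N)\<^sup>2"
    proof -
      have "cmod (m_sc ?u - m_sc ?w) \<le> cmod (?u - ?w) / (1 / real N)"
        by (rule m_sc_lipschitz) (use Im_v Npos in auto)
      also have "\<dots> = 1 / real N ^ 3" unfolding step using Npos by (simp add: power3_eq_cube power4_eq_xxxx)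
      also have "\<dots> \<le> 1 / (real N)\<^sup>2" using N by (intro divide_left_mono power_increasing) auto
      finally show ?thesis .
    qed
    have lipm: "cmod (m_emp N A ?u - m_emp N A ?w) \<le> 1 / (real N)\<^sup>2"
    proof -
      have "m_emp N A ?u - m_emp N A ?w = (\<Sum>i<N. resolvent A ?u $$ (i, i) - resolvent A ?w $$ (i, i)) / of_nat N"
        using m_emp_eq[OF resolvent_model, of ?u] m_emp_eq[OF resolvent_model, of ?w] Im_v(2)[of j] Im_v(2)[of "Suc j"]
        by (simp add: sum_subtractf diff_divide_distrib)
      also have "cmod \<dots> \<le> (\<Sum>i<N. 1 / (real N)\<^sup>2) / real N"
        unfolding norm_divide norm_of_nat
        by (intro divide_right_mono sum_norm_le lipG) auto
      finally show ?thesis using Npos by simp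
    qed
    have ap: "a_priori ?u"
    proof (rule a_priori_near[OF Im_v(2) v9])
      show "cmod (resolvent A ?u $$ (i, i) - m_sc ?u) \<le> tol" if i: "i < N" for i
      proof -
        have "resolvent A ?u $$ (i, i) - m_sc ?u = (resolvent A ?u $$ (i, i) - resolvent A ?w $$ (i, i))
            + (resolvent A ?w $$ (i, i) - m_emp N A ?w) + (m_emp N A ?w - m_sc ?w) - (m_sc ?u - m_sc ?w)" by simp
        also have "cmod \<dots> \<le> cmod (resolvent A ?u $$ (i, i) - resolvent A ?w $$ (i, i))
            + cmod (resolvent A ?w $$ (i, i) - m_emp N A ?w) + ?\<Lambda> ?w + cmod (m_sc ?u - m_sc ?w)"
          by (intro order_trans[OF norm_triangle_ineq4] add_mono order_trans[OF norm_triangle_ineq] order_refl)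
        also have "\<dots> \<le> 1 / (real N)\<^sup>2 + offset_const * (R * psi N q z) + 5 * ?\<theta> z + 1 / (real N)\<^sup>2"
        proof (intro add_mono lipG i lipsc)
          have "cmod (resolvent A ?w $$ (i, i) - m_emp N A ?w) \<le> offset_const * (R * psi N q ?w)"
            using ns i unfolding near_sc_def by auto
          also have "\<dots> \<le> offset_const * (R * psi N q z)" by (rule mult_left_mono[OF psi_v]) (use const_pos in simp)
          finally show "cmod (resolvent A ?w $$ (i, i) - m_emp N A ?w) \<le> offset_const * (R * psi N q z)" .
          show "?\<Lambda> ?w \<le> 5 * ?\<theta> z" using L5 \<theta>_v[of j] by linarith
        qed
        also have "\<dots> \<le> tol" using small(1) by simp
        finally show ?thesis .
      qed
      show "cmod (resolvent A ?u $$ (k, i)) \<le> tol" if ik: "i < N" "k < N" "k \<noteq> i" for i k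
      proof -
        have "cmod (resolvent A ?u $$ (k, i)) \<le> cmod (resolvent A ?w $$ (k, i)) + 1 / (real N)\<^sup>2"
          using lipG[OF ik(2,1)] norm_triangle_sub[of "resolvent A ?u $$ (k, i)" "resolvent A ?w $$ (k, i)"] by linarith
        also have "\<dots> \<le> 16 * (R * psi N q ?w) + 1 / (real N)\<^sup>2"
          using ns ik unfolding near_sc_def by auto
        also have "\<dots> \<le> tol" using psi_v[of j] small(2) by linarith
        finally show ?thesis .
      qed
    qed
    have nu: "near_sc ?u" by (rule near_scI[OF Im_v(2) v9 NIm ap good_v])
    \<comment> \<open>Monotonicity of gap and rate transfers the separation from \<open>?u\<close>
      up to \<open>?w\<close>, where the induction hypothesis applies. If \<open>m\<close> then
      changed roots within one step, the gap at \<open>?u\<close> would be at most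
      \<open>2 * ?\<theta> ?u + 2 / N\<^sup>2\<close>, which is less than
      \<open>4 * ?\<theta> ?u\<close>.\<close>
    have "?\<Lambda> ?u \<le> ?\<theta> ?u" if sep: "4 * ?\<theta> ?u \<le> root_gap ?u"
    proof (rule ccontr)
      assume "\<not> ?thesis"
      then have other: "cmod (m_emp N A ?u - 1 / m_sc ?u) \<le> ?\<theta> ?u" using nu unfolding near_sc_def by blast
      have Imm: "Im ?u \<le> Im ?w" unfolding v_def by (simp add: divide_right_mono)
      have th: "?\<theta> ?w \<le> ?\<theta> ?u"
        using conv_rate_antimono[OF Im_v(2)[of "Suc j"] Imm] const_pos R by (intro mult_left_mono) auto
      have "root_gap ?u \<le> root_gap ?w"
        by (rule root_gap_mono) (use Imm Im_v(2)[of "Suc j"] in \<open>auto simp: v_def\<close>)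
      then have "?\<Lambda> ?w \<le> ?\<theta> ?w" using IH(2) th sep by linarith
      have "m_emp N A ?u - m_sc ?u = (m_emp N A ?u - m_emp N A ?w) + (m_emp N A ?w - m_sc ?w) - (m_sc ?u - m_sc ?w)"
        by simp
      also have "cmod \<dots> \<le> cmod (m_emp N A ?u - m_emp N A ?w) + ?\<Lambda> ?w + cmod (m_sc ?u - m_sc ?w)"
        by (intro order_trans[OF norm_triangle_ineq4] add_mono order_trans[OF norm_triangle_ineq] order_refl)
      finally have "?\<Lambda> ?u \<le> ?\<theta> ?u + 2 * (1 / (real N)\<^sup>2)"
        using lipm lipsc \<open>?\<Lambda> ?w \<le> ?\<theta> ?w\<close> th by linarith
      moreover have "root_gap ?u \<le> ?\<Lambda> ?u + cmod (m_emp N A ?u - 1 / m_sc ?u)"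
        unfolding root_gap_def
        using norm_triangle_ineq4[of "m_emp N A ?u - 1 / m_sc ?u" "m_emp N A ?u - m_sc ?u"] by simp
      ultimately show False using sep other \<theta>_small[of "Suc j"] by linarith
    qed
    then show ?case using ap by blast
  qed
  have vn: "v n = z" unfolding v_def path_def by simp
  have ap: "a_priori z" using claim[of n] vn by simp
  show ns: "near_sc z" using near_scI[OF Im_v(2)[of n] v9 NIm _ good_v] ap unfolding vn by blast
  show "?\<Lambda> z \<le> 5 * ?\<theta> z"
  proof (cases "4 * ?\<theta> z \<le> root_gap z")
    case True
    moreover have "0 < ?\<theta> z" using \<theta>_small[of n] unfolding vn by (rule order_le_less_trans[rotated]) simp
    ultimately show ?thesis using claim[of n] vn by simp
  next
    case False
    have "?\<Lambda> z \<le> cmod (m_emp N A z - 1 / m_sc z) + root_gap z"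
      unfolding root_gap_def
      using norm_triangle_ineq4[of "m_emp N A z - 1 / m_sc z" "m_sc z - 1 / m_sc z"] by simp
    moreover have "0 < ?\<theta> z" using \<theta>_small[of n] unfolding vn by (rule order_le_less_trans[rotated]) simp
    ultimately show ?thesis using False ns unfolding near_sc_def by linarith
  qed
qed

end

section \<open>Moment and tail bounds for sparse families\<close>

lemma abs_add_power_le: "\<bar>x + y\<bar> ^ p \<le> 2 ^ p * (\<bar>x\<bar> ^ p + \<bar>y\<bar> ^ p)" for x y :: real
proof -
  have "\<bar>x + y\<bar> \<le> 2 * max \<bar>x\<bar> \<bar>y\<bar>" by auto
  then have "\<bar>x + y\<bar> ^ p \<le> (2 * max \<bar>x\<bar> \<bar>y\<bar>) ^ p" by (intro power_mono) auto
  also have "\<dots> = 2 ^ p * max \<bar>x\<bar> \<bar>y\<bar> ^ p" by (simp add: power_mult_distrib)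
  also have "max \<bar>x\<bar> \<bar>y\<bar> ^ p \<le> \<bar>x\<bar> ^ p + \<bar>y\<bar> ^ p" by (auto simp: max_def)
  finally show ?thesis by simp
qed

text \<open>Finiteness of all moments is stable under sums and products, so integrability of
  polynomial expansions is settled without tracking exponents.\<close>

definition all_moments :: "'a measure \<Rightarrow> ('a \<Rightarrow> real) \<Rightarrow> bool" where
  "all_moments M X \<longleftrightarrow> X \<in> borel_measurable M \<and> (\<forall>p::nat. integrable M (\<lambda>\<omega>. \<bar>X \<omega>\<bar> ^ p))"

lemma all_momentsD:
  assumes "all_moments M X"
  shows "X \<in> borel_measurable M" "integrable M (\<lambda>\<omega>. \<bar>X \<omega>\<bar> ^ p)" "integrable M (\<lambda>\<omega>. X \<omega> ^ p)"
proof -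
  show m: "X \<in> borel_measurable M" and i: "integrable M (\<lambda>\<omega>. \<bar>X \<omega>\<bar> ^ p)"
    using assms unfolding all_moments_def by auto
  show "integrable M (\<lambda>\<omega>. X \<omega> ^ p)"
    by (rule Bochner_Integration.integrable_bound[OF i]) (use m in \<open>auto simp: power_abs\<close>)
qed

lemma all_moments_integrable: "all_moments M X \<Longrightarrow> integrable M X"
  using all_momentsD(3)[of M X 1] by simp

lemma all_moments_add:
  assumes "all_moments M X" "all_moments M Y"
  shows "all_moments M (\<lambda>\<omega>. X \<omega> + Y \<omega>)"
  unfolding all_moments_def
proof (intro conjI allI)
  note [measurable] = all_momentsD(1)[OF assms(1)] all_momentsD(1)[OF assms(2)]
  show "(\<lambda>\<omega>. X \<omega> + Y \<omega>) \<in> borel_measurable M" by measurable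
  fix p :: nat
  have "integrable M (\<lambda>\<omega>. 2 ^ p * (\<bar>X \<omega>\<bar> ^ p + \<bar>Y \<omega>\<bar> ^ p))"
    by (intro integrable_mult_right Bochner_Integration.integrable_add all_momentsD assms)
  then show "integrable M (\<lambda>\<omega>. \<bar>X \<omega> + Y \<omega>\<bar> ^ p)"
    by (rule Bochner_Integration.integrable_bound) (use abs_add_power_le in auto)
qed

lemma all_moments_mult:
  assumes "all_moments M X" "all_moments M Y"
  shows "all_moments M (\<lambda>\<omega>. X \<omega> * Y \<omega>)"
  unfolding all_moments_def
proof (intro conjI allI)
  note [measurable] = all_momentsD(1)[OF assms(1)] all_momentsD(1)[OF assms(2)]
  show "(\<lambda>\<omega>. X \<omega> * Y \<omega>) \<in> borel_measurable M" by measurable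
  fix p :: nat
  have "integrable M (\<lambda>\<omega>. \<bar>X \<omega>\<bar> ^ (2 * p) + \<bar>Y \<omega>\<bar> ^ (2 * p))"
    by (intro Bochner_Integration.integrable_add all_momentsD assms)
  then show "integrable M (\<lambda>\<omega>. \<bar>X \<omega> * Y \<omega>\<bar> ^ p)"
  proof (rule Bochner_Integration.integrable_bound)
    have "a * b \<le> a\<^sup>2 + b\<^sup>2" for a b :: real
      using sum_squares_bound[of a b] zero_le_power2[of a] zero_le_power2[of b] by (sos | linarith)
    from this[of "\<bar>X _\<bar> ^ p" "\<bar>Y _\<bar> ^ p"]
    show "AE \<omega> in M. norm (\<bar>X \<omega> * Y \<omega>\<bar> ^ p) \<le> norm (\<bar>X \<omega>\<bar> ^ (2 * p) + \<bar>Y \<omega>\<bar> ^ (2 * p))"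
      by (auto simp: abs_mult power_mult_distrib power_mult mult.commute[of 2])
  qed measurable
qed

lemma (in prob_space) all_moments_const: "all_moments M (\<lambda>_. a)"
  unfolding all_moments_def by auto

lemma (in prob_space) all_moments_cmult: "all_moments M X \<Longrightarrow> all_moments M (\<lambda>\<omega>. a * X \<omega>)"
  by (rule all_moments_mult[OF all_moments_const])

lemma (in prob_space) all_moments_power: "all_moments M X \<Longrightarrow> all_moments M (\<lambda>\<omega>. X \<omega> ^ p)"
  by (induction p) (auto intro: all_moments_mult all_moments_const)

lemma (in prob_space) all_moments_sum:
  "(\<And>k. k \<in> I \<Longrightarrow> all_moments M (X k)) \<Longrightarrow> all_moments M (\<lambda>\<omega>. \<Sum>k\<in>I. X k \<omega>)"
  by (induction I rule: infinite_finite_induct) (auto intro: all_moments_add all_moments_const)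

text \<open>Separates one variable from a group of others. The group enters through a measurable
  function of the restricted family, so that powers of sums and of quadratic forms are covered
  alike.\<close>

lemma (in prob_space) indep_vars_integral_mult:
  assumes ind: "indep_vars (\<lambda>_. borel) Y I" and x: "x \<in> I" "J \<subseteq> I" "x \<notin> J"
    and g: "g \<in> borel_measurable (PiM J (\<lambda>_. borel))"
    and f: "f \<in> borel_measurable borel"
    and int: "integrable M (\<lambda>\<omega>. f (Y x \<omega>))" "integrable M (\<lambda>\<omega>. g (restrict (\<lambda>k. Y k \<omega>) J))"
  shows "expectation (\<lambda>\<omega>. (f (Y x \<omega>) :: real) * g (restrict (\<lambda>k. Y k \<omega>) J))
    = expectation (\<lambda>\<omega>. f (Y x \<omega>)) * expectation (\<lambda>\<omega>. g (restrict (\<lambda>k. Y k \<omega>) J))"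
proof -
  have "indep_var (PiM {x} (\<lambda>_. borel)) (\<lambda>\<omega>. restrict (\<lambda>k. Y k \<omega>) {x})
                  (PiM J (\<lambda>_. borel)) (\<lambda>\<omega>. restrict (\<lambda>k. Y k \<omega>) J)"
    using indep_var_restrict[OF ind, of "{x}" J] x by auto
  then have "indep_var borel ((\<lambda>y. f (y x)) \<circ> (\<lambda>\<omega>. restrict (\<lambda>k. Y k \<omega>) {x}))
                  borel (g \<circ> (\<lambda>\<omega>. restrict (\<lambda>k. Y k \<omega>) J))"
    by (rule indep_var_compose) (use f g in measurable)
  then have "indep_var borel (\<lambda>\<omega>. f (Y x \<omega>)) borel (\<lambda>\<omega>. g (restrict (\<lambda>k. Y k \<omega>) J))"
    by (simp add: comp_def)
  then show ?thesis by (rule indep_var_lebesgue_integral) (use int in auto)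
qed

text \<open>The recursion that the binomial expansion in \<open>rosenthal_aux\<close> produces. At
  \<open>p = 1\<close> the sum is empty, and the value 0 expresses the vanishing mean.\<close>

fun rosenthal_const :: "(nat \<Rightarrow> real) \<Rightarrow> nat \<Rightarrow> real" where
  "rosenthal_const c p = (if p = 0 then 1 else
     (\<Sum>j=2..p. real (p choose j) * c j * rosenthal_const c (p - j)))"

declare rosenthal_const.simps [simp del]

lemma rosenthal_const_nonneg: "(\<And>j. c j \<ge> 0) \<Longrightarrow> rosenthal_const c p \<ge> 0"
proof (induction p rule: less_induct)
  case (less p)
  then show ?case
    by (subst rosenthal_const.simps) (auto intro!: sum_nonneg mult_nonneg_nonneg)
qed

lemma atMost_split_01: "1 \<le> p \<Longrightarrow> {..p::nat} = {0, 1} \<union> {2..p}"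
  by auto

text \<open>Induction on \<open>p\<close> and \<open>J\<close>: expanding \<open>(Y x + S)^p\<close>, the term linear in \<open>Y x\<close> has mean zero and all
  further terms carry a factor \<open>v x\<close>.\<close>

lemma (in prob_space) rosenthal_aux:
  fixes Y :: "'i \<Rightarrow> 'a \<Rightarrow> real"
  assumes fin: "finite I" and ind: "indep_vars (\<lambda>_. borel) Y I"
    and mom: "\<And>k. k \<in> I \<Longrightarrow> all_moments M (Y k)"
    and mean: "\<And>k. k \<in> I \<Longrightarrow> expectation (Y k) = 0"
    and bound: "\<And>k j. k \<in> I \<Longrightarrow> 2 \<le> j \<Longrightarrow> \<bar>expectation (\<lambda>\<omega>. Y k \<omega> ^ j)\<bar> \<le> c j * v k * \<theta> ^ (j - 2)"
    and c: "\<And>j. c j \<ge> 0" and v: "\<And>k. k \<in> I \<Longrightarrow> v k \<ge> 0"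
    and \<theta>: "0 \<le> \<theta>" "\<theta> \<le> \<Psi>" and V: "(\<Sum>k\<in>I. v k) \<le> \<Psi>\<^sup>2"
    and J: "J \<subseteq> I"
  shows "\<bar>expectation (\<lambda>\<omega>. (\<Sum>k\<in>J. Y k \<omega>) ^ p)\<bar> \<le>
    (if p = 0 then 1 else rosenthal_const c p * \<Psi> ^ (p - 2) * (\<Sum>k\<in>J. v k))"
  using J
proof (induction p arbitrary: J rule: less_induct)
  case (less p)
  let ?K = "rosenthal_const c"
  have \<Psi>: "0 \<le> \<Psi>" using \<theta> by simp
  \<comment> \<open>For lower powers the sum of \<open>v\<close> is traded for
    \<open>\<Psi>\<^sup>2\<close>. The claim itself keeps the sum, because it is additive in
    \<open>J\<close>.\<close>
  have IH: "\<bar>expectation (\<lambda>\<omega>. (\<Sum>k\<in>J. Y k \<omega>) ^ r)\<bar> \<le> ?K r * \<Psi> ^ r" if r: "r < p" and J: "J \<subseteq> I" for r J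
  proof (cases "r < 2")
    case True
    then consider "r = 0" | "r = 1" by linarith
    then show ?thesis
    proof cases
      case 1
      then show ?thesis by (simp add: rosenthal_const.simps[of c 0] prob_space)
    next
      case 2
      then show ?thesis using less.IH[OF r J] by (simp add: rosenthal_const.simps[of c "Suc 0"])
    qed
  next
    case False
    have "\<bar>expectation (\<lambda>\<omega>. (\<Sum>k\<in>J. Y k \<omega>) ^ r)\<bar> \<le> ?K r * \<Psi> ^ (r - 2) * (\<Sum>k\<in>J. v k)"
      using less.IH[OF r J] False by simp
    also have "(\<Sum>k\<in>J. v k) \<le> \<Psi>\<^sup>2"
      using V J by (intro order_trans[OF sum_mono2 V]) (auto simp: fin v)
    also have "?K r * \<Psi> ^ (r - 2) * \<Psi>\<^sup>2 = ?K r * \<Psi> ^ r"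
      using False by (metis le_add_diff_inverse2 mult.assoc not_less power_add)
    finally show ?thesis using rosenthal_const_nonneg[of c r] c \<Psi> by (simp add: mult_left_mono)
  qed
  show ?case
  proof (cases "p = 0")
    case True
    then show ?thesis by (simp add: prob_space)
  next
    case p: False
    have "finite J" using less.prems fin by (rule finite_subset)
    then show ?thesis using less.prems
    proof (induction J rule: finite_induct)
      case empty
      then show ?case using p by (simp add: power_0_left)
    next
      case (insert x J)
      let ?S = "\<lambda>\<omega>. \<Sum>k\<in>J. Y k \<omega>"
      have x: "x \<in> I" and J: "J \<subseteq> I" using insert.prems by auto
      have mS: "all_moments M ?S" using J mom by (intro all_moments_sum) auto
      have mx: "all_moments M (Y x)" using mom x by auto
      have prod: "expectation (\<lambda>\<omega>. Y x \<omega> ^ j * ?S \<omega> ^ r)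
          = expectation (\<lambda>\<omega>. Y x \<omega> ^ j) * expectation (\<lambda>\<omega>. ?S \<omega> ^ r)" for j r
        using indep_vars_integral_mult[OF ind x J \<open>x \<notin> J\<close>, where f = "\<lambda>y. y ^ j" and g = "\<lambda>y. (\<Sum>k\<in>J. y k) ^ r"]
          all_momentsD(3)[OF mS] all_momentsD(3)[OF mx] by simp
      let ?T = "\<lambda>j. real (p choose j) * (expectation (\<lambda>\<omega>. Y x \<omega> ^ j) * expectation (\<lambda>\<omega>. ?S \<omega> ^ (p - j)))"
      have "expectation (\<lambda>\<omega>. (\<Sum>k\<in>insert x J. Y k \<omega>) ^ p)
          = expectation (\<lambda>\<omega>. \<Sum>j\<le>p. real (p choose j) * (Y x \<omega> ^ j * ?S \<omega> ^ (p - j)))"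
        using insert.hyps by (simp add: binomial_ring mult.assoc)
      also have "\<dots> = (\<Sum>j\<le>p. ?T j)"
        by (subst Bochner_Integration.integral_sum)
          (auto simp: prod intro!: integrable_mult_right all_moments_integrable all_moments_mult all_moments_power mS mx)
      \<comment> \<open>The term \<open>j = 1\<close> vanishes because \<open>Y x\<close> has mean
        zero and has been factored off by independence.\<close>
      also have "\<dots> = ?T 0 + (\<Sum>j=2..p. ?T j)"
        using p mean[OF x] by (subst atMost_split_01) (simp_all add: sum.union_disjoint)
      finally have "\<bar>expectation (\<lambda>\<omega>. (\<Sum>k\<in>insert x J. Y k \<omega>) ^ p)\<bar> \<le> \<bar>?T 0\<bar> + (\<Sum>j=2..p. \<bar>?T j\<bar>)"
        using sum_abs[of ?T "{2..p}"] by linarith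
      also have "\<bar>?T 0\<bar> \<le> ?K p * \<Psi> ^ (p - 2) * (\<Sum>k\<in>J. v k)"
        using insert.IH[OF J] p by (simp add: prob_space)
      also have "(\<Sum>j=2..p. \<bar>?T j\<bar>) \<le> (\<Sum>j=2..p. real (p choose j) * c j * ?K (p - j) * (\<Psi> ^ (p - 2) * v x))"
      proof (intro sum_mono)
        fix j assume j: "j \<in> {2..p}"
        have "\<bar>?T j\<bar> = real (p choose j) * (\<bar>expectation (\<lambda>\<omega>. Y x \<omega> ^ j)\<bar> * \<bar>expectation (\<lambda>\<omega>. ?S \<omega> ^ (p - j))\<bar>)"
          by (simp add: abs_mult)
        also have "\<dots> \<le> real (p choose j) * ((c j * v x * \<theta> ^ (j - 2)) * (?K (p - j) * \<Psi> ^ (p - j)))"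
          using j x J by (intro mult_left_mono mult_mono bound IH) (auto intro!: mult_nonneg_nonneg c v \<theta> zero_le_power)
        also have "\<dots> \<le> real (p choose j) * ((c j * v x * \<Psi> ^ (j - 2)) * (?K (p - j) * \<Psi> ^ (p - j)))"
          using \<theta> \<Psi> v[OF x] c
          by (intro mult_left_mono mult_right_mono power_mono mult_nonneg_nonneg rosenthal_const_nonneg) auto
        also have "\<dots> = real (p choose j) * c j * ?K (p - j) * ((\<Psi> ^ (j - 2) * \<Psi> ^ (p - j)) * v x)"
          by (simp add: mult_ac)
        also have "\<Psi> ^ (j - 2) * \<Psi> ^ (p - j) = \<Psi> ^ (p - 2)"
          using j by (simp flip: power_add)
        finally show "\<bar>?T j\<bar> \<le> real (p choose j) * c j * ?K (p - j) * (\<Psi> ^ (p - 2) * v x)" .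
      qed
      also have "\<dots> = ?K p * (\<Psi> ^ (p - 2) * v x)"
        using p by (subst rosenthal_const.simps[of c p]) (simp add: sum_distrib_right)
      finally show ?case using insert.hyps p by (simp add: algebra_simps)
    qed
  qed
qed

lemma (in prob_space) rosenthal:
  fixes Y :: "'i \<Rightarrow> 'a \<Rightarrow> real"
  assumes fin: "finite I" and ind: "indep_vars (\<lambda>_. borel) Y I"
    and mom: "\<And>k. k \<in> I \<Longrightarrow> all_moments M (Y k)"
    and mean: "\<And>k. k \<in> I \<Longrightarrow> expectation (Y k) = 0"
    and bound: "\<And>k j. k \<in> I \<Longrightarrow> 2 \<le> j \<Longrightarrow> \<bar>expectation (\<lambda>\<omega>. Y k \<omega> ^ j)\<bar> \<le> c j * v k * \<theta> ^ (j - 2)"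
    and c: "\<And>j. c j \<ge> 0" and v: "\<And>k. k \<in> I \<Longrightarrow> v k \<ge> 0"
    and \<theta>: "0 \<le> \<theta>" "\<theta> \<le> \<Psi>" and V: "(\<Sum>k\<in>I. v k) \<le> \<Psi>\<^sup>2"
    and p: "2 \<le> p"
  shows "\<bar>expectation (\<lambda>\<omega>. (\<Sum>k\<in>I. Y k \<omega>) ^ p)\<bar> \<le> rosenthal_const c p * \<Psi> ^ p"
proof -
  have "\<bar>expectation (\<lambda>\<omega>. (\<Sum>k\<in>I. Y k \<omega>) ^ p)\<bar> \<le> rosenthal_const c p * \<Psi> ^ (p - 2) * (\<Sum>k\<in>I. v k)"
    using rosenthal_aux[where c = c and v = v and p = p, OF fin ind mom mean bound c v \<theta> V subset_refl] p by simp
  also have "\<dots> \<le> rosenthal_const c p * \<Psi> ^ (p - 2) * \<Psi>\<^sup>2"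
    by (intro mult_left_mono V mult_nonneg_nonneg rosenthal_const_nonneg c) (use \<theta> in auto)
  also have "\<dots> = rosenthal_const c p * \<Psi> ^ p"
    using p by (metis le_add_diff_inverse2 mult.assoc power_add)
  finally show ?thesis .
qed


lemma young_power: "0 \<le> x \<Longrightarrow> 0 \<le> y \<Longrightarrow> j \<le> p \<Longrightarrow> x ^ (p - j) * y ^ j \<le> x ^ p + y ^ p" for x y :: real
proof (cases "x \<le> y")
  case True
  assume *: "0 \<le> x" "0 \<le> y" "j \<le> p"
  then have "x ^ (p - j) * y ^ j \<le> y ^ (p - j) * y ^ j"
    using True by (intro mult_right_mono power_mono) auto
  also have "\<dots> = y ^ p" using * by (simp flip: power_add)
  finally show ?thesis using * by (simp add: add_increasing)
next
  case False
  assume *: "0 \<le> x" "0 \<le> y" "j \<le> p"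
  then have "x ^ (p - j) * y ^ j \<le> x ^ (p - j) * x ^ j"
    using False by (intro mult_left_mono power_mono) auto
  also have "\<dots> = x ^ p" using * by (simp flip: power_add)
  finally show ?thesis using * by (simp add: add_increasing2)
qed

section \<open>Linear and quadratic forms in a sparse family\<close>

locale sparse_family = prob_space M for M :: "'a measure" +
  fixes I :: "'i set" and X :: "'i \<Rightarrow> 'a \<Rightarrow> real" and N :: nat and q :: real and c :: "nat \<Rightarrow> real"
  assumes fin: "finite I" and card: "card I \<le> N" and N_pos: "1 \<le> N"
    and q: "1 \<le> q" "q\<^sup>2 \<le> real N"
    and c: "\<And>j. c j \<ge> 0"
    and ind: "indep_vars (\<lambda>_. borel) X I"
    and mom: "\<And>k. k \<in> I \<Longrightarrow> all_moments M (X k)"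
    and mean: "\<And>k. k \<in> I \<Longrightarrow> expectation (X k) = 0"
    and bound: "\<And>k j. k \<in> I \<Longrightarrow> 2 \<le> j \<Longrightarrow>
      expectation (\<lambda>\<omega>. \<bar>X k \<omega>\<bar> ^ j) \<le> c j / (real N * q ^ (j - 2))"
begin

lemma abs_moment: "k \<in> I \<Longrightarrow> 2 \<le> j \<Longrightarrow> \<bar>expectation (\<lambda>\<omega>. X k \<omega> ^ j)\<bar> \<le> c j / (real N * q ^ (j - 2))"
  using integral_abs_bound[of M "\<lambda>\<omega>. X k \<omega> ^ j"] bound[of k j] by (simp add: power_abs)

text \<open>Two powers of the coefficient make up the variance proxy \<open>v k\<close>; each
  further power is bounded by \<open>A\<close> and comes with a factor \<open>1 / q\<close> from the
  moment bound, hence \<open>\<theta> = A / q\<close>.\<close>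

lemma linear_moment:
  assumes J: "J \<subseteq> I" and A: "0 \<le> A" "\<And>k. k \<in> J \<Longrightarrow> \<bar>a k\<bar> \<le> A"
    and \<Psi>: "A / q \<le> \<Psi>" "(\<Sum>k\<in>J. (a k)\<^sup>2) / real N \<le> \<Psi>\<^sup>2" and p: "2 \<le> p"
  shows "\<bar>expectation (\<lambda>\<omega>. (\<Sum>k\<in>J. a k * X k \<omega>) ^ p)\<bar> \<le> rosenthal_const c p * \<Psi> ^ p"
proof (rule rosenthal[where v = "\<lambda>k. (a k)\<^sup>2 / real N" and \<theta> = "A / q"])
  show "finite J" using fin J by (rule rev_finite_subset)
  show "indep_vars (\<lambda>_. borel) (\<lambda>k \<omega>. a k * X k \<omega>) J"
    by (rule indep_vars_compose2[OF indep_vars_subset[OF ind J]]) measurable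
  show "all_moments M (\<lambda>\<omega>. a k * X k \<omega>)" if "k \<in> J" for k
    using that J by (intro all_moments_cmult mom) auto
  show "expectation (\<lambda>\<omega>. a k * X k \<omega>) = 0" if "k \<in> J" for k
    using mean that J by auto
  show "\<bar>expectation (\<lambda>\<omega>. (a k * X k \<omega>) ^ j)\<bar> \<le> c j * ((a k)\<^sup>2 / real N) * (A / q) ^ (j - 2)"
    if k: "k \<in> J" and j: "2 \<le> j" for k j
  proof -
    have "\<bar>expectation (\<lambda>\<omega>. (a k * X k \<omega>) ^ j)\<bar> = \<bar>a k\<bar> ^ j * \<bar>expectation (\<lambda>\<omega>. X k \<omega> ^ j)\<bar>"
      by (simp add: power_mult_distrib abs_mult power_abs)
    also have "\<dots> \<le> \<bar>a k\<bar> ^ j * (c j / (real N * q ^ (j - 2)))"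
      using k j J by (intro mult_left_mono abs_moment) auto
    also have "\<bar>a k\<bar> ^ j = (a k)\<^sup>2 * \<bar>a k\<bar> ^ (j - 2)"
      using j by (metis le_add_diff_inverse power2_abs power_add)
    also have "(a k)\<^sup>2 * \<bar>a k\<bar> ^ (j - 2) * (c j / (real N * q ^ (j - 2)))
        \<le> (a k)\<^sup>2 * A ^ (j - 2) * (c j / (real N * q ^ (j - 2)))"
      using A(2)[OF k] c q by (intro mult_left_mono mult_right_mono power_mono) auto
    finally show ?thesis by (simp add: power_divide mult_ac)
  qed
qed (use c A \<Psi> p q in \<open>auto simp: sum_divide_distrib\<close>)

text \<open>Of the factor \<open>4 ^ j\<close>, one \<open>2 ^ j\<close> stems from the increment
  \<open>2 * X x * b\<close>, the other from the bound
  \<open>\<beta> x \<le> 2 * (q * \<Psi>)\<close> in \<open>quad_moment\<close>.\<close>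

definition quad_gronwall :: "nat \<Rightarrow> real" where
  "quad_gronwall p = (\<Sum>j=2..p. real (p choose j) * 4 ^ j * c j)"

lemma quad_gronwall_nonneg: "quad_gronwall p \<ge> 0"
  unfolding quad_gronwall_def by (intro sum_nonneg) (auto simp: c)

text \<open>Adding an index \<open>x\<close> to \<open>J\<close> adds \<open>2 X x b\<close> to the quadratic form, where \<open>b\<close> is linear in the other
  variables.  Young's inequality turns the binomial expansion into a recursion for the \<open>p\<close>-th moment
  to which a discrete Gronwall argument applies.\<close>

lemma quad_moment:
  assumes sym: "\<And>k l. k \<in> I \<Longrightarrow> l \<in> I \<Longrightarrow> a k l = a l k"
    and A: "0 < A" "\<And>k l. k \<in> I \<Longrightarrow> l \<in> I \<Longrightarrow> \<bar>a k l\<bar> \<le> A"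
    and \<Psi>: "A / q \<le> \<Psi>" "(\<Sum>k\<in>I. \<Sum>l\<in>I. (a k l)\<^sup>2) / (real N)\<^sup>2 \<le> \<Psi>\<^sup>2"
    and p: "2 \<le> p" "even p"
  shows "expectation (\<lambda>\<omega>. (\<Sum>k\<in>I. \<Sum>l\<in>I-{k}. a k l * X k \<omega> * X l \<omega>) ^ p)
    \<le> rosenthal_const c p * exp (4 * quad_gronwall p) * \<Psi> ^ p"
proof -
  have Npos: "0 < real N" and qpos: "0 < q" using N_pos q by auto
  have \<Psi>pos: "0 < \<Psi>" using \<Psi>(1) A(1) qpos by (meson divide_pos_pos less_le_trans)
  \<comment> \<open>A scale admissible in \<open>linear_moment\<close> for the linear form
    \<open>b\<close> that index \<open>x\<close> brings in.\<close>
  define \<beta> where "\<beta> x = A / q + sqrt ((\<Sum>k\<in>I. (a k x)\<^sup>2) / real N)" for x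
  have \<beta>pos: "0 < \<beta> x" for x
    unfolding \<beta>_def using A(1) qpos by (intro add_pos_nonneg) (auto intro!: sum_nonneg divide_nonneg_nonneg)
  have \<beta>le: "\<beta> x \<le> 2 * (q * \<Psi>)" if x: "x \<in> I" for x
  proof -
    have "(\<Sum>k\<in>I. (a k x)\<^sup>2) \<le> (\<Sum>k\<in>I. A\<^sup>2)"
      using A(2)[OF _ x] by (intro sum_mono) (metis abs_ge_zero power2_abs power_mono)
    also have "\<dots> \<le> real N * A\<^sup>2" using card by (simp add: mult_right_mono)
    finally have "(\<Sum>k\<in>I. (a k x)\<^sup>2) / real N \<le> A\<^sup>2" using Npos by (simp add: field_simps)
    then have "sqrt ((\<Sum>k\<in>I. (a k x)\<^sup>2) / real N) \<le> A" using A(1) by (intro real_le_lsqrt) auto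
    moreover have "A / q \<le> A" using A(1) q by (simp add: field_simps)
    moreover have "A \<le> q * \<Psi>" using \<Psi>(1) qpos by (simp add: field_simps)
    ultimately show ?thesis unfolding \<beta>_def by linarith
  qed
  define w where "w x = quad_gronwall p * ((\<beta> x / \<Psi>)\<^sup>2 / real N)" for x
  define K where "K = rosenthal_const c p"
  have K0: "K \<ge> 0" unfolding K_def by (rule rosenthal_const_nonneg) (rule c)
  let ?S = "\<lambda>J \<omega>. \<Sum>k\<in>J. \<Sum>l\<in>J-{k}. a k l * X k \<omega> * X l \<omega>"
  have mS: "all_moments M (?S J)" if "J \<subseteq> I" for J
    using that mom by (intro all_moments_sum all_moments_mult all_moments_const) auto
  \<comment> \<open>Adding \<open>K * \<Psi> ^ p\<close> makes the recursion purely multiplicative: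
    both terms from Young's inequality merge into one quantity, which grows by at most
    \<open>1 + w x\<close> per index.\<close>
  have claim: "expectation (\<lambda>\<omega>. ?S J \<omega> ^ p) + K * \<Psi> ^ p \<le> K * \<Psi> ^ p * (\<Prod>x\<in>J. 1 + w x)"
    if "J \<subseteq> I" for J
  proof -
    have "finite J" using that fin by (rule finite_subset)
    then show ?thesis using that
    proof (induction J rule: finite_induct)
      case empty
      then show ?case using p by (simp add: power_0_left)
    next
      case (insert x J)
      have x: "x \<in> I" and J: "J \<subseteq> I" using insert.prems by auto
      define b where "b \<omega> = (\<Sum>k\<in>J. a k x * X k \<omega>)" for \<omega>
      have mb: "all_moments M b"
        unfolding b_def using J mom by (intro all_moments_sum all_moments_cmult) auto
      have mx: "all_moments M (X x)" using mom x by auto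
      have Eb: "expectation (\<lambda>\<omega>. b \<omega> ^ p) \<le> K * \<beta> x ^ p"
      proof -
        have "\<bar>expectation (\<lambda>\<omega>. b \<omega> ^ p)\<bar> \<le> rosenthal_const c p * \<beta> x ^ p"
          unfolding b_def
        proof (rule linear_moment[OF J])
          show "A / q \<le> \<beta> x" unfolding \<beta>_def by (auto intro!: sum_nonneg divide_nonneg_nonneg)
          have "(\<Sum>k\<in>J. (a k x)\<^sup>2) / real N \<le> (\<Sum>k\<in>I. (a k x)\<^sup>2) / real N"
            using J fin by (intro divide_right_mono sum_mono2) auto
          also have "\<dots> = (sqrt ((\<Sum>k\<in>I. (a k x)\<^sup>2) / real N))\<^sup>2"
            by (subst real_sqrt_pow2) (auto intro!: sum_nonneg divide_nonneg_nonneg)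
          also have "\<dots> \<le> (\<beta> x)\<^sup>2"
            unfolding \<beta>_def using A(1) qpos
            by (intro power_mono) (auto intro!: sum_nonneg divide_nonneg_nonneg)
          finally show "(\<Sum>k\<in>J. (a k x)\<^sup>2) / real N \<le> (\<beta> x)\<^sup>2" .
        qed (use A x J p in auto)
        then show ?thesis unfolding K_def by linarith
      qed
      have split: "?S (insert x J) \<omega> = 2 * b \<omega> * X x \<omega> + ?S J \<omega>" for \<omega>
      proof -
        have "?S (insert x J) \<omega> = (\<Sum>l\<in>J. a x l * X x \<omega> * X l \<omega>)
            + (\<Sum>k\<in>J. a k x * X k \<omega> * X x \<omega> + (\<Sum>l\<in>J-{k}. a k l * X k \<omega> * X l \<omega>))"
        proof -
          have "insert x J - {x} = J" using insert.hyps by auto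
          moreover have "(\<Sum>l\<in>insert x J-{k}. a k l * X k \<omega> * X l \<omega>)
              = a k x * X k \<omega> * X x \<omega> + (\<Sum>l\<in>J-{k}. a k l * X k \<omega> * X l \<omega>)" if "k \<in> J" for k
          proof -
            have "insert x J - {k} = insert x (J - {k})" using that insert.hyps by auto
            then show ?thesis using insert.hyps by simp
          qed
          ultimately show ?thesis using insert.hyps by simp
        qed
        also have "(\<Sum>l\<in>J. a x l * X x \<omega> * X l \<omega>) = b \<omega> * X x \<omega>"
          unfolding b_def sum_distrib_right
        proof (intro sum.cong refl)
          fix l assume "l \<in> J"
          then have "a x l = a l x" using sym x J by auto
          then show "a x l * X x \<omega> * X l \<omega> = a l x * X l \<omega> * X x \<omega>" by simp
        qed
        finally show ?thesis by (simp add: sum.distrib b_def sum_distrib_right[symmetric])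
      qed
      have prod: "expectation (\<lambda>\<omega>. X x \<omega> ^ j * (b \<omega> ^ j * ?S J \<omega> ^ r))
          = expectation (\<lambda>\<omega>. X x \<omega> ^ j) * expectation (\<lambda>\<omega>. b \<omega> ^ j * ?S J \<omega> ^ r)" for j r
      proof -
        let ?g = "\<lambda>y. (\<Sum>k\<in>J. a k x * y k) ^ j * (\<Sum>k\<in>J. \<Sum>l\<in>J-{k}. a k l * y k * y l) ^ r"
        have g: "?g (restrict (\<lambda>k. X k \<omega>) J) = b \<omega> ^ j * ?S J \<omega> ^ r" for \<omega>
          unfolding b_def by simp
        have gm: "?g \<in> borel_measurable (PiM J (\<lambda>_. borel))" by measurable
        have "integrable M (\<lambda>\<omega>. b \<omega> ^ j * ?S J \<omega> ^ r)"
          by (intro all_moments_integrable all_moments_mult all_moments_power mb mS J)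
        then show ?thesis
          using indep_vars_integral_mult[OF ind x J \<open>x \<notin> J\<close> gm, where f = "\<lambda>y. y ^ j"] all_momentsD(3)[OF mx]
          unfolding g by simp
      qed
      define U where "U = expectation (\<lambda>\<omega>. ?S J \<omega> ^ p)"
      have U0: "U \<ge> 0" unfolding U_def using p by (intro integral_nonneg_AE) auto
      let ?T = "\<lambda>j. real (p choose j) * 2 ^ j * (expectation (\<lambda>\<omega>. X x \<omega> ^ j) * expectation (\<lambda>\<omega>. b \<omega> ^ j * ?S J \<omega> ^ (p - j)))"
      have "expectation (\<lambda>\<omega>. ?S (insert x J) \<omega> ^ p)
          = expectation (\<lambda>\<omega>. \<Sum>j\<le>p. real (p choose j) * 2 ^ j * (X x \<omega> ^ j * (b \<omega> ^ j * ?S J \<omega> ^ (p - j))))"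
        unfolding split by (subst binomial_ring) (simp add: power_mult_distrib mult_ac)
      also have "\<dots> = (\<Sum>j\<le>p. ?T j)"
        by (subst Bochner_Integration.integral_sum)
          (auto simp: prod intro!: integrable_mult_right all_moments_integrable all_moments_mult all_moments_power mS mx mb J)
      also have "\<dots> = ?T 0 + (\<Sum>j=2..p. ?T j)"
        using p mean[OF x] by (subst atMost_split_01) (simp_all add: sum.union_disjoint)
      finally have expand: "expectation (\<lambda>\<omega>. ?S (insert x J) \<omega> ^ p) = ?T 0 + (\<Sum>j=2..p. ?T j)" .
      have T0: "?T 0 = U" by (simp add: prob_space U_def)
      have "(\<Sum>j=2..p. ?T j) \<le> (\<Sum>j=2..p. real (p choose j) * 4 ^ j * c j * ((\<beta> x / \<Psi>)\<^sup>2 / real N * (U + K * \<Psi> ^ p)))"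
      proof (intro sum_mono)
        fix j assume j: "j \<in> {2..p}"
        have "\<bar>expectation (\<lambda>\<omega>. b \<omega> ^ j * ?S J \<omega> ^ (p - j))\<bar>
            \<le> expectation (\<lambda>\<omega>. \<bar>b \<omega> ^ j * ?S J \<omega> ^ (p - j)\<bar>)" by (rule integral_abs_bound)
        \<comment> \<open>Young's inequality with \<open>b\<close> measured in units of
          \<open>\<beta> x\<close> and the quadratic form in units of \<open>\<Psi>\<close>; this
          splits off the power \<open>(\<beta> x / \<Psi>) ^ j\<close>.\<close>
        also have "\<dots> \<le> expectation (\<lambda>\<omega>. \<Psi> ^ (p - j) * \<beta> x ^ j * (?S J \<omega> ^ p / \<Psi> ^ p + b \<omega> ^ p / \<beta> x ^ p))"
        proof (rule integral_mono)
          show "integrable M (\<lambda>\<omega>. \<bar>b \<omega> ^ j * ?S J \<omega> ^ (p - j)\<bar>)"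
            by (intro integrable_abs all_moments_integrable all_moments_mult all_moments_power mb mS J)
          show "integrable M (\<lambda>\<omega>. \<Psi> ^ (p - j) * \<beta> x ^ j * (?S J \<omega> ^ p / \<Psi> ^ p + b \<omega> ^ p / \<beta> x ^ p))"
            by (intro integrable_mult_right Bochner_Integration.integrable_add integrable_divide
                all_momentsD(3) mb mS J)
          fix \<omega>
          have "\<bar>?S J \<omega>\<bar> ^ (p - j) * \<bar>b \<omega>\<bar> ^ j
              = \<Psi> ^ (p - j) * \<beta> x ^ j * ((\<bar>?S J \<omega>\<bar> / \<Psi>) ^ (p - j) * (\<bar>b \<omega>\<bar> / \<beta> x) ^ j)"
            using \<Psi>pos \<beta>pos[of x] by (simp add: power_divide)
          also have "\<dots> \<le> \<Psi> ^ (p - j) * \<beta> x ^ j * ((\<bar>?S J \<omega>\<bar> / \<Psi>) ^ p + (\<bar>b \<omega>\<bar> / \<beta> x) ^ p)"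
            using \<Psi>pos \<beta>pos[of x] j by (intro mult_left_mono young_power) auto
          also have "\<dots> = \<Psi> ^ (p - j) * \<beta> x ^ j * (?S J \<omega> ^ p / \<Psi> ^ p + b \<omega> ^ p / \<beta> x ^ p)"
            using p by (simp add: power_divide power_even_abs)
          finally show "\<bar>b \<omega> ^ j * ?S J \<omega> ^ (p - j)\<bar>
              \<le> \<Psi> ^ (p - j) * \<beta> x ^ j * (?S J \<omega> ^ p / \<Psi> ^ p + b \<omega> ^ p / \<beta> x ^ p)"
            by (simp add: abs_mult power_abs mult.commute)
        qed
        also have "\<dots> = \<Psi> ^ (p - j) * \<beta> x ^ j * (U / \<Psi> ^ p + expectation (\<lambda>\<omega>. b \<omega> ^ p) / \<beta> x ^ p)"
          unfolding U_def using all_momentsD(3)[OF mb, of p] all_momentsD(3)[OF mS[OF J], of p] by simp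
        also have "\<dots> \<le> \<Psi> ^ (p - j) * \<beta> x ^ j * (U / \<Psi> ^ p + K)"
          using Eb \<Psi>pos \<beta>pos[of x] by (intro mult_left_mono add_left_mono) (auto simp: field_simps)
        also have "\<dots> = \<Psi> ^ (p - j) * \<beta> x ^ j / \<Psi> ^ p * (U + K * \<Psi> ^ p)"
          using \<Psi>pos by (simp add: field_simps)
        also have "\<Psi> ^ (p - j) * \<beta> x ^ j / \<Psi> ^ p = (\<beta> x / \<Psi>) ^ j"
          using j \<Psi>pos by (simp add: power_diff power_divide)
        finally have E1: "\<bar>expectation (\<lambda>\<omega>. b \<omega> ^ j * ?S J \<omega> ^ (p - j))\<bar> \<le> (\<beta> x / \<Psi>) ^ j * (U + K * \<Psi> ^ p)" .
        have "?T j \<le> real (p choose j) * 2 ^ j * (\<bar>expectation (\<lambda>\<omega>. X x \<omega> ^ j)\<bar> * \<bar>expectation (\<lambda>\<omega>. b \<omega> ^ j * ?S J \<omega> ^ (p - j))\<bar>)"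
          by (intro mult_left_mono) (auto simp flip: abs_mult)
        also have "\<dots> \<le> real (p choose j) * 2 ^ j * (c j / (real N * q ^ (j - 2)) * ((\<beta> x / \<Psi>) ^ j * (U + K * \<Psi> ^ p)))"
          using j x by (intro mult_left_mono mult_mono abs_moment E1) (use c qpos in auto)
        also have "(\<beta> x / \<Psi>) ^ j = (\<beta> x / \<Psi>)\<^sup>2 * (\<beta> x / \<Psi>) ^ (j - 2)"
          using j by (metis atLeastAtMost_iff le_add_diff_inverse power_add)
        also have "real (p choose j) * 2 ^ j * (c j / (real N * q ^ (j - 2)) * ((\<beta> x / \<Psi>)\<^sup>2 * (\<beta> x / \<Psi>) ^ (j - 2) * (U + K * \<Psi> ^ p)))
          = real (p choose j) * c j * ((\<beta> x / \<Psi>)\<^sup>2 / real N * (U + K * \<Psi> ^ p)) * (2 ^ j * (\<beta> x / (q * \<Psi>)) ^ (j - 2))"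
          by (simp add: power_divide power_mult_distrib mult_ac)
        also have "\<dots> \<le> real (p choose j) * c j * ((\<beta> x / \<Psi>)\<^sup>2 / real N * (U + K * \<Psi> ^ p)) * (4 ^ j)"
        proof (rule mult_left_mono)
          have "(\<beta> x / (q * \<Psi>)) ^ (j - 2) \<le> 2 ^ (j - 2)"
            using \<beta>le[OF x] \<beta>pos[of x] \<Psi>pos qpos by (intro power_mono) (auto simp: field_simps)
          also have "\<dots> \<le> 2 ^ j" by (intro power_increasing) auto
          finally have "2 ^ j * (\<beta> x / (q * \<Psi>)) ^ (j - 2) \<le> 2 ^ j * 2 ^ j" by (intro mult_left_mono) auto
          then show "2 ^ j * (\<beta> x / (q * \<Psi>)) ^ (j - 2) \<le> 4 ^ j" by (simp flip: power_mult_distrib)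
          show "0 \<le> real (p choose j) * c j * ((\<beta> x / \<Psi>)\<^sup>2 / real N * (U + K * \<Psi> ^ p))"
            using U0 K0 \<Psi>pos by (intro mult_nonneg_nonneg c add_nonneg_nonneg) auto
        qed
        finally show "?T j \<le> real (p choose j) * 4 ^ j * c j * ((\<beta> x / \<Psi>)\<^sup>2 / real N * (U + K * \<Psi> ^ p))"
          by (simp add: mult_ac)
      qed
      also have "\<dots> = w x * (U + K * \<Psi> ^ p)"
        unfolding w_def quad_gronwall_def sum_distrib_right[symmetric] by (rule mult.assoc[symmetric])
      finally have Tj: "(\<Sum>j=2..p. ?T j) \<le> w x * (U + K * \<Psi> ^ p)" .
      have "expectation (\<lambda>\<omega>. ?S (insert x J) \<omega> ^ p) + K * \<Psi> ^ p \<le> (1 + w x) * (U + K * \<Psi> ^ p)"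
        using Tj unfolding expand T0 by (simp add: distrib_right)
      also have "\<dots> \<le> (1 + w x) * (K * \<Psi> ^ p * (\<Prod>x\<in>J. 1 + w x))"
      proof (rule mult_left_mono)
        show "U + K * \<Psi> ^ p \<le> K * \<Psi> ^ p * (\<Prod>x\<in>J. 1 + w x)"
          using insert.IH[OF J] unfolding U_def .
        show "0 \<le> 1 + w x"
          unfolding w_def by (intro add_nonneg_nonneg mult_nonneg_nonneg divide_nonneg_nonneg quad_gronwall_nonneg) auto
      qed
      finally show ?case using insert.hyps by (simp add: mult_ac)
    qed
  qed
  have w0: "w x \<ge> 0" for x unfolding w_def by (intro mult_nonneg_nonneg quad_gronwall_nonneg) auto
  have "(\<Prod>x\<in>I. 1 + w x) \<le> (\<Prod>x\<in>I. exp (w x))"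
    by (intro prod_mono) (use w0 in \<open>auto intro: add_nonneg_nonneg\<close>)
  also have "\<dots> = exp (\<Sum>x\<in>I. w x)" using fin by (simp add: exp_sum)
  also have "(\<Sum>x\<in>I. w x) \<le> 4 * quad_gronwall p"
  proof -
    \<comment> \<open>The squares of \<open>\<beta>\<close> sum to at most
      \<open>4 * N * \<Psi>\<^sup>2\<close>, so the total growth is bounded uniformly in
      \<open>N\<close>.\<close>
    have "(\<Sum>x\<in>I. (\<beta> x)\<^sup>2) \<le> (\<Sum>x\<in>I. 2 * (A / q)\<^sup>2 + 2 * ((\<Sum>k\<in>I. (a k x)\<^sup>2) / real N))"
    proof (intro sum_mono)
      fix x
      have "(u + v)\<^sup>2 \<le> 2 * u\<^sup>2 + 2 * v\<^sup>2" for u v :: real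
        using sum_squares_bound[of u v] by (simp add: power2_sum)
      from this[of "A / q" "sqrt ((\<Sum>k\<in>I. (a k x)\<^sup>2) / real N)"]
      show "(\<beta> x)\<^sup>2 \<le> 2 * (A / q)\<^sup>2 + 2 * ((\<Sum>k\<in>I. (a k x)\<^sup>2) / real N)"
        unfolding \<beta>_def by (simp add: sum_nonneg)
    qed
    also have "\<dots> = 2 * real (card I) * (A / q)\<^sup>2 + 2 * ((\<Sum>x\<in>I. \<Sum>k\<in>I. (a k x)\<^sup>2) / real N)"
      by (simp add: sum.distrib sum_distrib_left sum_divide_distrib)
    also have "(\<Sum>x\<in>I. \<Sum>k\<in>I. (a k x)\<^sup>2) = (\<Sum>k\<in>I. \<Sum>l\<in>I. (a k l)\<^sup>2)" by (rule sum.swap)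
    also have "\<dots> / real N = real N * (\<dots> / (real N)\<^sup>2)"
      using Npos by (simp add: power2_eq_square)
    also have "2 * real (card I) * (A / q)\<^sup>2 + 2 * (real N * ((\<Sum>k\<in>I. \<Sum>l\<in>I. (a k l)\<^sup>2) / (real N)\<^sup>2))
        \<le> 2 * real N * \<Psi>\<^sup>2 + 2 * (real N * \<Psi>\<^sup>2)"
      using card A(1) qpos by (intro add_mono mult_mono mult_left_mono \<Psi> power_mono) auto
    finally have "(\<Sum>x\<in>I. (\<beta> x)\<^sup>2) / (\<Psi>\<^sup>2 * real N) \<le> 4" using Npos \<Psi>pos by (simp add: field_simps)
    then have "quad_gronwall p * ((\<Sum>x\<in>I. (\<beta> x)\<^sup>2) / (\<Psi>\<^sup>2 * real N)) \<le> quad_gronwall p * 4"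
      by (rule mult_left_mono) (rule quad_gronwall_nonneg)
    then show ?thesis
      unfolding w_def by (simp add: sum_distrib_left sum_divide_distrib power_divide)
  qed
  finally have "(\<Prod>x\<in>I. 1 + w x) \<le> exp (4 * quad_gronwall p)" by simp
  then have "K * \<Psi> ^ p * (\<Prod>x\<in>I. 1 + w x) \<le> K * \<Psi> ^ p * exp (4 * quad_gronwall p)"
    using K0 \<Psi>pos by (intro mult_left_mono) auto
  moreover have "0 \<le> K * \<Psi> ^ p" using K0 \<Psi>pos by simp
  ultimately show ?thesis using claim[OF subset_refl] unfolding K_def by (simp add: mult_ac)
qed

definition diag_const :: "nat \<Rightarrow> real" where
  "diag_const j = 2 ^ j * (c (2 * j) + c 2 ^ j)"

lemma diag_const_nonneg: "diag_const j \<ge> 0"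
  unfolding diag_const_def using c by (simp add: add_nonneg_nonneg)

abbreviation var :: "'i \<Rightarrow> real" where
  "var k \<equiv> expectation (\<lambda>\<omega>. (X k \<omega>)\<^sup>2)"

text \<open>\<open>rosenthal\<close> for centred squares. Since \<open>q\<^sup>2 \<le> N\<close>,
  the power \<open>var k ^ j\<close> obeys the same bound as the moment of order
  \<open>2 * j\<close>, and each further power of a square costs
  \<open>1 / q\<^sup>2\<close>.\<close>

lemma diag_moment:
  assumes A: "0 \<le> A" "\<And>k. k \<in> I \<Longrightarrow> \<bar>a k\<bar> \<le> A" and p: "2 \<le> p"
  shows "\<bar>expectation (\<lambda>\<omega>. (\<Sum>k\<in>I. a k * ((X k \<omega>)\<^sup>2 - var k)) ^ p)\<bar>
    \<le> rosenthal_const diag_const p * (A / q) ^ p"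
proof (rule rosenthal[where v = "\<lambda>k. A\<^sup>2 / (real N * q\<^sup>2)" and \<theta> = "A / q\<^sup>2"])
  have Npos: "0 < real N" and qpos: "0 < q" using N_pos q by auto
  have mk: "all_moments M (\<lambda>\<omega>. (X k \<omega>)\<^sup>2 - var k)" if "k \<in> I" for k
    using all_moments_add[OF all_moments_power[OF mom[OF that], of 2] all_moments_const[of "- var k"]] by simp
  show "finite I" by (rule fin)
  show "indep_vars (\<lambda>_. borel) (\<lambda>k \<omega>. a k * ((X k \<omega>)\<^sup>2 - var k)) I"
    by (rule indep_vars_compose2[OF ind]) measurable
  show "all_moments M (\<lambda>\<omega>. a k * ((X k \<omega>)\<^sup>2 - var k))" if "k \<in> I" for k
    using mk[OF that] by (rule all_moments_cmult)
  show "expectation (\<lambda>\<omega>. a k * ((X k \<omega>)\<^sup>2 - var k)) = 0" if "k \<in> I" for k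
    using all_momentsD(3)[OF mom[OF that], of 2] by (simp add: prob_space)
  show "\<bar>expectation (\<lambda>\<omega>. (a k * ((X k \<omega>)\<^sup>2 - var k)) ^ j)\<bar>
      \<le> diag_const j * (A\<^sup>2 / (real N * q\<^sup>2)) * (A / q\<^sup>2) ^ (j - 2)"
    if k: "k \<in> I" and j: "2 \<le> j" for k j
  proof -
    have Npow: "real N * q ^ (2 * j - 2) \<le> real N ^ j"
    proof -
      have "real N * q ^ (2 * j - 2) = real N * (q\<^sup>2) ^ (j - 1)"
        by (simp add: power_mult[symmetric] diff_mult_distrib2)
      also have "\<dots> \<le> real N * real N ^ (j - 1)"
        using q by (intro mult_left_mono power_mono) auto
      also have "\<dots> = real N ^ j" using j by (cases j) auto
      finally show ?thesis .
    qed
    have v0: "0 \<le> var k" by (intro integral_nonneg_AE) auto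
    have "var k \<le> c 2 / real N" using bound[OF k, of 2] by simp
    then have "var k ^ j \<le> (c 2 / real N) ^ j" using v0 by (intro power_mono) auto
    also have "\<dots> \<le> c 2 ^ j / (real N * q ^ (2 * j - 2))"
      unfolding power_divide using Npow Npos qpos c by (intro divide_left_mono) auto
    finally have vj: "var k ^ j \<le> c 2 ^ j / (real N * q ^ (2 * j - 2))" .
    have "\<bar>expectation (\<lambda>\<omega>. (a k * ((X k \<omega>)\<^sup>2 - var k)) ^ j)\<bar>
        = \<bar>a k\<bar> ^ j * \<bar>expectation (\<lambda>\<omega>. ((X k \<omega>)\<^sup>2 - var k) ^ j)\<bar>"
      by (simp add: power_mult_distrib abs_mult power_abs)
    also have "\<dots> \<le> A ^ j * expectation (\<lambda>\<omega>. \<bar>((X k \<omega>)\<^sup>2 - var k) ^ j\<bar>)"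
      using A k by (intro mult_mono power_mono integral_abs_bound) auto
    also have "\<dots> \<le> A ^ j * expectation (\<lambda>\<omega>. 2 ^ j * (\<bar>X k \<omega>\<bar> ^ (2 * j) + var k ^ j))"
    proof (intro mult_left_mono integral_mono)
      show "integrable M (\<lambda>\<omega>. \<bar>((X k \<omega>)\<^sup>2 - var k) ^ j\<bar>)"
        using all_momentsD(3)[OF mk[OF k], of j] by (rule integrable_abs)
      show "integrable M (\<lambda>\<omega>. 2 ^ j * (\<bar>X k \<omega>\<bar> ^ (2 * j) + var k ^ j))"
        using all_momentsD(2)[OF mom[OF k], of "2 * j"] by simp
      show "\<bar>((X k \<omega>)\<^sup>2 - var k) ^ j\<bar> \<le> 2 ^ j * (\<bar>X k \<omega>\<bar> ^ (2 * j) + var k ^ j)" for \<omega>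
        using abs_add_power_le[of "(X k \<omega>)\<^sup>2" "- var k" j] v0 by (simp add: power_abs power_mult)
    qed (use A in auto)
    also have "\<dots> = A ^ j * (2 ^ j * (expectation (\<lambda>\<omega>. \<bar>X k \<omega>\<bar> ^ (2 * j)) + var k ^ j))"
      using all_momentsD(2)[OF mom[OF k], of "2 * j"] by (simp add: prob_space)
    also have "\<dots> \<le> A ^ j * (2 ^ j * (c (2 * j) / (real N * q ^ (2 * j - 2)) + c 2 ^ j / (real N * q ^ (2 * j - 2))))"
      using j A k by (intro mult_left_mono add_mono vj bound) auto
    also have "\<dots> = diag_const j * (A ^ j / (real N * q ^ (2 * j - 2)))"
      unfolding diag_const_def by (simp add: add_divide_distrib[symmetric])
    also have "A ^ j = A\<^sup>2 * A ^ (j - 2)" using j by (metis le_add_diff_inverse power_add)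
    also have "q ^ (2 * j - 2) = q\<^sup>2 * (q\<^sup>2) ^ (j - 2)"
      unfolding power_mult[symmetric] power_add[symmetric] using j by (intro arg_cong[of _ _ "power q"]) auto
    finally show ?thesis by (simp add: power_divide)
  qed
  show "A / q\<^sup>2 \<le> A / q" using A q qpos by (intro divide_left_mono) (auto simp: power2_eq_square)
  have "(\<Sum>k\<in>I. A\<^sup>2 / (real N * q\<^sup>2)) \<le> real N * (A\<^sup>2 / (real N * q\<^sup>2))"
    using card unfolding sum_constant by (intro mult_right_mono) auto
  also have "\<dots> = (A / q)\<^sup>2" using Npos by (simp add: power_divide)
  finally show "(\<Sum>k\<in>I. A\<^sup>2 / (real N * q\<^sup>2)) \<le> (A / q)\<^sup>2" .
qed (use p A diag_const_nonneg in auto)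

text \<open>Markov's inequality for the \<open>p\<close>-th power. For \<open>\<Psi> = 0\<close> the
  moment bound forces \<open>S = 0\<close> almost everywhere, and the strict inequality makes the
  event null.\<close>

lemma moment_tail:
  assumes S: "all_moments M S" and p: "even p" "2 \<le> p" and E: "expectation (\<lambda>\<omega>. S \<omega> ^ p) \<le> C * \<Psi> ^ p"
    and \<Psi>: "0 \<le> \<Psi>" and R: "0 < R" and C: "0 \<le> C"
  shows "prob {\<omega> \<in> space M. \<bar>S \<omega>\<bar> > R * \<Psi>} \<le> C / R ^ p"
proof (cases "\<Psi> = 0")
  case True
  have nn: "AE \<omega> in M. 0 \<le> S \<omega> ^ p" using p by auto
  have "expectation (\<lambda>\<omega>. S \<omega> ^ p) = 0"
    using E True p integral_nonneg_AE[OF nn] by (simp add: power_0_left)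
  then have "AE \<omega> in M. S \<omega> ^ p = 0"
    using integral_nonneg_eq_0_iff_AE[OF all_momentsD(3)[OF S] nn] by simp
  then have "AE \<omega> in M. \<not> \<bar>S \<omega>\<bar> > R * \<Psi>"
  proof eventually_elim
    case (elim \<omega>)
    then show ?case using True p by simp
  qed
  then have "prob {\<omega> \<in> space M. \<bar>S \<omega>\<bar> > R * \<Psi>} = 0"
    using all_momentsD(1)[OF S] by (subst prob_Collect_eq_0) auto
  then show ?thesis using C R by simp
next
  case False
  then have pos: "0 < (R * \<Psi>) ^ p" using \<Psi> R by simp
  note [measurable] = all_momentsD(1)[OF S]
  have "prob {\<omega> \<in> space M. \<bar>S \<omega>\<bar> > R * \<Psi>} \<le> prob {\<omega> \<in> space M. S \<omega> ^ p \<ge> (R * \<Psi>) ^ p}"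
  proof (rule finite_measure_mono)
    show "{\<omega> \<in> space M. \<bar>S \<omega>\<bar> > R * \<Psi>} \<subseteq> {\<omega> \<in> space M. S \<omega> ^ p \<ge> (R * \<Psi>) ^ p}"
    proof safe
      fix \<omega> assume "R * \<Psi> < \<bar>S \<omega>\<bar>"
      then have "(R * \<Psi>) ^ p \<le> \<bar>S \<omega>\<bar> ^ p" using R \<Psi> by (intro power_mono) auto
      then show "(R * \<Psi>) ^ p \<le> S \<omega> ^ p" using p by (simp add: power_even_abs)
    qed
  qed measurable
  also have "\<dots> \<le> expectation (\<lambda>\<omega>. S \<omega> ^ p) / (R * \<Psi>) ^ p"
    by (rule integral_Markov_inequality_measure[where A = "space M"]) (use all_momentsD(3)[OF S] p pos in auto)
  also have "\<dots> \<le> C * \<Psi> ^ p / (R * \<Psi>) ^ p" using E pos by (intro divide_right_mono) auto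
  also have "\<dots> = C / R ^ p" using False by (simp add: power_mult_distrib)
  finally show ?thesis .
qed

lemma linear_tail:
  fixes a :: "'i \<Rightarrow> complex"
  assumes A: "0 \<le> A" "\<And>k. k \<in> I \<Longrightarrow> cmod (a k) \<le> A"
    and \<Psi>: "A / q \<le> \<Psi>" "(\<Sum>k\<in>I. (cmod (a k))\<^sup>2) / real N \<le> \<Psi>\<^sup>2"
    and p: "even p" "2 \<le> p" and R: "0 < R"
  shows "prob {\<omega> \<in> space M. cmod (\<Sum>k\<in>I. a k * of_real (X k \<omega>)) > 2 * (R * \<Psi>)}
    \<le> 2 * rosenthal_const c p / R ^ p"
proof -
  have \<Psi>0: "0 \<le> \<Psi>" using \<Psi>(1) A(1) q by (meson divide_nonneg_nonneg order_trans zero_le_one)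
  have real_case: "prob {\<omega> \<in> space M. \<bar>\<Sum>k\<in>I. f (a k) * X k \<omega>\<bar> > R * \<Psi>} \<le> rosenthal_const c p / R ^ p"
    if f: "\<And>z. \<bar>f z\<bar> \<le> cmod z" for f :: "complex \<Rightarrow> real"
  proof (rule moment_tail[OF _ p _ \<Psi>0 R])
    show "all_moments M (\<lambda>\<omega>. \<Sum>k\<in>I. f (a k) * X k \<omega>)"
      using mom by (intro all_moments_sum all_moments_cmult) auto
    have "\<bar>expectation (\<lambda>\<omega>. (\<Sum>k\<in>I. f (a k) * X k \<omega>) ^ p)\<bar> \<le> rosenthal_const c p * \<Psi> ^ p"
    proof (rule linear_moment[OF subset_refl A(1) _ \<Psi>(1) _ p(2)])
      show "\<bar>f (a k)\<bar> \<le> A" if "k \<in> I" for k using f A(2)[OF that] by (meson order_trans)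
      have "(f z)\<^sup>2 \<le> (cmod z)\<^sup>2" for z using f[of z] by (metis abs_ge_zero power2_abs power_mono)
      then have "(\<Sum>k\<in>I. (f (a k))\<^sup>2) / real N \<le> (\<Sum>k\<in>I. (cmod (a k))\<^sup>2) / real N"
        by (intro divide_right_mono sum_mono) auto
      with \<Psi>(2) show "(\<Sum>k\<in>I. (f (a k))\<^sup>2) / real N \<le> \<Psi>\<^sup>2" by linarith
    qed
    then show "expectation (\<lambda>\<omega>. (\<Sum>k\<in>I. f (a k) * X k \<omega>) ^ p) \<le> rosenthal_const c p * \<Psi> ^ p" by linarith
    show "0 \<le> rosenthal_const c p" by (rule rosenthal_const_nonneg) (rule c)
  qed
  have [measurable]: "k \<in> I \<Longrightarrow> X k \<in> borel_measurable M" for k using all_momentsD(1)[OF mom] .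
  have "prob {\<omega> \<in> space M. cmod (\<Sum>k\<in>I. a k * of_real (X k \<omega>)) > 2 * (R * \<Psi>)}
      \<le> prob ({\<omega> \<in> space M. \<bar>\<Sum>k\<in>I. Re (a k) * X k \<omega>\<bar> > R * \<Psi>} \<union>
              {\<omega> \<in> space M. \<bar>\<Sum>k\<in>I. Im (a k) * X k \<omega>\<bar> > R * \<Psi>})"
  proof (rule finite_measure_mono)
    show "{\<omega> \<in> space M. cmod (\<Sum>k\<in>I. a k * of_real (X k \<omega>)) > 2 * (R * \<Psi>)} \<subseteq>
        {\<omega> \<in> space M. \<bar>\<Sum>k\<in>I. Re (a k) * X k \<omega>\<bar> > R * \<Psi>} \<union>
        {\<omega> \<in> space M. \<bar>\<Sum>k\<in>I. Im (a k) * X k \<omega>\<bar> > R * \<Psi>}"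
    proof safe
      fix \<omega> assume *: "2 * (R * \<Psi>) < cmod (\<Sum>k\<in>I. a k * of_real (X k \<omega>))"
        "\<not> R * \<Psi> < \<bar>\<Sum>k\<in>I. Im (a k) * X k \<omega>\<bar>"
      then show "R * \<Psi> < \<bar>\<Sum>k\<in>I. Re (a k) * X k \<omega>\<bar>"
        using cmod_le[of "\<Sum>k\<in>I. a k * of_real (X k \<omega>)"] by simp
    qed
  qed measurable
  also have "\<dots> \<le> prob {\<omega> \<in> space M. \<bar>\<Sum>k\<in>I. Re (a k) * X k \<omega>\<bar> > R * \<Psi>} +
              prob {\<omega> \<in> space M. \<bar>\<Sum>k\<in>I. Im (a k) * X k \<omega>\<bar> > R * \<Psi>}"
    by (rule measure_Un_le) measurable
  also have "\<dots> \<le> rosenthal_const c p / R ^ p + rosenthal_const c p / R ^ p"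
    by (intro add_mono real_case abs_Re_le_cmod abs_Im_le_cmod)
  finally show ?thesis by simp
qed

text \<open>Diagonal terms are centred by the variances, off-diagonal ones have mean zero.
  \<open>diag_moment\<close> and \<open>quad_moment\<close> handle real and imaginary parts of each,
  and the four tails add up.\<close>

lemma quad_tail:
  fixes a :: "'i \<Rightarrow> 'i \<Rightarrow> complex"
  assumes sym: "\<And>k l. k \<in> I \<Longrightarrow> l \<in> I \<Longrightarrow> a k l = a l k"
    and A: "0 \<le> A" "\<And>k l. k \<in> I \<Longrightarrow> l \<in> I \<Longrightarrow> cmod (a k l) \<le> A"
    and \<Psi>: "A / q \<le> \<Psi>" "(\<Sum>k\<in>I. \<Sum>l\<in>I. (cmod (a k l))\<^sup>2) / (real N)\<^sup>2 \<le> \<Psi>\<^sup>2"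
    and p: "even p" "2 \<le> p" and R: "0 < R"
  shows "prob {\<omega> \<in> space M. cmod ((\<Sum>k\<in>I. \<Sum>l\<in>I. of_real (X k \<omega>) * a k l * of_real (X l \<omega>))
        - (\<Sum>k\<in>I. of_real (var k) * a k k)) > 4 * (R * \<Psi>)}
    \<le> 2 * (rosenthal_const diag_const p + rosenthal_const c p * exp (4 * quad_gronwall p)) / R ^ p"
proof -
  have \<Psi>0: "0 \<le> \<Psi>" using \<Psi>(1) A(1) q by (meson divide_nonneg_nonneg order_trans zero_le_one)
  let ?C1 = "rosenthal_const diag_const p" and ?C2 = "rosenthal_const c p * exp (4 * quad_gronwall p)"
  have C1: "0 \<le> ?C1" by (rule rosenthal_const_nonneg) (rule diag_const_nonneg)
  have C2: "0 \<le> ?C2" by (intro mult_nonneg_nonneg rosenthal_const_nonneg c) auto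
  let ?D = "\<lambda>f \<omega>. \<Sum>k\<in>I. f (a k k) * ((X k \<omega>)\<^sup>2 - var k)"
  let ?O = "\<lambda>f \<omega>. \<Sum>k\<in>I. \<Sum>l\<in>I-{k}. f (a k l) * X k \<omega> * X l \<omega>"
  have diag: "prob {\<omega> \<in> space M. \<bar>?D f \<omega>\<bar> > R * \<Psi>} \<le> ?C1 / R ^ p"
    if f: "\<And>z. \<bar>f z\<bar> \<le> cmod z" for f :: "complex \<Rightarrow> real"
  proof (rule moment_tail[OF _ p _ \<Psi>0 R C1])
    have "all_moments M (\<lambda>\<omega>. (X k \<omega>)\<^sup>2 - var k)" if "k \<in> I" for k
      using all_moments_add[OF all_moments_power[OF mom[OF that], of 2] all_moments_const[of "- var k"]] by simp
    then show "all_moments M (?D f)" by (intro all_moments_sum all_moments_cmult)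
    have "\<bar>expectation (\<lambda>\<omega>. ?D f \<omega> ^ p)\<bar> \<le> ?C1 * (A / q) ^ p"
      by (rule diag_moment[OF A(1) _ p(2)]) (meson f A(2) order_trans)
    also have "\<dots> \<le> ?C1 * \<Psi> ^ p"
      using \<Psi>(1) A(1) q by (intro mult_left_mono power_mono C1) auto
    finally show "expectation (\<lambda>\<omega>. ?D f \<omega> ^ p) \<le> ?C1 * \<Psi> ^ p" by linarith
  qed
  have offd: "prob {\<omega> \<in> space M. \<bar>?O f \<omega>\<bar> > R * \<Psi>} \<le> ?C2 / R ^ p"
    if f: "\<And>z. \<bar>f z\<bar> \<le> cmod z" for f :: "complex \<Rightarrow> real"
  proof (rule moment_tail[OF _ p _ \<Psi>0 R C2])
    show "all_moments M (?O f)"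
      using mom by (intro all_moments_sum all_moments_mult all_moments_const) auto
    show "expectation (\<lambda>\<omega>. ?O f \<omega> ^ p) \<le> ?C2 * \<Psi> ^ p"
    proof (cases "A = 0")
      \<comment> \<open>\<open>quad_moment\<close> divides by scales that are positive only for
        \<open>0 < A\<close>; for \<open>A = 0\<close> the form vanishes identically.\<close>
      case True
      have "f (a k l) = 0" if "k \<in> I" "l \<in> I" for k l
        using f[of "a k l"] A(2)[OF that] True by simp
      then have "?O f \<omega> = 0" for \<omega> by (intro sum.neutral) auto
      then show ?thesis using p \<Psi>0 C2 by (simp add: power_0_left)
    next
      case False
      show ?thesis
      proof (rule quad_moment[OF _ _ _ \<Psi>(1) _ p(2,1)])
        show "0 < A" using False A by simp
        show "\<bar>f (a k l)\<bar> \<le> A" if "k \<in> I" "l \<in> I" for k l using f A(2)[OF that] by (meson order_trans)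
        have "(f z)\<^sup>2 \<le> (cmod z)\<^sup>2" for z using f[of z] by (metis abs_ge_zero power2_abs power_mono)
        then have "(\<Sum>k\<in>I. \<Sum>l\<in>I. (f (a k l))\<^sup>2) / (real N)\<^sup>2 \<le> (\<Sum>k\<in>I. \<Sum>l\<in>I. (cmod (a k l))\<^sup>2) / (real N)\<^sup>2"
          by (intro divide_right_mono sum_mono) auto
        with \<Psi>(2) show "(\<Sum>k\<in>I. \<Sum>l\<in>I. (f (a k l))\<^sup>2) / (real N)\<^sup>2 \<le> \<Psi>\<^sup>2" by linarith
      qed (use sym in auto)
    qed
  qed
  let ?E = "\<lambda>T. {\<omega> \<in> space M. \<bar>T \<omega>\<bar> > R * \<Psi>}"
  let ?Z = "\<lambda>\<omega>. (\<Sum>k\<in>I. \<Sum>l\<in>I. of_real (X k \<omega>) * a k l * of_real (X l \<omega>)) - (\<Sum>k\<in>I. of_real (var k) * a k k)"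
  have Z: "?Z \<omega> = (\<Sum>k\<in>I. a k k * of_real ((X k \<omega>)\<^sup>2 - var k)) + (\<Sum>k\<in>I. \<Sum>l\<in>I-{k}. a k l * of_real (X k \<omega> * X l \<omega>))" for \<omega>
  proof -
    have "(\<Sum>l\<in>I. of_real (X k \<omega>) * a k l * of_real (X l \<omega>)) = a k k * of_real ((X k \<omega>)\<^sup>2) +
        (\<Sum>l\<in>I-{k}. a k l * of_real (X k \<omega> * X l \<omega>))" if "k \<in> I" for k
      using that fin by (subst sum.remove[of I k]) (auto simp: power2_eq_square mult_ac)
    then show ?thesis by (simp add: sum.distrib sum_subtractf algebra_simps)
  qed
  have [measurable]: "k \<in> I \<Longrightarrow> X k \<in> borel_measurable M" for k using all_momentsD(1)[OF mom] .
  have m: "?E (?D f) \<in> events" "?E (?O f) \<in> events" for f by measurable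
  have "prob {\<omega> \<in> space M. cmod (?Z \<omega>) > 4 * (R * \<Psi>)}
      \<le> prob ((?E (?D Re) \<union> ?E (?D Im)) \<union> (?E (?O Re) \<union> ?E (?O Im)))"
  proof (rule finite_measure_mono)
    show "{\<omega> \<in> space M. cmod (?Z \<omega>) > 4 * (R * \<Psi>)} \<subseteq> (?E (?D Re) \<union> ?E (?D Im)) \<union> (?E (?O Re) \<union> ?E (?O Im))"
    proof
      fix \<omega> assume "\<omega> \<in> {\<omega> \<in> space M. cmod (?Z \<omega>) > 4 * (R * \<Psi>)}"
      then have w: "\<omega> \<in> space M" "4 * (R * \<Psi>) < cmod (?Z \<omega>)" by auto
      have "cmod (?Z \<omega>) \<le> \<bar>Re (?Z \<omega>)\<bar> + \<bar>Im (?Z \<omega>)\<bar>" by (rule cmod_le)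
      moreover have "Re (?Z \<omega>) = ?D Re \<omega> + ?O Re \<omega>" "Im (?Z \<omega>) = ?D Im \<omega> + ?O Im \<omega>"
        unfolding Z by (simp_all add: mult.assoc)
      ultimately have "4 * (R * \<Psi>) < \<bar>?D Re \<omega>\<bar> + \<bar>?O Re \<omega>\<bar> + (\<bar>?D Im \<omega>\<bar> + \<bar>?O Im \<omega>\<bar>)"
        using w(2) by linarith
      then show "\<omega> \<in> (?E (?D Re) \<union> ?E (?D Im)) \<union> (?E (?O Re) \<union> ?E (?O Im))"
        using w(1) by (simp, linarith)
    qed
  qed (use m in auto)
  also have "\<dots> \<le> (prob (?E (?D Re)) + prob (?E (?D Im))) + (prob (?E (?O Re)) + prob (?E (?O Im)))"
    using m by (intro order_trans[OF measure_Un_le] add_mono measure_Un_le) auto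
  also have "\<dots> \<le> (?C1 / R ^ p + ?C1 / R ^ p) + (?C2 / R ^ p + ?C2 / R ^ p)"
    by (intro add_mono diag offd abs_Re_le_cmod abs_Im_le_cmod)
  finally show ?thesis by (simp add: add_divide_distrib)
qed

end

section \<open>Row estimates with high probability\<close>

text \<open>Independence makes the joint law a product, so by Fubini a bound valid for every frozen
  value of \<open>Y\<close> holds for the random one.\<close>

lemma (in prob_space) indep_var_prob_le:
  assumes ind: "indep_var S X T Y"
    and m: "{x \<in> space (S \<Otimes>\<^sub>M T). P (fst x) (snd x)} \<in> sets (S \<Otimes>\<^sub>M T)"
    and b: "\<And>y. y \<in> space T \<Longrightarrow> prob {\<omega> \<in> space M. P (X \<omega>) y} \<le> b" and b0: "0 \<le> b"
  shows "prob {\<omega> \<in> space M. P (X \<omega>) (Y \<omega>)} \<le> b"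
proof -
  let ?B = "{x \<in> space (S \<Otimes>\<^sub>M T). P (fst x) (snd x)}"
  have rX [measurable]: "X \<in> measurable M S" and rY [measurable]: "Y \<in> measurable M T"
    using ind by (auto dest: indep_var_rv1 indep_var_rv2)
  have eq: "distr M S X \<Otimes>\<^sub>M distr M T Y = distr M (S \<Otimes>\<^sub>M T) (\<lambda>x. (X x, Y x))"
    using ind unfolding indep_var_distribution_eq by auto
  note em = emeasure_eq_measure
  interpret PX: prob_space "distr M S X" by (rule prob_space_distr) (rule rX)
  interpret PY: prob_space "distr M T Y" by (rule prob_space_distr) (rule rY)
  interpret pair_prob_space "distr M S X" "distr M T Y" ..
  have "emeasure M {\<omega> \<in> space M. P (X \<omega>) (Y \<omega>)} = emeasure (distr M (S \<Otimes>\<^sub>M T) (\<lambda>x. (X x, Y x))) ?B"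
    using m rX rY
    by (subst emeasure_distr) (auto simp: space_pair_measure measurable_space[OF rX] measurable_space[OF rY]
          intro!: arg_cong[of _ _ "emeasure M"])
  also have "\<dots> = emeasure (distr M S X \<Otimes>\<^sub>M distr M T Y) ?B" by (simp add: eq)
  also have "\<dots> = (\<integral>\<^sup>+ y. emeasure (distr M S X) ((\<lambda>x. (x, y)) -` ?B) \<partial>distr M T Y)"
  proof (rule emeasure_pair_measure_alt2)
    have "sets (distr M S X \<Otimes>\<^sub>M distr M T Y) = sets (S \<Otimes>\<^sub>M T)"
      by (rule sets_pair_measure_cong) simp_all
    then show "?B \<in> sets (distr M S X \<Otimes>\<^sub>M distr M T Y)" using m by (simp only:)
  qed
  also have "\<dots> \<le> (\<integral>\<^sup>+ y. ennreal b \<partial>distr M T Y)"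
  proof (rule nn_integral_mono)
    fix y assume "y \<in> space (distr M T Y)"
    then have y: "y \<in> space T" by simp
    have s: "(\<lambda>x. (x, y)) -` ?B \<in> sets S" using sets_Pair2[OF m, of y] .
    have "emeasure (distr M S X) ((\<lambda>x. (x, y)) -` ?B) = emeasure M (X -` ((\<lambda>x. (x, y)) -` ?B) \<inter> space M)"
      by (rule emeasure_distr[OF rX s])
    also have "X -` ((\<lambda>x. (x, y)) -` ?B) \<inter> space M = {\<omega> \<in> space M. P (X \<omega>) y}"
      using y measurable_space[OF rX] by (auto simp: space_pair_measure)
    also have "emeasure M \<dots> \<le> ennreal b"
      unfolding em by (rule ennreal_leI) (rule b[OF y])
    finally show "emeasure (distr M S X) ((\<lambda>x. (x, y)) -` ?B) \<le> ennreal b" .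
  qed
  also have "\<dots> = ennreal b" by (simp only: nn_integral_const PY.emeasure_space_1 mult_1_right)
  finally show ?thesis unfolding em using b0 by simp
qed

text \<open>For vanishing mean the moment series minus 1 starts at order 2. Its square has no
  coefficient of order 2, so only the linear term of the logarithm contributes.\<close>

lemma second_cumulant:
  assumes "prob_space M" "(\<integral>\<omega>. X \<omega> \<partial>M) = 0"
  shows "cumulant M X 2 = (\<integral>\<omega>. (X \<omega>)\<^sup>2 \<partial>M)"
proof -
  interpret prob_space M by fact
  define b where "b = moment_fps M X - 1"
  have b: "fps_nth b 0 = 0" "fps_nth b 1 = 0" "fps_nth b 2 = (\<integral>\<omega>. (X \<omega>)\<^sup>2 \<partial>M) / 2"
    unfolding b_def moment_fps_def using assms(2) by (auto simp: prob_space)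
  have "fps_nth (b ^ 2) 2 = 0"
    unfolding power2_eq_square fps_mult_nth by (simp add: numeral_2_eq_2 b[unfolded numeral_2_eq_2, simplified])
  then have "fps_nth (fps_compose (fps_ln 1) b) 2 = fps_nth b 2"
    unfolding fps_compose_nth by (simp add: numeral_2_eq_2 fps_ln_nth)
  then show ?thesis unfolding cumulant_def b_def[symmetric] b by simp
qed

section \<open>Splitting a matrix into one row and its minor\<close>

definition sym_mat :: "nat \<Rightarrow> (nat \<times> nat \<Rightarrow> real) \<Rightarrow> real mat" where
  "sym_mat N h = mat N N (\<lambda>(a, b). if a = b then 0 else h (min a b, max a b))"

lemma sym_mat_carrier: "sym_mat N h \<in> carrier_mat N N"
  unfolding sym_mat_def by auto

lemma sym_mat_index: "a < N \<Longrightarrow> b < N \<Longrightarrow> sym_mat N h $$ (a, b) = (if a = b then 0 else h (min a b, max a b))"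
  unfolding sym_mat_def by auto

lemma sym_mat_sym: "a < N \<Longrightarrow> b < N \<Longrightarrow> sym_mat N h $$ (a, b) = sym_mat N h $$ (b, a)"
  by (auto simp: sym_mat_index min.commute max.commute)

lemma sym_mat_resolvent: "Im z \<noteq> 0 \<Longrightarrow> sym_resolvent N (sym_mat N h) z"
  by unfold_locales (auto intro: sym_mat_carrier sym_mat_sym)

lemma sym_mat_cong:
  assumes "\<And>a b. a < b \<Longrightarrow> b < N \<Longrightarrow> h (a, b) = h' (a, b)"
  shows "sym_mat N h = sym_mat N h'"
proof (rule eq_matI)
  fix a b assume "a < dim_row (sym_mat N h')" "b < dim_col (sym_mat N h')"
  then have ab: "a < N" "b < N" using sym_mat_carrier[of N h'] by auto
  show "sym_mat N h $$ (a, b) = sym_mat N h' $$ (a, b)"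
  proof (cases "a = b")
    case False
    then have "min a b < max a b" "max a b < N" using ab by auto
    then show ?thesis using assms ab by (simp add: sym_mat_index)
  qed (use ab in \<open>simp add: sym_mat_index\<close>)
qed (auto simp: sym_mat_def)

definition minor_pairs :: "nat \<Rightarrow> nat \<Rightarrow> (nat \<times> nat) set" where
  "minor_pairs N i = {(a, b). a < b \<and> b < N \<and> a \<noteq> i \<and> b \<noteq> i}"

definition row_pairs :: "nat \<Rightarrow> nat \<Rightarrow> (nat \<times> nat) set" where
  "row_pairs N i = {(a, b). a < b \<and> b < N \<and> (a = i \<or> b = i)}"

text \<open>\<open>glue\<close> assembles a matrix from the entries \<open>x\<close> of row \<open>i\<close> and the remaining entries \<open>y\<close>, which
  are independent of each other in the model.\<close>

definition glue :: "nat \<Rightarrow> nat \<Rightarrow> (nat \<times> nat \<Rightarrow> real) \<Rightarrow> (nat \<times> nat \<Rightarrow> real) \<Rightarrow> real mat" where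
  "glue N i x y = sym_mat N (\<lambda>p. if p \<in> row_pairs N i then x p else y p)"

lemma row_pairsI: "i < N \<Longrightarrow> k < N \<Longrightarrow> k \<noteq> i \<Longrightarrow> (min k i, max k i) \<in> row_pairs N i"
  unfolding row_pairs_def by auto

lemma glue_row: "i < N \<Longrightarrow> k < N \<Longrightarrow> k \<noteq> i \<Longrightarrow> glue N i x y $$ (k, i) = x (min k i, max k i)"
  unfolding glue_def using row_pairsI by (simp add: sym_mat_index)

lemma glue_del_index: "del_index i (glue N i x y) = del_index i (sym_mat N y)"
proof (rule eq_matI)
  fix a b assume "a < dim_row (del_index i (sym_mat N y))" "b < dim_col (del_index i (sym_mat N y))"
  then have ab: "a < N" "b < N" unfolding del_index_def sym_mat_def by auto
  then show "del_index i (glue N i x y) $$ (a, b) = del_index i (sym_mat N y) $$ (a, b)"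
    unfolding del_index_def glue_def sym_mat_def row_pairs_def by auto
qed (auto simp: del_index_def sym_mat_def glue_def)

context
  fixes M :: "'a measure" and F :: "'a \<Rightarrow> real mat" and N :: nat and z :: complex
  assumes res: "\<And>x. x \<in> space M \<Longrightarrow> sym_resolvent N (F x) z"
    and meas: "\<And>i j. i < N \<Longrightarrow> j < N \<Longrightarrow> (\<lambda>x. F x $$ (i, j)) \<in> borel_measurable M"
begin

lemma measurable_minor_resolvent:
  assumes "k < N" "l < N"
  shows "(\<lambda>x. resolvent (del_index i (F x)) z $$ (k, l)) \<in> borel_measurable M"
proof (rule measurable_resolvent[OF _ _ assms])
  show "sym_resolvent N (del_index i (F x)) z" if "x \<in> space M" for x
    by (rule sym_resolvent_del_index) (rule res[OF that])
  fix a b assume ab: "a < N" "b < N"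
  show "(\<lambda>x. del_index i (F x) $$ (a, b)) \<in> borel_measurable M"
  proof (subst measurable_cong)
    show "del_index i (F x) $$ (a, b) = (if a = i \<or> b = i then 0 else F x $$ (a, b))" if "x \<in> space M" for x
      using sym_resolvent.del_index_entry[OF res[OF that] ab] .
    show "(\<lambda>x. if a = i \<or> b = i then 0 else F x $$ (a, b)) \<in> borel_measurable M" using meas[OF ab] by simp
  qed
qed

lemma measurable_minor_max: "(\<lambda>x. minor_max N (F x) z i) \<in> borel_measurable M"
  unfolding minor_max_def
proof (rule borel_measurable_Max)
  fix p assume "p \<in> ({..<N} - {i}) \<times> ({..<N} - {i})"
  then show "(\<lambda>x. case p of (k, l) \<Rightarrow> cmod (resolvent (del_index i (F x)) z $$ (k, l))) \<in> borel_measurable M"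
    using measurable_compose[OF measurable_minor_resolvent borel_measurable_norm, of "fst p" "snd p" i] by (cases p) auto
qed simp

lemma measurable_row_good_parts:
  assumes "i < N"
  shows "k \<in> {..<N} - {i} \<Longrightarrow> l \<in> {..<N} - {i} \<Longrightarrow>
      (\<lambda>x. resolvent (del_index i (F x)) z $$ (k, l)) \<in> borel_measurable M"
    and "k \<in> {..<N} - {i} \<Longrightarrow> l \<in> {..<N} - {i} \<Longrightarrow>
      (\<lambda>x. cmod (resolvent (del_index i (F x)) z $$ (k, l))) \<in> borel_measurable M"
    and "k \<in> {..<N} - {i} \<Longrightarrow> (\<lambda>x. complex_of_real (F x $$ (k, i))) \<in> borel_measurable M"
proof -
  show m: "(\<lambda>x. resolvent (del_index i (F x)) z $$ (k, l)) \<in> borel_measurable M"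
    if "k \<in> {..<N} - {i}" "l \<in> {..<N} - {i}"
    using that by (intro measurable_minor_resolvent) auto
  show "(\<lambda>x. cmod (resolvent (del_index i (F x)) z $$ (k, l))) \<in> borel_measurable M"
    if "k \<in> {..<N} - {i}" "l \<in> {..<N} - {i}"
    by (rule measurable_compose[OF m[OF that] borel_measurable_norm])
  show "(\<lambda>x. complex_of_real (F x $$ (k, i))) \<in> borel_measurable M" if "k \<in> {..<N} - {i}"
    using meas[of k i] that assms by simp
qed

lemma measurable_row_linear_good:
  assumes i: "i < N" and j: "j < N" "j \<noteq> i"
  shows "{x \<in> space M. row_linear_good N q R (F x) z i j} \<in> sets M"
proof -
  define f where "f x = (\<Sum>k\<in>{..<N}-{i}. resolvent (del_index i (F x)) z $$ (j, k) * of_real (F x $$ (k, i)))" for x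
  define g where "g x = (\<Sum>k\<in>{..<N}-{i}. (cmod (resolvent (del_index i (F x)) z $$ (j, k)))\<^sup>2) / real N" for x
  have [measurable]: "f \<in> borel_measurable M"
    unfolding f_def using j
    by (intro borel_measurable_sum borel_measurable_times measurable_row_good_parts i) auto
  have [measurable]: "g \<in> borel_measurable M"
    unfolding g_def using j
    by (intro borel_measurable_divide borel_measurable_sum borel_measurable_power borel_measurable_const
        measurable_row_good_parts i) auto
  note [measurable] = measurable_minor_max
  have "{x \<in> space M. cmod (f x) \<le> 2 * (R * (minor_max N (F x) z i / q + sqrt (g x)))} \<in> sets M" by measurable
  then show ?thesis unfolding row_linear_good_def f_def g_def .
qed

lemma measurable_row_quad_good:
  assumes i: "i < N"
  shows "{x \<in> space M. row_quad_good N q R s (F x) z i} \<in> sets M"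
proof -
  define f where "f x = (\<Sum>k\<in>{..<N}-{i}. \<Sum>l\<in>{..<N}-{i}.
          of_real (F x $$ (k, i)) * resolvent (del_index i (F x)) z $$ (k, l) * of_real (F x $$ (l, i)))
        - (\<Sum>k\<in>{..<N}-{i}. of_real (s k i) * resolvent (del_index i (F x)) z $$ (k, k))" for x
  define g where "g x = (\<Sum>k\<in>{..<N}-{i}. \<Sum>l\<in>{..<N}-{i}.
      (cmod (resolvent (del_index i (F x)) z $$ (k, l)))\<^sup>2) / (real N)\<^sup>2" for x
  have [measurable]: "f \<in> borel_measurable M"
    unfolding f_def
    by (intro borel_measurable_diff borel_measurable_sum borel_measurable_times borel_measurable_const
        measurable_row_good_parts i)
  have [measurable]: "g \<in> borel_measurable M"
    unfolding g_def
    by (intro borel_measurable_divide borel_measurable_sum borel_measurable_power borel_measurable_const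
        measurable_row_good_parts i)
  note [measurable] = measurable_minor_max
  have "{x \<in> space M. cmod (f x) \<le> 4 * (R * (minor_max N (F x) z i / q + sqrt (g x)))} \<in> sets M" by measurable
  then show ?thesis unfolding row_quad_good_def f_def g_def .
qed

end

lemma (in prob_space) indep_vars_reindex:
  assumes ind: "indep_vars (\<lambda>_. borel) X I" and f: "inj_on f L" "f ` L \<subseteq> I"
  shows "indep_vars (\<lambda>_. borel) (\<lambda>k \<omega>. X (f k) \<omega>) L"
proof -
  have "indep_vars (\<lambda>j. PiM {f j} (\<lambda>_. borel)) (\<lambda>j \<omega>. restrict (\<lambda>i. X i \<omega>) {f j}) L"
    by (rule indep_vars_restrict[OF ind]) (use f in \<open>auto simp: disjoint_family_on_def inj_on_def\<close>)
  then have "indep_vars (\<lambda>_. borel) (\<lambda>j \<omega>. (\<lambda>y. y (f j)) (restrict (\<lambda>i. X i \<omega>) {f j})) L"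
    by (rule indep_vars_compose2) (rule measurable_component_singleton, simp)
  then show ?thesis by simp
qed

lemma glue_measurable:
  assumes "a < N" "b < N"
  shows "(\<lambda>x. glue N i (fst x) (snd x) $$ (a, b)) \<in>
    borel_measurable (PiM (row_pairs N i) (\<lambda>_. borel) \<Otimes>\<^sub>M PiM (minor_pairs N i) (\<lambda>_. borel))"
proof (cases "a = b")
  case True
  then show ?thesis using assms by (simp add: glue_def sym_mat_index)
next
  case False
  let ?p = "(min a b, max a b)"
  have p: "?p \<in> row_pairs N i \<or> ?p \<in> minor_pairs N i"
    using False assms by (auto simp: row_pairs_def minor_pairs_def)
  show ?thesis
  proof (cases "?p \<in> row_pairs N i")
    case True
    then have "(\<lambda>x. fst x ?p) \<in> borel_measurable (PiM (row_pairs N i) (\<lambda>_. borel) \<Otimes>\<^sub>M PiM (minor_pairs N i) (\<lambda>_. borel))"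
      by measurable
    then show ?thesis using True False assms by (simp add: glue_def sym_mat_index)
  next
    case F: False
    then have "?p \<in> minor_pairs N i" using p by auto
    then have "(\<lambda>x. snd x ?p) \<in> borel_measurable (PiM (row_pairs N i) (\<lambda>_. borel) \<Otimes>\<^sub>M PiM (minor_pairs N i) (\<lambda>_. borel))"
      by measurable
    then show ?thesis using F False assms by (simp add: glue_def sym_mat_index)
  qed
qed

lemma glue_resolvent: "Im z \<noteq> 0 \<Longrightarrow> sym_resolvent N (glue N i x y) z"
  unfolding glue_def by (rule sym_mat_resolvent)

lemma minor_max_ge:
  "k \<in> {..<N} - {i} \<Longrightarrow> l \<in> {..<N} - {i} \<Longrightarrow> cmod (resolvent (del_index i A) z $$ (k, l)) \<le> minor_max N A z i"
  unfolding minor_max_def by (rule Max_ge) auto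

section \<open>Row estimates in the model\<close>

context balanced_sparse_matrix begin

definition moment_seq :: "nat \<Rightarrow> real" where
  "moment_seq j = (C * real j) powr (c * real j)"

text \<open>The indices go through \<open>min\<close> and \<open>max\<close> because independence is
  assumed for entries above the diagonal; in this form \<open>s\<close> agrees literally with the
  variances of the row family.\<close>

definition s :: "nat \<Rightarrow> nat \<Rightarrow> real" where
  "s k i = expectation (\<lambda>\<omega>. (H \<omega> $$ (min k i, max k i))\<^sup>2)"

text \<open>The diagonal of \<open>H\<close> vanishes only almost surely, so it is replaced by zero.\<close>

definition W :: "'w \<Rightarrow> real mat" where
  "W \<omega> = sym_mat N (\<lambda>p. H \<omega> $$ p)"

lemma entry_all_moments: "i < N \<Longrightarrow> j < N \<Longrightarrow> all_moments M (\<lambda>\<omega>. H \<omega> $$ (i, j))"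
  unfolding all_moments_def using H_measurable H_integrable by auto

lemma s_eq:
  assumes "k < N" "i < N"
  shows "s k i = expectation (\<lambda>\<omega>. \<bar>H \<omega> $$ (k, i)\<bar>\<^sup>2)"
  unfolding s_def
proof (rule Bochner_Integration.integral_cong[OF refl])
  fix \<omega> assume w: "\<omega> \<in> space M"
  show "(H \<omega> $$ (min k i, max k i))\<^sup>2 = \<bar>H \<omega> $$ (k, i)\<bar>\<^sup>2"
    using H_symmetric[OF w assms] by (auto simp: min_def max_def)
qed

lemma s_sum1: "i < N \<Longrightarrow> (\<Sum>k<N. s k i) = 1"
  using H_variance_sum[of i] by (simp add: s_eq)

lemma s_diag0:
  assumes "i < N"
  shows "s i i = 0"
proof -
  have "s i i = expectation (\<lambda>\<omega>. 0)"
    unfolding s_def by (rule integral_cong_AE) (use H_diag[OF assms] H_measurable[OF assms assms] in auto)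
  then show ?thesis by simp
qed

lemma s_nonneg: "0 \<le> s k i"
  unfolding s_def by (intro integral_nonneg_AE) auto

lemma s_le: "k < N \<Longrightarrow> i < N \<Longrightarrow> s k i \<le> moment_seq 2 / real N"
  using H_moment_bound[of k i 2] unfolding moment_seq_def by (simp add: s_eq)

lemma s_cumulant:
  assumes "k < N" "i < N" "k \<noteq> i"
  shows "s k i = (if same_community K V k i then \<kappa>s 2 else \<kappa>d 2)"
  using H_cumulants[of k i 2] second_cumulant[OF prob_space_axioms H_mean, of k i] assms by (simp add: s_eq)

text \<open>The variances of a row sum to 1, so one of them is at least \<open>1 / N\<close>. Off
  the diagonal they take only two values, which are comparable up to the factor
  \<open>L\<close>.\<close>

lemma s_ge:
  assumes K: "1 \<le> K" and L: "1 \<le> L" and ki: "k < N" "i < N" "k \<noteq> i"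
  shows "1 / (L * real N) \<le> s k i"
proof -
  have Npos: "0 < real N" using ki by simp
  have "\<exists>l<N. 1 / real N \<le> s l i"
  proof (rule ccontr)
    assume "\<not> ?thesis"
    then have "(\<Sum>l<N. s l i) < (\<Sum>l<N. 1 / real N)" using ki by (intro sum_strict_mono) auto
    then show False using s_sum1[OF ki(2)] Npos by simp
  qed
  then obtain l where l: "l < N" "1 / real N \<le> s l i" by blast
  have "l \<noteq> i" using l s_diag0[OF ki(2)] Npos by auto
  have "s l i / L \<le> s k i"
  proof (cases "K = 1")
    \<comment> \<open>\<open>similar_variances\<close> speaks of \<open>2 \<le> K\<close>; for a
      single community all off-diagonal variances coincide.\<close>
    case True
    have "V 0 = {..<N}" using communities True unfolding balanced_partition_def by (auto simp: lessThan_Suc)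
    then have "same_community K V a b" if "a < N" "b < N" for a b
      unfolding same_community_def using True that by auto
    then have "s l i = s k i" using s_cumulant ki l \<open>l \<noteq> i\<close> by simp
    then show ?thesis using L s_nonneg[of k i] by (simp add: field_simps mult_le_cancel_right1)
  next
    case False
    then have v: "\<kappa>d 2 \<le> L * \<kappa>s 2" "\<kappa>s 2 \<le> L * \<kappa>d 2"
      using similar_variances K L by (auto simp: field_simps)
    have same: "x \<le> L * x" if "0 \<le> x" for x using that L by (simp add: mult_le_cancel_right1)
    have "s l i \<le> L * s k i"
      using v same[OF s_nonneg[of l i]] s_cumulant[OF ki] s_cumulant[OF l(1) ki(2) \<open>l \<noteq> i\<close>]
      by (auto split: if_splits)
    then show ?thesis using L by (simp add: field_simps)
  qed
  moreover have "1 / (L * real N) = 1 / real N / L" by simp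
  moreover have "1 / real N / L \<le> s l i / L" using l L by (intro divide_right_mono) auto
  ultimately show ?thesis by linarith
qed

lemma pairs_indep: "indep_vars (\<lambda>_. borel) (\<lambda>p \<omega>. H \<omega> $$ p) {(i, j). i < j \<and> j < N}"
proof -
  have "(\<lambda>(i, j) \<omega>. H \<omega> $$ (i, j)) = (\<lambda>p \<omega>. H \<omega> $$ p)" by (auto simp: fun_eq_iff)
  then show ?thesis using H_indep by simp
qed

lemma row_sparse_family:
  assumes i: "i < N" and q1: "1 \<le> q"
  shows "sparse_family M ({..<N} - {i}) (\<lambda>k \<omega>. H \<omega> $$ (min k i, max k i)) N q moment_seq"
proof
  show "finite ({..<N} - {i})" "card ({..<N} - {i}) \<le> N" "1 \<le> N" "1 \<le> q" using i q1 by auto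
  have "q\<^sup>2 \<le> (real N powr (1 / 2))\<^sup>2" using sparsity q1 by (intro power_mono) auto
  also have "\<dots> = real N" using i by (simp add: powr_half_sqrt)
  finally show "q\<^sup>2 \<le> real N" .
  show "0 \<le> moment_seq j" for j unfolding moment_seq_def by simp
  have inj: "inj_on (\<lambda>k. (min k i, max k i)) ({..<N} - {i})"
    by (auto simp: inj_on_def min_def max_def split: if_splits)
  have "(\<lambda>k. (min k i, max k i)) ` ({..<N} - {i}) \<subseteq> {(i, j). i < j \<and> j < N}" using i by auto
  then show "indep_vars (\<lambda>_. borel) (\<lambda>k \<omega>. H \<omega> $$ (min k i, max k i)) ({..<N} - {i})"
    by (rule indep_vars_reindex[OF pairs_indep inj])
  fix k assume "k \<in> {..<N} - {i}"
  then have k: "min k i < N" "max k i < N" using i by auto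
  show "all_moments M (\<lambda>\<omega>. H \<omega> $$ (min k i, max k i))" by (rule entry_all_moments[OF k])
  show "expectation (\<lambda>\<omega>. H \<omega> $$ (min k i, max k i)) = 0" by (rule H_mean[OF k])
  show "expectation (\<lambda>\<omega>. \<bar>H \<omega> $$ (min k i, max k i)\<bar> ^ j) \<le> moment_seq j / (real N * q ^ (j - 2))" if "2 \<le> j" for j
    using H_moment_bound[OF k that] unfolding moment_seq_def .
qed

lemma row_minor_indep:
  "indep_var (PiM (row_pairs N i) (\<lambda>_. borel)) (\<lambda>\<omega>. restrict (\<lambda>p. H \<omega> $$ p) (row_pairs N i))
     (PiM (minor_pairs N i) (\<lambda>_. borel)) (\<lambda>\<omega>. restrict (\<lambda>p. H \<omega> $$ p) (minor_pairs N i))"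
  by (rule indep_var_restrict[OF pairs_indep]) (auto simp: row_pairs_def minor_pairs_def)

lemma glue_W:
  "glue N i (restrict (\<lambda>p. H \<omega> $$ p) (row_pairs N i)) (restrict (\<lambda>p. H \<omega> $$ p) (minor_pairs N i)) = W \<omega>"
  unfolding glue_def W_def by (rule sym_mat_cong) (auto simp: row_pairs_def minor_pairs_def)

text \<open>The constants exported from \<open>sparse_family\<close> are functions of the moment
  sequence alone, so this one depends on \<open>C\<close>, \<open>c\<close> and \<open>p\<close> but
  not on \<open>N\<close>.\<close>

definition tail_const :: "nat \<Rightarrow> real" where
  "tail_const p = 2 * rosenthal_const moment_seq p +
     2 * (rosenthal_const (sparse_family.diag_const moment_seq) p +
          rosenthal_const moment_seq p * exp (4 * sparse_family.quad_gronwall moment_seq p))"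

lemma moment_seq_nonneg: "0 \<le> moment_seq j" unfolding moment_seq_def by simp

context
  fixes z :: complex and R :: real and p :: nat
  assumes z: "Im z > 0" and q1: "1 \<le> q" and R: "0 < R" and p: "even p" "2 \<le> p" and N2: "2 \<le> N"
begin

lemma tail_parts:
  assumes "i < N"
  shows "2 * rosenthal_const moment_seq p / R ^ p \<le> tail_const p / R ^ p"
    "2 * (rosenthal_const (sparse_family.diag_const moment_seq) p +
          rosenthal_const moment_seq p * exp (4 * sparse_family.quad_gronwall moment_seq p)) / R ^ p \<le> tail_const p / R ^ p"
    "0 \<le> tail_const p / R ^ p"
proof -
  interpret sparse_family M "{..<N} - {i}" "\<lambda>k \<omega>. H \<omega> $$ (min k i, max k i)" N q moment_seq
    by (rule row_sparse_family[OF assms q1])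
  have "0 \<le> rosenthal_const moment_seq p" "0 \<le> rosenthal_const diag_const p"
    by (intro rosenthal_const_nonneg moment_seq_nonneg diag_const_nonneg)+
  then have nn: "0 \<le> 2 * rosenthal_const moment_seq p"
    "0 \<le> 2 * (rosenthal_const diag_const p + rosenthal_const moment_seq p * exp (4 * quad_gronwall p))" by auto
  show "2 * rosenthal_const moment_seq p / R ^ p \<le> tail_const p / R ^ p"
    "2 * (rosenthal_const diag_const p + rosenthal_const moment_seq p * exp (4 * quad_gronwall p)) / R ^ p \<le> tail_const p / R ^ p"
    "0 \<le> tail_const p / R ^ p"
    unfolding tail_const_def using nn R by (auto intro!: divide_right_mono divide_nonneg_nonneg)
qed

lemma ex_other: "i < N \<Longrightarrow> \<exists>k. k \<in> {..<N} - {i}"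
  using N2 by (intro exI[of _ "if i = 0 then 1 else 0"]) auto

lemma minor_max_nonneg: "i < N \<Longrightarrow> 0 \<le> minor_max N A z i"
  using ex_other[of i] minor_max_ge[of _ N i _ A z] by (meson norm_ge_zero order_trans)

text \<open>Conditioning on the minor: for frozen \<open>y\<close> the coefficients are
  deterministic, and \<open>linear_tail\<close> applies to the row with \<open>A\<close> the actual
  value of \<open>minor_max\<close>.\<close>

lemma row_linear_prob:
  assumes ij: "i < N" "j < N" "j \<noteq> i"
  shows "prob {\<omega> \<in> space M. \<not> row_linear_good N q R (W \<omega>) z i j} \<le> tail_const p / R ^ p"
proof -
  interpret sparse_family M "{..<N} - {i}" "\<lambda>k \<omega>. H \<omega> $$ (min k i, max k i)" N q moment_seq
    by (rule row_sparse_family[OF ij(1) q1])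
  let ?S = "PiM (row_pairs N i) (\<lambda>_. borel :: real measure)" and ?T = "PiM (minor_pairs N i) (\<lambda>_. borel :: real measure)"
  have "prob {\<omega> \<in> space M. \<not> row_linear_good N q R (glue N i (restrict (\<lambda>p. H \<omega> $$ p) (row_pairs N i))
      (restrict (\<lambda>p. H \<omega> $$ p) (minor_pairs N i))) z i j} \<le> tail_const p / R ^ p"
  proof (rule indep_var_prob_le[OF row_minor_indep])
    have "{x \<in> space (?S \<Otimes>\<^sub>M ?T). row_linear_good N q R (glue N i (fst x) (snd x)) z i j} \<in> sets (?S \<Otimes>\<^sub>M ?T)"
      by (rule measurable_row_linear_good) (use glue_resolvent glue_measurable z ij in auto)
    then show "{x \<in> space (?S \<Otimes>\<^sub>M ?T). \<not> row_linear_good N q R (glue N i (fst x) (snd x)) z i j} \<in> sets (?S \<Otimes>\<^sub>M ?T)"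
      by (rule sets.sets_Collect_neg)
    fix y
    define a where "a k = resolvent (del_index i (sym_mat N y)) z $$ (j, k)" for k
    define A where "A = minor_max N (sym_mat N y) z i"
    have mm: "minor_max N (glue N i x y) z i = A" for x unfolding A_def minor_max_def glue_del_index ..
    have row: "(\<Sum>k\<in>{..<N}-{i}. a k * of_real (glue N i (restrict (\<lambda>p. H \<omega> $$ p) (row_pairs N i)) y $$ (k, i)))
        = (\<Sum>k\<in>{..<N}-{i}. a k * of_real (H \<omega> $$ (min k i, max k i)))" for \<omega>
      by (intro sum.cong refl) (use ij row_pairsI[of i N] in \<open>auto simp: glue_row\<close>)
    let ?\<Psi> = "A / q + sqrt ((\<Sum>k\<in>{..<N}-{i}. (cmod (a k))\<^sup>2) / real N)"
    have A0: "0 \<le> A" unfolding A_def by (rule minor_max_nonneg) fact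
    have s0: "0 \<le> (\<Sum>k\<in>{..<N}-{i}. (cmod (a k))\<^sup>2) / real N" by (auto intro!: sum_nonneg divide_nonneg_nonneg)
    have "prob {\<omega> \<in> space M. cmod (\<Sum>k\<in>{..<N}-{i}. a k * of_real (H \<omega> $$ (min k i, max k i))) > 2 * (R * ?\<Psi>)}
        \<le> 2 * rosenthal_const moment_seq p / R ^ p"
    proof (rule linear_tail[OF A0 _ _ _ p R])
      show "cmod (a k) \<le> A" if "k \<in> {..<N} - {i}" for k
        unfolding a_def A_def using that ij by (intro minor_max_ge) auto
      show "A / q \<le> ?\<Psi>" using s0 by simp
      have "(\<Sum>k\<in>{..<N}-{i}. (cmod (a k))\<^sup>2) / real N = (sqrt ((\<Sum>k\<in>{..<N}-{i}. (cmod (a k))\<^sup>2) / real N))\<^sup>2"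
        using s0 by simp
      also have "\<dots> \<le> ?\<Psi>\<^sup>2" using A0 q1 s0 by (intro power_mono) auto
      finally show "(\<Sum>k\<in>{..<N}-{i}. (cmod (a k))\<^sup>2) / real N \<le> ?\<Psi>\<^sup>2" .
    qed
    also have "\<dots> \<le> tail_const p / R ^ p" by (rule tail_parts[OF ij(1)])
    finally show "prob {\<omega> \<in> space M. \<not> row_linear_good N q R (glue N i (restrict (\<lambda>p. H \<omega> $$ p) (row_pairs N i)) y) z i j}
        \<le> tail_const p / R ^ p"
      unfolding row_linear_good_def mm glue_del_index a_def[symmetric] row by (simp add: not_le)
  qed (rule tail_parts[OF ij(1)])
  then show ?thesis unfolding glue_W .
qed

lemma row_quad_prob:
  assumes i: "i < N"
  shows "prob {\<omega> \<in> space M. \<not> row_quad_good N q R s (W \<omega>) z i} \<le> tail_const p / R ^ p"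
proof -
  interpret sparse_family M "{..<N} - {i}" "\<lambda>k \<omega>. H \<omega> $$ (min k i, max k i)" N q moment_seq
    by (rule row_sparse_family[OF i q1])
  let ?S = "PiM (row_pairs N i) (\<lambda>_. borel :: real measure)" and ?T = "PiM (minor_pairs N i) (\<lambda>_. borel :: real measure)"
  have "prob {\<omega> \<in> space M. \<not> row_quad_good N q R s (glue N i (restrict (\<lambda>p. H \<omega> $$ p) (row_pairs N i))
      (restrict (\<lambda>p. H \<omega> $$ p) (minor_pairs N i))) z i} \<le> tail_const p / R ^ p"
  proof (rule indep_var_prob_le[OF row_minor_indep])
    have "{x \<in> space (?S \<Otimes>\<^sub>M ?T). row_quad_good N q R s (glue N i (fst x) (snd x)) z i} \<in> sets (?S \<Otimes>\<^sub>M ?T)"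
      by (rule measurable_row_quad_good) (use glue_resolvent glue_measurable z i in auto)
    then show "{x \<in> space (?S \<Otimes>\<^sub>M ?T). \<not> row_quad_good N q R s (glue N i (fst x) (snd x)) z i} \<in> sets (?S \<Otimes>\<^sub>M ?T)"
      by (rule sets.sets_Collect_neg)
    fix y
    define a where "a k l = resolvent (del_index i (sym_mat N y)) z $$ (k, l)" for k l
    define A where "A = minor_max N (sym_mat N y) z i"
    have mm: "minor_max N (glue N i x y) z i = A" for x unfolding A_def minor_max_def glue_del_index ..
    have row: "(\<Sum>k\<in>{..<N}-{i}. \<Sum>l\<in>{..<N}-{i}.
          of_real (glue N i (restrict (\<lambda>p. H \<omega> $$ p) (row_pairs N i)) y $$ (k, i)) * a k l *
          of_real (glue N i (restrict (\<lambda>p. H \<omega> $$ p) (row_pairs N i)) y $$ (l, i)))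
        = (\<Sum>k\<in>{..<N}-{i}. \<Sum>l\<in>{..<N}-{i}. of_real (H \<omega> $$ (min k i, max k i)) * a k l * of_real (H \<omega> $$ (min l i, max l i)))" for \<omega>
      by (intro sum.cong refl) (use i row_pairsI[of i N] in \<open>auto simp: glue_row\<close>)
    let ?Q = "(\<Sum>k\<in>{..<N}-{i}. \<Sum>l\<in>{..<N}-{i}. (cmod (a k l))\<^sup>2) / (real N)\<^sup>2"
    let ?\<Psi> = "A / q + sqrt ?Q"
    have A0: "0 \<le> A" unfolding A_def by (rule minor_max_nonneg) fact
    have s0: "0 \<le> ?Q" by (auto intro!: sum_nonneg divide_nonneg_nonneg)
    have "prob {\<omega> \<in> space M. cmod ((\<Sum>k\<in>{..<N}-{i}. \<Sum>l\<in>{..<N}-{i}.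
          of_real (H \<omega> $$ (min k i, max k i)) * a k l * of_real (H \<omega> $$ (min l i, max l i)))
        - (\<Sum>k\<in>{..<N}-{i}. of_real (expectation (\<lambda>\<omega>. (H \<omega> $$ (min k i, max k i))\<^sup>2)) * a k k)) > 4 * (R * ?\<Psi>)}
        \<le> 2 * (rosenthal_const diag_const p + rosenthal_const moment_seq p * exp (4 * quad_gronwall p)) / R ^ p"
    proof (rule quad_tail[OF _ A0 _ _ _ p R])
      interpret d: sym_resolvent N "del_index i (sym_mat N y)" z
        by (rule sym_resolvent_del_index) (rule sym_mat_resolvent, use z in simp)
      show "a k l = a l k" if "k \<in> {..<N} - {i}" "l \<in> {..<N} - {i}" for k l
        unfolding a_def using that by (intro d.resolvent_sym) auto
      show "cmod (a k l) \<le> A" if "k \<in> {..<N} - {i}" "l \<in> {..<N} - {i}" for k l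
        unfolding a_def A_def using that i by (intro minor_max_ge) auto
      show "A / q \<le> ?\<Psi>" using s0 by simp
      have "?Q = (sqrt ?Q)\<^sup>2" using s0 by simp
      also have "\<dots> \<le> ?\<Psi>\<^sup>2" using A0 q1 s0 by (intro power_mono) auto
      finally show "?Q \<le> ?\<Psi>\<^sup>2" .
    qed
    also have "\<dots> \<le> tail_const p / R ^ p" by (rule tail_parts[OF i])
    finally show "prob {\<omega> \<in> space M. \<not> row_quad_good N q R s (glue N i (restrict (\<lambda>p. H \<omega> $$ p) (row_pairs N i)) y) z i}
        \<le> tail_const p / R ^ p"
      unfolding row_quad_good_def mm glue_del_index a_def[symmetric] row s_def by (simp add: not_le)
  qed (rule tail_parts[OF i])
  then show ?thesis unfolding glue_W .
qed

lemma W_resolvent: "sym_resolvent N (W \<omega>) z"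
  unfolding W_def by (rule sym_mat_resolvent) (use z in simp)

lemma W_measurable: "a < N \<Longrightarrow> b < N \<Longrightarrow> (\<lambda>\<omega>. W \<omega> $$ (a, b)) \<in> borel_measurable M"
  unfolding W_def using H_measurable[of "min a b" "max a b"] by (cases "a = b") (simp_all add: sym_mat_index)

lemma rows_good_prob:
  "{\<omega> \<in> space M. \<not> rows_good N q R s (W \<omega>) z} \<in> events"
  "prob {\<omega> \<in> space M. \<not> rows_good N q R s (W \<omega>) z} \<le> 2 * (real N)\<^sup>2 * (tail_const p / R ^ p)"
proof -
  let ?Q = "\<lambda>i. {\<omega> \<in> space M. \<not> row_quad_good N q R s (W \<omega>) z i}"
  let ?L = "\<lambda>(i, j). {\<omega> \<in> space M. \<not> row_linear_good N q R (W \<omega>) z i j}"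
  let ?I = "{(i, j). i < N \<and> j < N \<and> j \<noteq> i}"
  let ?b = "tail_const p / R ^ p"
  have b0: "0 \<le> ?b" using tail_parts(3)[of 0] N2 by simp
  have fin: "finite ?I" and cI: "card ?I \<le> N * N"
  proof -
    have "?I \<subseteq> {..<N} \<times> {..<N}" by auto
    then show "finite ?I" "card ?I \<le> N * N"
      using finite_subset[of ?I "{..<N} \<times> {..<N}"] card_mono[of "{..<N} \<times> {..<N}" ?I] by auto
  qed
  have Qm: "?Q i \<in> events" if "i < N" for i
    by (intro sets.sets_Collect_neg measurable_row_quad_good) (use that W_resolvent W_measurable in auto)
  have Lm: "?L p \<in> events" if "p \<in> ?I" for p
    using that by (auto intro!: sets.sets_Collect_neg measurable_row_linear_good W_resolvent W_measurable)
  have eq: "{\<omega> \<in> space M. \<not> rows_good N q R s (W \<omega>) z} = (\<Union>i<N. ?Q i) \<union> (\<Union>p\<in>?I. ?L p)"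
    unfolding rows_good_def by auto
  show "{\<omega> \<in> space M. \<not> rows_good N q R s (W \<omega>) z} \<in> events"
    unfolding eq using Qm Lm fin by (intro sets.Un sets.finite_UN) auto
  have "prob ((\<Union>i<N. ?Q i) \<union> (\<Union>p\<in>?I. ?L p)) \<le> prob (\<Union>i<N. ?Q i) + prob (\<Union>p\<in>?I. ?L p)"
    using Qm Lm fin by (intro measure_Un_le sets.finite_UN) auto
  also have "\<dots> \<le> (\<Sum>i<N. prob (?Q i)) + (\<Sum>p\<in>?I. prob (?L p))"
    using Qm Lm fin by (intro add_mono measure_UNION_le) auto
  also have "\<dots> \<le> (\<Sum>i<N. ?b) + (\<Sum>p\<in>?I. ?b)"
    by (intro add_mono sum_mono) (auto intro: row_quad_prob row_linear_prob)
  also have "\<dots> = (real N + real (card ?I)) * ?b" by (simp add: algebra_simps)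
  also have "\<dots> \<le> (2 * (real N)\<^sup>2) * ?b"
  proof (rule mult_right_mono[OF _ b0])
    have "real (card ?I) \<le> real (N * N)" using cI by (simp only: of_nat_le_iff)
    moreover have "real N \<le> real N * real N" using N2 by simp
    ultimately show "real N + real (card ?I) \<le> 2 * (real N)\<^sup>2" by (simp add: power2_eq_square)
  qed
  finally show "prob {\<omega> \<in> space M. \<not> rows_good N q R s (W \<omega>) z} \<le> 2 * (real N)\<^sup>2 * ?b" unfolding eq .
qed

end

end

section \<open>The local law\<close>

lemma (in balanced_sparse_matrix) W_eq_H:
  assumes w: "\<omega> \<in> space M" and d: "\<And>i. i < N \<Longrightarrow> H \<omega> $$ (i, i) = 0"
  shows "W \<omega> = H \<omega>"
proof (rule eq_matI)
  have c: "H \<omega> \<in> carrier_mat N N" by (rule H_dim[OF w])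
  fix a b assume "a < dim_row (H \<omega>)" "b < dim_col (H \<omega>)"
  then have ab: "a < N" "b < N" using c by auto
  show "W \<omega> $$ (a, b) = H \<omega> $$ (a, b)"
    using H_symmetric[OF w ab] d ab unfolding W_def by (auto simp: sym_mat_index min_def max_def)
qed (use H_dim[OF w] in \<open>auto simp: W_def sym_mat_def\<close>)

definition sc_close :: "nat \<Rightarrow> real \<Rightarrow> real \<Rightarrow> real \<Rightarrow> real mat \<Rightarrow> complex \<Rightarrow> bool" where
  "sc_close N a b d A z \<longleftrightarrow>
     (\<forall>i<N. \<forall>k<N. k \<noteq> i \<longrightarrow> cmod (resolvent A z $$ (k, i)) \<le> a) \<and>
     (\<forall>i<N. cmod (resolvent A z $$ (i, i) - m_emp N A z) \<le> b) \<and>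
     cmod (m_emp N A z - m_sc z) \<le> d"

lemma sc_close_mono: "sc_close N a b d A z \<Longrightarrow> a \<le> a' \<Longrightarrow> b \<le> b' \<Longrightarrow> d \<le> d' \<Longrightarrow> sc_close N a' b' d' A z"
  unfolding sc_close_def by fastforce

text \<open>Union bound over the \<open>3 * N ^ 4 + 1\<close> grid points above \<open>z\<close>.
  The null set where some diagonal entry is nonzero joins the exceptional event, so that
  \<open>W\<close> and \<open>H\<close> agree outside it.\<close>

lemma (in balanced_sparse_matrix) local_law_event:
  assumes K: "1 \<le> K" and L: "1 \<le> L" and N4: "4 \<le> N" and q1: "1 \<le> q" and R: "1 \<le> R"
    and p: "even p" "2 \<le> p"
    and z: "1 / real N \<le> Im z" "\<bar>Re z\<bar> \<le> 3" "Im z \<le> 3"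
    and small: "2 / (real N)\<^sup>2 + offset_coeff (moment_seq 2) L * (R * psi N q z)
        + 5 * (root_coeff (moment_seq 2) L * R * conv_rate N q z) \<le> apriori_tol L"
      "16 * (R * psi N q z) + 1 / (real N)\<^sup>2 \<le> apriori_tol L"
  shows "\<exists>B\<in>events. prob B \<le> real (3 * N ^ 4 + 1) * (2 * (real N)\<^sup>2 * (tail_const p / R ^ p)) \<and>
    (\<forall>\<omega>\<in>space M - B. sc_close N (16 * (R * psi N q z)) (offset_coeff (moment_seq 2) L * (R * psi N q z))
       (5 * (root_coeff (moment_seq 2) L * R * conv_rate N q z)) (H \<omega>) z)"
proof -
  have Npos: "0 < real N" using N4 by simp
  have "0 < 1 / real N" using Npos by simp
  then have z0: "0 < Im z" using z(1) by linarith
  let ?E = "\<lambda>k. {\<omega> \<in> space M. \<not> rows_good N q R s (W \<omega>) (path N z k)}"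
  let ?D = "\<Union>i<N. {\<omega> \<in> space M. H \<omega> $$ (i, i) \<noteq> 0}"
  let ?B = "(\<Union>k\<le>3 * N ^ 4. ?E k) \<union> ?D"
  have Im_path: "0 < Im (path N z k)" for k using z0 by (simp add: add_pos_nonneg)
  have R0: "0 < R" and N2: "2 \<le> N" using R N4 by auto
  note rg = rows_good_prob[OF Im_path q1 R0 p N2]
  have Em: "?E k \<in> events" for k by (rule rg(1))
  have Dm: "{\<omega> \<in> space M. H \<omega> $$ (i, i) \<noteq> 0} \<in> events" if "i < N" for i
    using H_measurable[OF that that] by measurable
  have D0: "prob {\<omega> \<in> space M. H \<omega> $$ (i, i) \<noteq> 0} = 0" if "i < N" for i
    using H_diag[OF that] Dm[OF that] by (subst prob_Collect_eq_0) auto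
  show ?thesis
  proof (intro bexI conjI ballI)
    show "?B \<in> events" using Em Dm by (intro sets.Un sets.finite_UN) auto
    have "prob ?B \<le> prob (\<Union>k\<le>3 * N ^ 4. ?E k) + prob ?D"
      using Em Dm by (intro measure_Un_le sets.finite_UN) auto
    also have "\<dots> \<le> (\<Sum>k\<le>3 * N ^ 4. prob (?E k)) + (\<Sum>i<N. prob {\<omega> \<in> space M. H \<omega> $$ (i, i) \<noteq> 0})"
      using Em Dm by (intro add_mono measure_UNION_le) auto
    also have "(\<Sum>i<N. prob {\<omega> \<in> space M. H \<omega> $$ (i, i) \<noteq> 0}) = 0" by (simp add: D0)
    also have "(\<Sum>k\<le>3 * N ^ 4. prob (?E k)) \<le> (\<Sum>k\<le>3 * N ^ 4. 2 * (real N)\<^sup>2 * (tail_const p / R ^ p))"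
      by (intro sum_mono rg(2))
    finally show "prob ?B \<le> real (3 * N ^ 4 + 1) * (2 * (real N)\<^sup>2 * (tail_const p / R ^ p))" by simp
    fix \<omega> assume w: "\<omega> \<in> space M - ?B"
    then have WH: "W \<omega> = H \<omega>" by (intro W_eq_H) auto
    interpret sparse_instance N "W \<omega>" s q R "moment_seq 2" L
    proof
      show "W \<omega> \<in> carrier_mat N N" unfolding W_def by (rule sym_mat_carrier)
      show "W \<omega> $$ (i, j) = W \<omega> $$ (j, i)" if "i < N" "j < N" for i j
        unfolding W_def using that by (rule sym_mat_sym)
      show "W \<omega> $$ (i, i) = 0" if "i < N" for i unfolding W_def using that by (simp add: sym_mat_index)
    qed (use s_sum1 s_diag0 s_ge[OF K L] s_le N4 q1 R L moment_seq_nonneg in auto)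
    have "q \<le> real N powr (1 / 2)" by (rule sparsity)
    also have "\<dots> \<le> real N powr 2" using N4 by (intro powr_mono) auto
    finally have qN: "q \<le> (real N)\<^sup>2" using Npos by (simp add: powr_numeral)
    have good: "rows_good N q R s (W \<omega>) (path N z k)" if "k \<le> 3 * N ^ 4" for k using w that by auto
    note b = bootstrap[OF z good small qN]
    show "sc_close N (16 * (R * psi N q z)) (offset_coeff (moment_seq 2) L * (R * psi N q z))
       (5 * (root_coeff (moment_seq 2) L * R * conv_rate N q z)) (H \<omega>) z"
      using b(2) b(1)[unfolded near_sc_def] unfolding sc_close_def WH by auto
  qed
qed

section \<open>Asymptotics of rates and probabilities\<close>

lemma eventually_le_powr: "0 < a \<Longrightarrow> \<forall>\<^sub>F N in sequentially. x \<le> real N powr a"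
  by real_asymp

lemma eventually_small:
  assumes "0 < t" "0 < \<rho>"
  shows "\<forall>\<^sub>F N in sequentially. u / (real N)\<^sup>2 + x * (2 * real N powr - \<rho>) \<le> t"
proof -
  have "(\<lambda>N. u / (real N)\<^sup>2 + x * (2 * real N powr - \<rho>)) \<longlonglongrightarrow> 0"
  proof -
    have "(\<lambda>N. u / (real N)\<^sup>2) \<longlonglongrightarrow> 0" by real_asymp
    moreover have "(\<lambda>N. real N powr - \<rho>) \<longlonglongrightarrow> 0"
      by (rule tendsto_neg_powr) (use assms(2) filterlim_real_sequentially in auto)
    ultimately have "(\<lambda>N. u / (real N)\<^sup>2 + x * (2 * real N powr - \<rho>)) \<longlonglongrightarrow> 0 + x * (2 * 0)"
      by (intro tendsto_add tendsto_mult tendsto_const)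
    then show ?thesis by simp
  qed
  then have "\<forall>\<^sub>F N in sequentially. u / (real N)\<^sup>2 + x * (2 * real N powr - \<rho>) < t"
    using assms(1) by (rule order_tendstoD)
  then show ?thesis by (rule eventually_mono) simp
qed

text \<open>On the domain \<open>N * Im z\<close> is at least \<open>N powr l\<close>. The worst
  exponents, \<open>\<phi> / 2\<close> from \<open>1 / sqrt q\<close> and \<open>l / 3\<close> from
  the cube root, limit \<open>\<rho>\<close>, and the factor \<open>N powr e\<close> uses up at most
  half of it.\<close>

lemma rate_bounds:
  assumes N: "1 \<le> N" and \<phi>: "0 < \<phi>" and l: "0 < l" and q: "real N powr \<phi> \<le> q"
    and z: "real N powr (- 1 + l) < Im z" and \<rho>: "\<rho> \<le> \<phi> / 2" "\<rho> \<le> l / 3" and e: "0 \<le> e" "e \<le> \<rho> / 2"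
  shows "real N powr e * psi N q z \<le> 2 * real N powr - (\<rho> / 2)"
    "real N powr e * conv_rate N q z \<le> 2 * real N powr - (\<rho> / 2)"
proof -
  have x: "1 \<le> real N" using N by simp
  then have x0: "0 < real N" by simp
  have q0: "0 < q" using q x0 less_le_trans[of 0 "real N powr \<phi>" q] by simp
  have NIm: "real N powr l \<le> real N * Im z"
  proof -
    have "real N powr l = real N powr 1 * real N powr (- 1 + l)" unfolding powr_add[symmetric] by simp
    also have "\<dots> \<le> real N * Im z" using z x0 by simp
    finally show ?thesis .
  qed
  then have NIm0: "0 < real N * Im z" using x0 less_le_trans[of 0 "real N powr l" "real N * Im z"] by simp
  have inv: "1 / u \<le> real N powr - \<rho>" if "real N powr b \<le> u" "\<rho> \<le> b" for u b
  proof -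
    have "0 < real N powr b" "0 < u" using that x0 less_le_trans[of 0 "real N powr b" u] by auto
    then have "1 / u \<le> 1 / real N powr b" using that by (intro divide_left_mono mult_pos_pos) auto
    also have "\<dots> = real N powr - b" by (simp add: powr_minus_divide)
    also have "\<dots> \<le> real N powr - \<rho>" using that x by (intro powr_mono) auto
    finally show ?thesis .
  qed
  have sq: "real N powr (b / 2) \<le> sqrt u" if "real N powr b \<le> u" for u b
  proof -
    have "real N powr (b / 2) = sqrt (real N powr b)"
      using x0 by (simp add: powr_half_sqrt[symmetric] powr_powr)
    then show ?thesis using that by simp
  qed
  have cb: "real N powr (l / 3) \<le> (real N * Im z) powr (1 / 3)"
  proof -
    have "real N powr (l / 3) = (real N powr l) powr (1 / 3)" by (simp add: powr_powr)
    also have "\<dots> \<le> (real N * Im z) powr (1 / 3)" using NIm by (intro powr_mono2) auto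
    finally show ?thesis .
  qed
  have fin: "real N powr e * (2 * real N powr - \<rho>) \<le> 2 * real N powr - (\<rho> / 2)"
  proof -
    have "real N powr e * (2 * real N powr - \<rho>) = 2 * real N powr (e - \<rho>)"
      using x0 by (simp add: powr_diff powr_minus_divide)
    also have "\<dots> \<le> 2 * real N powr - (\<rho> / 2)" using e x by (intro mult_left_mono powr_mono) auto
    finally show ?thesis .
  qed
  have "psi N q z \<le> real N powr - \<rho> + real N powr - \<rho>"
    unfolding psi_def using \<rho> \<phi> l by (intro add_mono inv[OF q] inv[OF sq[OF NIm]]) auto
  then have "real N powr e * psi N q z \<le> real N powr e * (2 * real N powr - \<rho>)" by (intro mult_left_mono) auto
  with fin show "real N powr e * psi N q z \<le> 2 * real N powr - (\<rho> / 2)" by linarith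
  have "conv_rate N q z \<le> real N powr - \<rho> + real N powr - \<rho>"
    unfolding conv_rate_def using \<rho> by (intro add_mono inv[OF sq[OF q]] inv[OF cb]) auto
  then have "real N powr e * conv_rate N q z \<le> real N powr e * (2 * real N powr - \<rho>)" by (intro mult_left_mono) auto
  with fin show "real N powr e * conv_rate N q z \<le> 2 * real N powr - (\<rho> / 2)" by linarith
qed

text \<open>The number of events is at most \<open>8 * N ^ 6\<close>, and
  \<open>8 * \<bar>T\<bar>\<close> is at most \<open>N powr 2\<close>; together they account for the
  8 in \<open>D + 8\<close>.\<close>

lemma union_bound_decay:
  assumes N: "1 \<le> N" and T: "8 * \<bar>T\<bar> \<le> real N powr 2" and e: "D + 8 \<le> e * real p"
  shows "real (3 * N ^ 4 + 1) * (2 * (real N)\<^sup>2 * (T / (real N powr e) ^ p)) \<le> real N powr - D"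
proof -
  have x: "1 \<le> real N" using N by simp
  then have x0: "0 < real N" by simp
  have Rp: "(real N powr e) ^ p = real N powr (e * real p)"
    using x0 by (simp add: powr_realpow[symmetric] powr_powr)
  have "T / (real N powr e) ^ p \<le> \<bar>T\<bar> / real N powr (D + 8)"
    unfolding Rp using x e by (intro frac_le powr_mono) auto
  then have "real (3 * N ^ 4 + 1) * (2 * (real N)\<^sup>2 * (T / (real N powr e) ^ p))
      \<le> real (3 * N ^ 4 + 1) * (2 * (real N)\<^sup>2 * (\<bar>T\<bar> / real N powr (D + 8)))"
    by (intro mult_left_mono) auto
  also have "\<dots> \<le> (4 * real N ^ 4) * (2 * (real N)\<^sup>2 * (\<bar>T\<bar> / real N powr (D + 8)))"
    using x by (intro mult_right_mono) auto
  also have "\<dots> = (8 * \<bar>T\<bar>) * real N ^ 6 / real N powr (D + 8)" by (simp add: power2_eq_square eval_nat_numeral)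
  also have "\<dots> \<le> real N powr 2 * real N ^ 6 / real N powr (D + 8)"
    using T by (intro divide_right_mono mult_right_mono) auto
  also have "real N ^ 6 = real N powr 6" using x0 by (simp add: powr_numeral)
  also have "real N powr 2 * real N powr 6 / real N powr (D + 8) = real N powr (2 + 6 - (D + 8))"
    unfolding powr_add powr_diff ..
  finally show ?thesis by simp
qed

lemma local_law_eventually:
  fixes K :: nat and \<phi> C c L :: real
    and M :: "nat \<Rightarrow> 'w measure"
    and H :: "nat \<Rightarrow> 'w \<Rightarrow> real mat"
  assumes K: "K \<ge> 1" and \<phi>: "\<phi> > 0" and L: "L \<ge> 1"
    and model: "\<forall>\<^sub>F N in sequentially. K dvd N \<longrightarrow>
      balanced_sparse_matrix (M N) N K (V N) (H N) \<phi> (q N) C c L (\<kappa>s N) (\<kappa>d N)"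
    and l: "0 < l" "l < 1" and \<epsilon>: "0 < \<epsilon>" and D: "0 < D"
  shows "\<forall>\<^sub>F N in sequentially. K dvd N \<longrightarrow> (\<forall>z\<in>spectral_domain l N.
    \<exists>B\<in>sets (M N). measure (M N) B \<le> real N powr - D \<and>
    (\<forall>\<omega>\<in>space (M N) - B. sc_close N (real N powr \<epsilon> * psi N (q N) z) (real N powr \<epsilon> * psi N (q N) z)
       (real N powr \<epsilon> * conv_rate N (q N) z) (H N \<omega>) z))"
proof -
  define \<rho> where "\<rho> = min (\<phi> / 2) (l / 3)"
  \<comment> \<open>Half of \<open>\<epsilon>\<close> pays for \<open>R = N powr e\<close>, the
    other half for the numerical constants; staying below \<open>\<rho> / 2\<close> keeps the errors
    decaying.\<close>
  define e where "e = min (\<epsilon> / 2) (\<rho> / 2)"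
  \<comment> \<open>Large enough for \<open>R ^ p\<close> to reach \<open>N powr (D + 8)\<close>,
    and doubled because the tail bounds use even powers.\<close>
  define p where "p = 2 * nat \<lceil>(D + 8) / e\<rceil>"
  define C0 where "C0 = (C * real 2) powr (c * real 2)"
  define T where "T = balanced_sparse_matrix.tail_const C c p"
  let ?o = "offset_coeff C0 L" and ?r = "root_coeff C0 L"
  have \<rho>: "0 < \<rho>" "\<rho> \<le> \<phi> / 2" "\<rho> \<le> l / 3" unfolding \<rho>_def using \<phi> l by auto
  have e: "0 < e" "e \<le> \<rho> / 2" "e \<le> \<epsilon> / 2" unfolding e_def using \<epsilon> \<rho> by auto
  have pe: "D + 8 \<le> e * real p" and p: "even p" "2 \<le> p"
  proof -
    have pos: "0 < (D + 8) / e" using D e by simp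
    have "(D + 8) / e \<le> real (nat \<lceil>(D + 8) / e\<rceil>)" by (rule real_nat_ceiling_ge)
    also have "\<dots> \<le> real p" unfolding p_def by simp
    finally show "D + 8 \<le> e * real p" using e by (simp add: field_simps)
    show "even p" unfolding p_def by simp
    have "1 \<le> nat \<lceil>(D + 8) / e\<rceil>" using pos by (simp add: Suc_leI)
    then show "2 \<le> p" unfolding p_def by simp
  qed
  have C0: "0 \<le> C0" unfolding C0_def by simp
  have coeff: "0 \<le> ?o" "0 \<le> ?r" unfolding offset_coeff_def root_coeff_def err_coeff_def using C0 L by auto
  have tol: "0 < apriori_tol L" unfolding apriori_tol_def using L by simp
  have ev4: "\<forall>\<^sub>F N in sequentially. max 16 (max ?o (5 * ?r)) \<le> real N powr (\<epsilon> / 2)"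
    using \<epsilon> by (intro eventually_le_powr) simp
  have ev5: "\<forall>\<^sub>F N in sequentially. 2 / (real N)\<^sup>2 + (?o + 5 * ?r) * (2 * real N powr - (\<rho> / 2)) \<le> apriori_tol L"
    and ev6: "\<forall>\<^sub>F N in sequentially. 1 / (real N)\<^sup>2 + 16 * (2 * real N powr - (\<rho> / 2)) \<le> apriori_tol L"
    using \<rho> by (intro eventually_small tol; simp)+
  have ev3: "\<forall>\<^sub>F N in sequentially. 8 * \<bar>T\<bar> \<le> real N powr 2" by (rule eventually_le_powr) simp
  show ?thesis
    using model eventually_ge_at_top[of 4] ev3 ev4 ev5 ev6
  proof eventually_elim
    case (elim N)
    show ?case
    proof (intro impI ballI)
      assume "K dvd N"
      then interpret balanced_sparse_matrix "M N" N K "V N" "H N" \<phi> "q N" C c L "\<kappa>s N" "\<kappa>d N"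
        using elim(1) by simp
      fix z assume "z \<in> spectral_domain l N"
      then have z: "0 < Im z" "\<bar>Re z\<bar> < 3" "real N powr (- 1 + l) < Im z" "Im z \<le> 3"
        unfolding spectral_domain_def by auto
      have N1: "1 \<le> N" and x: "1 \<le> real N" using elim(2) by auto
      have ms: "moment_seq 2 = C0" unfolding moment_seq_def C0_def ..
      define R where "R = real N powr e"
      have R1: "1 \<le> R" unfolding R_def using x e by (simp add: ge_one_powr_ge_zero)
      have "1 \<le> real N powr \<phi>" using x \<phi> by (simp add: ge_one_powr_ge_zero)
      then have q1: "1 \<le> q N" using sparsity by linarith
      have "1 / real N = real N powr (- 1)" by (simp add: powr_minus_divide)
      also have "\<dots> \<le> real N powr (- 1 + l)" using x l by (intro powr_mono) auto
      finally have z1: "1 / real N \<le> Im z" using z by linarith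
      note rb = rate_bounds[OF N1 \<phi> l(1) sparsity(1) z(3) \<rho>(2,3) less_imp_le[OF e(1)] e(2), folded R_def]
      have psi0: "0 \<le> psi N (q N) z" "0 \<le> conv_rate N (q N) z"
        unfolding psi_def conv_rate_def using q1 z by auto
      have small1: "2 / (real N)\<^sup>2 + ?o * (R * psi N (q N) z) + 5 * (?r * R * conv_rate N (q N) z) \<le> apriori_tol L"
      proof -
        have "?o * (R * psi N (q N) z) \<le> ?o * (2 * real N powr - (\<rho> / 2))"
          using rb coeff by (intro mult_left_mono) auto
        moreover have "?r * (R * conv_rate N (q N) z) \<le> ?r * (2 * real N powr - (\<rho> / 2))"
          using rb coeff by (intro mult_left_mono) auto
        moreover have "(?o + 5 * ?r) * (2 * real N powr - (\<rho> / 2))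
            = ?o * (2 * real N powr - (\<rho> / 2)) + 5 * (?r * (2 * real N powr - (\<rho> / 2)))" by (simp add: algebra_simps)
        ultimately show ?thesis using elim(5) by (simp add: mult.assoc)
      qed
      have small2: "16 * (R * psi N (q N) z) + 1 / (real N)\<^sup>2 \<le> apriori_tol L"
        using rb(1) elim(6) by linarith
      obtain B where B: "B \<in> events" "prob B \<le> real (3 * N ^ 4 + 1) * (2 * (real N)\<^sup>2 * (tail_const p / R ^ p))"
        and good: "\<And>\<omega>. \<omega> \<in> space (M N) - B \<Longrightarrow> sc_close N (16 * (R * psi N (q N) z))
          (?o * (R * psi N (q N) z)) (5 * (?r * R * conv_rate N (q N) z)) (H N \<omega>) z"
        using local_law_event[OF K L elim(2) q1 R1 p z1 less_imp_le[OF z(2)] z(4), unfolded ms, OF small1 small2]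
        by auto
      have "prob B \<le> real N powr - D"
        using B(2) union_bound_decay[OF N1 elim(3) pe] unfolding T_def R_def by linarith
      moreover have absorb: "a * (R * y) \<le> real N powr \<epsilon> * y" if "a \<le> real N powr (\<epsilon> / 2)" "0 \<le> y" for a y
      proof -
        have "a * R \<le> real N powr (\<epsilon> / 2) * real N powr (\<epsilon> / 2)"
          unfolding R_def using that x e by (intro mult_mono powr_mono) auto
        also have "\<dots> = real N powr \<epsilon>" by (simp flip: powr_add)
        finally have "a * R * y \<le> real N powr \<epsilon> * y" using that by (intro mult_right_mono)
        then show ?thesis by (simp add: mult.assoc)
      qed
      have a1: "16 * (R * psi N (q N) z) \<le> real N powr \<epsilon> * psi N (q N) z"
        and a2: "?o * (R * psi N (q N) z) \<le> real N powr \<epsilon> * psi N (q N) z"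
        and a3: "5 * (?r * R * conv_rate N (q N) z) \<le> real N powr \<epsilon> * conv_rate N (q N) z"
        using elim(4) absorb[of 16] absorb[of ?o] absorb[of "5 * ?r"] psi0 by (auto simp: mult.assoc)
      show "\<exists>B\<in>sets (M N). measure (M N) B \<le> real N powr - D \<and> (\<forall>\<omega>\<in>space (M N) - B.
          sc_close N (real N powr \<epsilon> * psi N (q N) z) (real N powr \<epsilon> * psi N (q N) z)
            (real N powr \<epsilon> * conv_rate N (q N) z) (H N \<omega>) z)"
        using B(1) \<open>prob B \<le> real N powr - D\<close> sc_close_mono[OF good a1 a2 a3] by blast
    qed
  qed
qed

text \<open>It suffices to cover the exceptional set by an event of small probability; that the set
  is itself an event comes from measurability of both sides.\<close>

lemma stoch_domI:
  assumes "\<And>\<epsilon> D. 0 < \<epsilon> \<Longrightarrow> 0 < D \<Longrightarrow> \<forall>\<^sub>F N in sequentially. K dvd N \<longrightarrow> (\<forall>u\<in>U N.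
      \<exists>B\<in>sets (M N). measure (M N) B \<le> real N powr - D \<and>
        (\<forall>\<omega>\<in>space (M N) - B. X N u \<omega> \<le> real N powr \<epsilon> * Y N u \<omega>))"
    and "\<forall>\<^sub>F N in sequentially. K dvd N \<longrightarrow> prob_space (M N) \<and>
      (\<forall>u\<in>U N. X N u \<in> borel_measurable (M N) \<and> Y N u \<in> borel_measurable (M N))"
  shows "stoch_dom K M U X Y"
  unfolding stoch_dom_def
proof (intro allI impI)
  fix \<epsilon> D :: real assume "0 < \<epsilon>" "0 < D"
  have "\<forall>\<^sub>F N in sequentially. K dvd N \<longrightarrow> (\<forall>u\<in>U N.
      {\<omega> \<in> space (M N). X N u \<omega> > real N powr \<epsilon> * Y N u \<omega>} \<in> sets (M N) \<and>
      measure (M N) {\<omega> \<in> space (M N). X N u \<omega> > real N powr \<epsilon> * Y N u \<omega>} \<le> real N powr - D)"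
    using assms(1)[OF \<open>0 < \<epsilon>\<close> \<open>0 < D\<close>] assms(2)
  proof eventually_elim
    case (elim N)
    show ?case
    proof (intro impI ballI)
      assume N: "K dvd N"
      fix u assume u: "u \<in> U N"
      interpret prob_space "M N" using elim(2) N by simp
      have [measurable]: "X N u \<in> borel_measurable (M N)" "Y N u \<in> borel_measurable (M N)"
        using elim(2) N u by auto
      let ?E = "{\<omega> \<in> space (M N). X N u \<omega> > real N powr \<epsilon> * Y N u \<omega>}"
      obtain B where B: "B \<in> events" "prob B \<le> real N powr - D"
        "\<And>\<omega>. \<omega> \<in> space (M N) - B \<Longrightarrow> X N u \<omega> \<le> real N powr \<epsilon> * Y N u \<omega>"
        using elim(1) N u by blast
      have "?E \<subseteq> B" using B(3) by force
      then have "prob ?E \<le> prob B" by (rule finite_measure_mono) (rule B)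
      moreover have "?E \<in> events" by measurable
      ultimately show "?E \<in> events \<and> prob ?E \<le> real N powr - D" using B(2) by simp
    qed
  qed
  then show "\<exists>N0. \<forall>N\<ge>N0. K dvd N \<longrightarrow> (\<forall>u\<in>U N.
      {\<omega> \<in> space (M N). X N u \<omega> > real N powr \<epsilon> * Y N u \<omega>} \<in> sets (M N) \<and>
      measure (M N) {\<omega> \<in> space (M N). X N u \<omega> > real N powr \<epsilon> * Y N u \<omega>} \<le> real N powr - D)"
    unfolding eventually_sequentially .
qed

text \<open>Each set under \<open>Max\<close> is rewritten as the image of a fixed finite index set,
  which makes the maximum one of finitely many measurable functions.\<close>

lemma (in balanced_sparse_matrix) observables_measurable:
  assumes z: "0 < Im z"
  shows "(\<lambda>\<omega>. Max {cmod (resolvent (H \<omega>) z $$ (i, j)) | i j. i < N \<and> j < N \<and> i \<noteq> j}) \<in> borel_measurable M"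
    "(\<lambda>\<omega>. Max {cmod (resolvent (H \<omega>) z $$ (i, i) - m_emp N (H \<omega>) z) | i. i < N}) \<in> borel_measurable M"
    "(\<lambda>\<omega>. cmod (m_emp N (H \<omega>) z - m_sc z)) \<in> borel_measurable M"
proof -
  have res: "sym_resolvent N (H \<omega>) z" if "\<omega> \<in> space M" for \<omega>
    by unfold_locales (use H_dim[OF that] H_symmetric[OF that] z in auto)
  have G: "(\<lambda>\<omega>. resolvent (H \<omega>) z $$ (i, j)) \<in> borel_measurable M" if "i < N" "j < N" for i j
    by (rule measurable_resolvent[OF res H_measurable that])
  have m: "(\<lambda>\<omega>. m_emp N (H \<omega>) z) \<in> borel_measurable M"
  proof (subst measurable_cong)
    show "m_emp N (H \<omega>) z = (\<Sum>i<N. resolvent (H \<omega>) z $$ (i, i)) / of_nat N" if "\<omega> \<in> space M" for \<omega>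
      by (rule m_emp_eq[OF res[OF that]])
    show "(\<lambda>\<omega>. (\<Sum>i<N. resolvent (H \<omega>) z $$ (i, i)) / of_nat N) \<in> borel_measurable M"
      by (intro borel_measurable_divide borel_measurable_sum borel_measurable_const G) auto
  qed
  have "{cmod (resolvent (H \<omega>) z $$ (i, j)) | i j. i < N \<and> j < N \<and> i \<noteq> j}
      = (\<lambda>p. cmod (resolvent (H \<omega>) z $$ p)) ` {(i, j). i < N \<and> j < N \<and> i \<noteq> j}" for \<omega> by auto
  moreover have "finite {(i, j). i < N \<and> j < N \<and> i \<noteq> j}"
    by (rule finite_subset[of _ "{..<N} \<times> {..<N}"]) auto
  moreover have "(\<lambda>\<omega>. cmod (resolvent (H \<omega>) z $$ p)) \<in> borel_measurable M"
    if "p \<in> {(i, j). i < N \<and> j < N \<and> i \<noteq> j}" for p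
    using that measurable_compose[OF G borel_measurable_norm, of "fst p" "snd p"] by auto
  ultimately show "(\<lambda>\<omega>. Max {cmod (resolvent (H \<omega>) z $$ (i, j)) | i j. i < N \<and> j < N \<and> i \<noteq> j}) \<in> borel_measurable M"
    by (simp only: borel_measurable_Max)
  have "{cmod (resolvent (H \<omega>) z $$ (i, i) - m_emp N (H \<omega>) z) | i. i < N}
      = (\<lambda>i. cmod (resolvent (H \<omega>) z $$ (i, i) - m_emp N (H \<omega>) z)) ` {..<N}" for \<omega> by auto
  moreover have "(\<lambda>\<omega>. cmod (resolvent (H \<omega>) z $$ (i, i) - m_emp N (H \<omega>) z)) \<in> borel_measurable M"
    if "i \<in> {..<N}" for i
    using that by (intro measurable_compose[OF borel_measurable_diff[OF G m] borel_measurable_norm]) auto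
  ultimately show "(\<lambda>\<omega>. Max {cmod (resolvent (H \<omega>) z $$ (i, i) - m_emp N (H \<omega>) z) | i. i < N}) \<in> borel_measurable M"
    by (simp only: borel_measurable_Max finite_lessThan)
  show "(\<lambda>\<omega>. cmod (m_emp N (H \<omega>) z - m_sc z)) \<in> borel_measurable M"
    by (rule measurable_compose[OF borel_measurable_diff[OF m borel_measurable_const] borel_measurable_norm])
qed

theorem theorem2p8:
  fixes K :: nat and \<phi> C c L :: real
    and M :: "nat \<Rightarrow> 'w measure"
    and V :: "nat \<Rightarrow> nat \<Rightarrow> nat set"
    and H :: "nat \<Rightarrow> 'w \<Rightarrow> real mat"
    and q :: "nat \<Rightarrow> real"
    and \<kappa>s \<kappa>d :: "nat \<Rightarrow> nat \<Rightarrow> real"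
  assumes "K \<ge> 1" and "\<phi> > 0" and "C > 0" and "c > 0" and "L \<ge> 1"
    and "\<forall>\<^sub>F N in sequentially. K dvd N \<longrightarrow>
      balanced_sparse_matrix (M N) N K (V N) (H N) \<phi> (q N) C c L (\<kappa>s N) (\<kappa>d N)"
  shows "\<exists>l0>0. \<forall>l. 0 < l \<and> l < l0 \<longrightarrow>
    stoch_dom K M (spectral_domain l)
      (\<lambda>N z \<omega>. Max {cmod (resolvent (H N \<omega>) z $$ (i, j)) | i j. i < N \<and> j < N \<and> i \<noteq> j})
      (\<lambda>N z \<omega>. psi N (q N) z) \<and>
    stoch_dom K M (spectral_domain l)
      (\<lambda>N z \<omega>. Max {cmod (resolvent (H N \<omega>) z $$ (i, i) - m_emp N (H N \<omega>) z) | i. i < N})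
      (\<lambda>N z \<omega>. psi N (q N) z) \<and>
    stoch_dom K M (spectral_domain l)
      (\<lambda>N z \<omega>. cmod (m_emp N (H N \<omega>) z - m_sc z))
      (\<lambda>N z \<omega>. 1 / sqrt (q N) + 1 / (real N * Im z) powr (1 / 3))"
proof (intro exI[of _ 1] conjI allI impI)
  let ?off = "\<lambda>N z \<omega>. Max {cmod (resolvent (H N \<omega>) z $$ (i, j)) | i j. i < N \<and> j < N \<and> i \<noteq> j}"
  let ?diag = "\<lambda>N z \<omega>. Max {cmod (resolvent (H N \<omega>) z $$ (i, i) - m_emp N (H N \<omega>) z) | i. i < N}"
  let ?tr = "\<lambda>N z \<omega>. cmod (m_emp N (H N \<omega>) z - m_sc z)"
  show "(0::real) < 1" by simp
  fix l :: real assume l: "0 < l \<and> l < 1"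
  have meas: "\<forall>\<^sub>F N in sequentially. K dvd N \<longrightarrow> prob_space (M N) \<and> (\<forall>z\<in>spectral_domain l N.
      ?off N z \<in> borel_measurable (M N) \<and> ?diag N z \<in> borel_measurable (M N) \<and> ?tr N z \<in> borel_measurable (M N))"
    using assms(6)
  proof eventually_elim
    case (elim N)
    show ?case
    proof (rule impI)
      assume "K dvd N"
      then interpret balanced_sparse_matrix "M N" N K "V N" "H N" \<phi> "q N" C c L "\<kappa>s N" "\<kappa>d N"
        using elim by simp
      have "0 < Im z" if "z \<in> spectral_domain l N" for z using that unfolding spectral_domain_def by simp
      then show "prob_space (M N) \<and> (\<forall>z\<in>spectral_domain l N.
          ?off N z \<in> borel_measurable (M N) \<and> ?diag N z \<in> borel_measurable (M N) \<and> ?tr N z \<in> borel_measurable (M N))"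
        by (intro conjI ballI prob_space_axioms observables_measurable)
    qed
  qed
  \<comment> \<open>The event of \<open>local_law_eventually\<close> serves all three estimates;
    \<open>X\<close> and \<open>Y\<close> stand for an observable and its bound.\<close>
  have law: "\<forall>\<^sub>F N in sequentially. K dvd N \<longrightarrow> (\<forall>z\<in>spectral_domain l N.
      \<exists>B\<in>sets (M N). measure (M N) B \<le> real N powr - D \<and> (\<forall>\<omega>\<in>space (M N) - B. X N z \<omega> \<le> real N powr \<epsilon> * Y N z))"
    if X: "\<And>N z \<omega>. 4 \<le> N \<Longrightarrow> sc_close N (real N powr \<epsilon> * psi N (q N) z) (real N powr \<epsilon> * psi N (q N) z)
       (real N powr \<epsilon> * conv_rate N (q N) z) (H N \<omega>) z \<Longrightarrow> X N z \<omega> \<le> real N powr \<epsilon> * Y N z"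
      and pos: "0 < \<epsilon>" "0 < D" for X Y \<epsilon> D
    using local_law_eventually[OF assms(1,2,5,6) conjunct1[OF l] conjunct2[OF l] pos] eventually_ge_at_top[of 4]
  proof eventually_elim
    case (elim N)
    show ?case
    proof (intro impI ballI)
      fix z assume N: "K dvd N" and z: "z \<in> spectral_domain l N"
      obtain B where B: "B \<in> sets (M N)" and B2: "measure (M N) B \<le> real N powr - D \<and>
          (\<forall>\<omega>\<in>space (M N) - B. sc_close N (real N powr \<epsilon> * psi N (q N) z) (real N powr \<epsilon> * psi N (q N) z)
            (real N powr \<epsilon> * conv_rate N (q N) z) (H N \<omega>) z)"
        using bspec[OF mp[OF elim(1) N] z] by (rule bexE)
      show "\<exists>B\<in>sets (M N). measure (M N) B \<le> real N powr - D \<and> (\<forall>\<omega>\<in>space (M N) - B. X N z \<omega> \<le> real N powr \<epsilon> * Y N z)"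
        by (intro bexI[OF _ B] conjI ballI conjunct1[OF B2] X[OF elim(2)] bspec[OF conjunct2[OF B2]])
    qed
  qed
  show "stoch_dom K M (spectral_domain l) ?off (\<lambda>N z \<omega>. psi N (q N) z)"
  proof (rule stoch_domI[OF law])
    fix \<epsilon> D :: real and N z \<omega>
    assume N: "4 \<le> N" and close: "sc_close N (real N powr \<epsilon> * psi N (q N) z) (real N powr \<epsilon> * psi N (q N) z)
       (real N powr \<epsilon> * conv_rate N (q N) z) (H N \<omega>) z"
    let ?S = "{cmod (resolvent (H N \<omega>) z $$ (i, j)) | i j. i < N \<and> j < N \<and> i \<noteq> j}"
    show "Max ?S \<le> real N powr \<epsilon> * psi N (q N) z"
    proof (rule Max.boundedI)
      show "finite ?S"
        by (rule finite_subset[of _ "(\<lambda>p. cmod (resolvent (H N \<omega>) z $$ p)) ` ({..<N} \<times> {..<N})"]) auto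
      \<comment> \<open>Nonemptiness matters because \<open>Max\<close> is unspecified on the empty
        set; \<open>4 \<le> N\<close> provides the index pair (0, 1).\<close>
      have "cmod (resolvent (H N \<omega>) z $$ (0, 1)) \<in> ?S"
        using N by (intro CollectI exI[of _ 0] exI[of _ 1]) auto
      then show "?S \<noteq> {}" by blast
    qed (use close in \<open>auto simp: sc_close_def\<close>)
  next
    show "\<forall>\<^sub>F N in sequentially. K dvd N \<longrightarrow> prob_space (M N) \<and> (\<forall>z\<in>spectral_domain l N.
      ?off N z \<in> borel_measurable (M N) \<and> (\<lambda>\<omega>. psi N (q N) z) \<in> borel_measurable (M N))"
      using meas by eventually_elim auto
  qed
  show "stoch_dom K M (spectral_domain l) ?diag (\<lambda>N z \<omega>. psi N (q N) z)"
  proof (rule stoch_domI[OF law])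
    fix \<epsilon> D :: real and N z \<omega>
    assume N: "4 \<le> N" and close: "sc_close N (real N powr \<epsilon> * psi N (q N) z) (real N powr \<epsilon> * psi N (q N) z)
       (real N powr \<epsilon> * conv_rate N (q N) z) (H N \<omega>) z"
    have "\<exists>i. i < N" using N by (intro exI[of _ 0]) simp
    then show "?diag N z \<omega> \<le> real N powr \<epsilon> * psi N (q N) z"
      by (intro Max.boundedI) (use close in \<open>auto simp: sc_close_def\<close>)
  next
    show "\<forall>\<^sub>F N in sequentially. K dvd N \<longrightarrow> prob_space (M N) \<and> (\<forall>z\<in>spectral_domain l N.
      ?diag N z \<in> borel_measurable (M N) \<and> (\<lambda>\<omega>. psi N (q N) z) \<in> borel_measurable (M N))"
      using meas by eventually_elim auto
  qed
  show "stoch_dom K M (spectral_domain l) ?tr (\<lambda>N z \<omega>. 1 / sqrt (q N) + 1 / (real N * Im z) powr (1 / 3))"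
    unfolding conv_rate_def[symmetric]
  proof (rule stoch_domI[OF law])
    show "\<forall>\<^sub>F N in sequentially. K dvd N \<longrightarrow> prob_space (M N) \<and> (\<forall>z\<in>spectral_domain l N.
      ?tr N z \<in> borel_measurable (M N) \<and> (\<lambda>\<omega>. conv_rate N (q N) z) \<in> borel_measurable (M N))"
      using meas by eventually_elim auto
  qed (auto simp: sc_close_def)
qed

end
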